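(* Let $(K_1|K,v)$ be a countable separable-algebraic extension of non-trivially valued fields. Then there is an extension of $v$ from $K_1$ to the algebraic closure $\widetilde{K_1(x)}=\widetilde{K(x)}$ of the rational function field $K(x)$ in one variable such that, upon taking henselizations in $(\widetilde{K(x)},v)$, $$K_1^h=\mathrm{IC}(K(x)|K,v).$$
   Context: A tilde denotes algebraic closure. "Countable" separable-algebraic extension means countably generated (possibly finite). For a subfield $L$ of $\widetilde{K(x)}$, where a valuation $v$ on $\widetilde{K(x)}$ is fixed, $L^h$ denotes the henselization of $(L,v)$ inside $(\widetilde{K(x)},v)$. The implicit constant field $\mathrm{IC}(K(x)|K,v)$ is the relative algebraic closure of $K$ in $K(x)^h$. *)

theory Defs
  imports
    "HOL-Algebra.Group"
    "HOL-Computational_Algebra.Polynomial"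
    "HOL-Library.Countable_Set"
begin

section \<open>Subfields of a field\<close>

text \<open>
  All fields are subsets of one ambient field, given as a type \<open>'a\<close>. In the application
  \<open>'a\<close> is algebraically closed.
\<close>

definition is_subfield :: "'a::field set \<Rightarrow> bool" where
  "is_subfield F \<longleftrightarrow> 1 \<in> F \<and> (\<forall>a\<in>F. \<forall>b\<in>F. a - b \<in> F) \<and> (\<forall>a\<in>F. \<forall>b\<in>F. a * b \<in> F) \<and>
     (\<forall>a\<in>F. inverse a \<in> F)"

definition field_adjoin :: "'a::field set \<Rightarrow> 'a set \<Rightarrow> 'a set" where
  "field_adjoin K S = \<Inter>{F. is_subfield F \<and> K \<union> S \<subseteq> F}"

definition poly_over :: "'a::field set \<Rightarrow> 'a poly \<Rightarrow> bool" where
  "poly_over K p \<longleftrightarrow> (\<forall>i. coeff p i \<in> K)"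

definition algebraic_over :: "'a::field set \<Rightarrow> 'a \<Rightarrow> bool" where
  "algebraic_over K a \<longleftrightarrow> (\<exists>p. p \<noteq> 0 \<and> poly_over K p \<and> poly p a = 0)"

definition is_minpoly :: "'a::field set \<Rightarrow> 'a \<Rightarrow> 'a poly \<Rightarrow> bool" where
  "is_minpoly K a p \<longleftrightarrow> poly_over K p \<and> lead_coeff p = 1 \<and> poly p a = 0 \<and>
     (\<forall>q. q \<noteq> 0 \<and> poly_over K q \<and> poly q a = 0 \<longrightarrow> degree p \<le> degree q)"

text \<open>
  \<^const>\<open>rsquarefree\<close> says that no root in the type \<open>'a\<close> is multiple. Since \<open>'a\<close> is algebraically
  closed, this is separability of the minimal polynomial.
\<close>

definition separable_over :: "'a::alg_closed_field set \<Rightarrow> 'a \<Rightarrow> bool" where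
  "separable_over K a \<longleftrightarrow> (\<exists>p. is_minpoly K a p \<and> rsquarefree p)"

definition separable_algebraic_extension :: "'a::alg_closed_field set \<Rightarrow> 'a set \<Rightarrow> bool" where
  "separable_algebraic_extension K L \<longleftrightarrow>
     is_subfield K \<and> is_subfield L \<and> K \<subseteq> L \<and> (\<forall>a\<in>L. separable_over K a)"

definition countably_generated_extension :: "'a::field set \<Rightarrow> 'a set \<Rightarrow> bool" where
  "countably_generated_extension K L \<longleftrightarrow> (\<exists>S. countable S \<and> L = field_adjoin K S)"

definition relative_algebraic_closure :: "'a::field set \<Rightarrow> 'a set \<Rightarrow> 'a set" where
  "relative_algebraic_closure K L = {a \<in> L. algebraic_over K a}"


section \<open>Krull valuations\<close>

text \<open>
  Value groups are written multiplicatively, as in \<^theory>\<open>HOL-Algebra.Group\<close>, but the order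
  convention is the additive one: \<open>\<one>\<close> plays the role of the value \<open>0\<close>, and elements of the
  valuation ring have values \<open>\<ge> \<one>\<close>.
\<close>

record 'g value_group = "'g monoid" +
  vle :: "'g \<Rightarrow> 'g \<Rightarrow> bool"

locale ordered_value_group = comm_group \<Gamma> for \<Gamma> :: "'g value_group" (structure) +
  assumes vle_antisym:
      "\<lbrakk>g \<in> carrier \<Gamma>; h \<in> carrier \<Gamma>; vle \<Gamma> g h; vle \<Gamma> h g\<rbrakk> \<Longrightarrow> g = h"
    and vle_trans:
      "\<lbrakk>g \<in> carrier \<Gamma>; h \<in> carrier \<Gamma>; k \<in> carrier \<Gamma>; vle \<Gamma> g h; vle \<Gamma> h k\<rbrakk> \<Longrightarrow> vle \<Gamma> g k"
    and vle_total:
      "\<lbrakk>g \<in> carrier \<Gamma>; h \<in> carrier \<Gamma>\<rbrakk> \<Longrightarrow> vle \<Gamma> g h \<or> vle \<Gamma> h g"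
    and vle_mult:
      "\<lbrakk>g \<in> carrier \<Gamma>; h \<in> carrier \<Gamma>; k \<in> carrier \<Gamma>; vle \<Gamma> g h\<rbrakk> \<Longrightarrow> vle \<Gamma> (g \<otimes> k) (h \<otimes> k)"

text \<open>
  A valuation is only constrained on nonzero arguments. The value of \<open>0\<close> is \<open>\<infinity>\<close>, so \<open>v 0\<close> is a
  junk value and \<open>0\<close> is treated separately wherever it matters. The group is required to be the
  full value group, that is, \<open>v\<close> is onto.
\<close>

definition valuation_on :: "'a::field set \<Rightarrow> 'g value_group \<Rightarrow> ('a \<Rightarrow> 'g) \<Rightarrow> bool" where
  "valuation_on F \<Gamma> v \<longleftrightarrow>
     is_subfield F \<and> ordered_value_group \<Gamma> \<and> v ` (F - {0}) = carrier \<Gamma> \<and>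
     (\<forall>a\<in>F - {0}. \<forall>b\<in>F - {0}. v (a * b) = v a \<otimes>\<^bsub>\<Gamma>\<^esub> v b) \<and>
     (\<forall>a\<in>F - {0}. \<forall>b\<in>F - {0}. a + b \<noteq> 0 \<longrightarrow>
        vle \<Gamma> (v a) (v (a + b)) \<or> vle \<Gamma> (v b) (v (a + b)))"

definition nontrivial_on :: "'a::field set \<Rightarrow> 'g value_group \<Rightarrow> ('a \<Rightarrow> 'g) \<Rightarrow> bool" where
  "nontrivial_on F \<Gamma> v \<longleftrightarrow> (\<exists>a\<in>F - {0}. v a \<noteq> \<one>\<^bsub>\<Gamma>\<^esub>)"

text \<open>
  The valuation \<open>w\<close> with value group \<open>\<Delta>\<close> extends \<open>v\<close> with value group \<open>\<Gamma>\<close> from \<open>F\<close>: the restriction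
  of \<open>w\<close> to \<open>F\<close> is \<open>v\<close>, up to an embedding of ordered groups of \<open>\<Gamma>\<close> into \<open>\<Delta>\<close>.
\<close>

definition extends_valuation ::
  "'a::field set \<Rightarrow> 'g value_group \<Rightarrow> ('a \<Rightarrow> 'g) \<Rightarrow> 'h value_group \<Rightarrow> ('a \<Rightarrow> 'h) \<Rightarrow> bool" where
  "extends_valuation F \<Gamma> v \<Delta> w \<longleftrightarrow>
     (\<exists>\<iota>\<in>hom \<Gamma> \<Delta>.
        (\<forall>g\<in>carrier \<Gamma>. \<forall>h\<in>carrier \<Gamma>. vle \<Gamma> g h \<longleftrightarrow> vle \<Delta> (\<iota> g) (\<iota> h)) \<and>
        (\<forall>a\<in>F - {0}. w a = \<iota> (v a)))"


section \<open>Henselizations\<close>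

definition valuation_ring :: "'a::field set \<Rightarrow> 'g value_group \<Rightarrow> ('a \<Rightarrow> 'g) \<Rightarrow> 'a set" where
  "valuation_ring F \<Gamma> v = {a \<in> F. a = 0 \<or> vle \<Gamma> \<one>\<^bsub>\<Gamma>\<^esub> (v a)}"

definition valuation_ideal :: "'a::field set \<Rightarrow> 'g value_group \<Rightarrow> ('a \<Rightarrow> 'g) \<Rightarrow> 'a set" where
  "valuation_ideal F \<Gamma> v = {a \<in> F. a = 0 \<or> (vle \<Gamma> \<one>\<^bsub>\<Gamma>\<^esub> (v a) \<and> v a \<noteq> \<one>\<^bsub>\<Gamma>\<^esub>)}"

text \<open>
  A valued field is henselian if it satisfies Hensel's Lemma: if \<open>f\<close> has coefficients in the
  valuation ring and \<open>a\<close> in the valuation ring satisfies \<open>v (f a) > 0\<close> and \<open>v (f' a) = 0\<close>, then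
  \<open>f\<close> has a root \<open>b\<close> in the valuation ring with \<open>v (b - a) > 0\<close>. The valuation of \<open>F\<close> is the
  restriction of a valuation that may be defined on a larger field.
\<close>

definition henselian :: "'a::field set \<Rightarrow> 'g value_group \<Rightarrow> ('a \<Rightarrow> 'g) \<Rightarrow> bool" where
  "henselian F \<Gamma> v \<longleftrightarrow>
     (\<forall>f a. (\<forall>i. coeff f i \<in> valuation_ring F \<Gamma> v) \<and> a \<in> valuation_ring F \<Gamma> v \<and>
        poly f a \<in> valuation_ideal F \<Gamma> v \<and>
        poly (pderiv f) a \<noteq> 0 \<and> v (poly (pderiv f) a) = \<one>\<^bsub>\<Gamma>\<^esub> \<longrightarrow>
        (\<exists>b\<in>valuation_ring F \<Gamma> v. poly f b = 0 \<and> b - a \<in> valuation_ideal F \<Gamma> v))"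

text \<open>
  For a valuation \<open>v\<close> on the whole algebraically closed field \<open>'a\<close>, the henselization of a subfield
  \<open>L\<close> inside \<open>('a, v)\<close> is the smallest subfield containing \<open>L\<close> that is henselian with respect to
  the restriction of \<open>v\<close>.
\<close>

definition henselization ::
  "'g value_group \<Rightarrow> ('a::alg_closed_field \<Rightarrow> 'g) \<Rightarrow> 'a set \<Rightarrow> 'a set" where
  "henselization \<Gamma> v L = \<Inter>{F. is_subfield F \<and> L \<subseteq> F \<and> henselian F \<Gamma> v}"

definition implicit_constant_field ::
  "'g value_group \<Rightarrow> ('a::alg_closed_field \<Rightarrow> 'g) \<Rightarrow> 'a set \<Rightarrow> 'a \<Rightarrow> 'a set" where
  "implicit_constant_field \<Gamma> v K x =
     relative_algebraic_closure K (henselization \<Gamma> v (field_adjoin K {x}))"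

end

theory Submission
  imports Defs "HOL-Computational_Algebra.Primes"
begin

text \<open>
  Extend \<open>v\<close> to the algebraic closure of \<open>K\<close> and list nonzero generators \<open>s 0, s 1, \<dots>\<close> of \<open>K1\<close> over
  \<open>K\<close>. Since \<open>K\<close> is cofinal in the value group of its algebraic closure, one can choose
  \<open>a (n + 1) = a n + d n * s n\<close> with \<open>d n \<in> K\<close> such that the values of the increments increase and
  exceed the Krasner constant of \<open>a n\<close>. If \<open>x\<close> is placed at least as close to \<open>a n\<close> as \<open>a (n + 1)\<close> is,
  for all \<open>n\<close>, then Krasner's lemma puts every \<open>a n\<close>, hence \<open>K1\<close>, into \<open>K(x)\<^sup>h\<close>. If some
  \<open>K(a N)\<^sup>h\<close> contains \<open>K1\<close>, place \<open>x\<close> infinitely close to \<open>a N\<close> instead. Otherwise the \<open>a n\<close> have no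
  limit in the algebraic closure, because a limit \<open>c\<close> would make \<open>K(a n)\<^sup>h\<close> a strictly increasing
  sequence inside \<open>K(c)\<^sup>h\<close>.

  In both cases every \<open>x - c\<close> with \<open>c\<close> algebraic has the value of some \<open>b - c\<close> with \<open>b \<in> K1\<close>, unless
  \<open>c \<in> K1\<close>. Hence an automorphism over \<open>K1\<^sup>h(x)\<close> preserves the valuation on the algebraic closure of
  \<open>K\<close> with \<open>x\<close> adjoined, and it can be corrected to preserve it everywhere. Such automorphisms fix
  \<open>K(x)\<^sup>h\<close>, so an algebraic \<open>c \<in> K(x)\<^sup>h\<close> is purely inseparable over \<open>K1\<^sup>h\<close>. It lies in \<open>K1\<^sup>h\<close>, since
  henselizations are contained in every field that is closed under adjoining simple roots.
\<close>

section \<open>Subfields and algebraic elements\<close>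

text \<open>Values are compared through valuation rings; value groups reappear only at the end. The
  obstacle is that the valuation of the ambient field is prescribed only on the algebraic closure of
  \<open>K\<close> and along \<open>x\<close>, so each step has to respect the subfield on which it
  is known.

  The increments are multiples of \<open>s n\<close> because \<open>K(a n, a (n + 1))\<close> then
  contains \<open>s n\<close>; the factor \<open>d n\<close> can have arbitrarily large value
  because algebraic values are torsion over those of \<open>K\<close>. A henselization is fixed by
  every valuation-preserving automorphism over its base, since Hensel roots are unique. An
  automorphism over \<open>K1^h(x)\<close> preserves values of rational functions in
  \<open>x\<close> with algebraic coefficients, as polynomials split into factors
  \<open>x - c\<close>; but \<open>K(x)^h\<close> need not consist of such functions, whence the
  correction, which leaves the action on algebraic elements unchanged. In positive characteristic a
  fixed element is only known to have a \<open>p\<close>-power in \<open>K1^h(x)\<close>, hence the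
  detour through fields closed under simple roots: these are henselian for every valuation
  ring.\<close>

definition is_subring :: "'a::comm_ring_1 set \<Rightarrow> bool" where
  "is_subring R \<longleftrightarrow> 1 \<in> R \<and> (\<forall>a\<in>R. \<forall>b\<in>R. a - b \<in> R) \<and> (\<forall>a\<in>R. \<forall>b\<in>R. a * b \<in> R)"

lemma is_subringD:
  assumes "is_subring R"
  shows "1 \<in> R" "0 \<in> R"
    and "\<And>a b. a \<in> R \<Longrightarrow> b \<in> R \<Longrightarrow> a - b \<in> R"
    and "\<And>a b. a \<in> R \<Longrightarrow> b \<in> R \<Longrightarrow> a + b \<in> R"
    and "\<And>a b. a \<in> R \<Longrightarrow> b \<in> R \<Longrightarrow> a * b \<in> R"
    and "\<And>a. a \<in> R \<Longrightarrow> - a \<in> R"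
    and "\<And>a n. a \<in> R \<Longrightarrow> a ^ n \<in> R"
proof -
  show 1: "1 \<in> R" using assms unfolding is_subring_def by blast
  show d: "\<And>a b. a \<in> R \<Longrightarrow> b \<in> R \<Longrightarrow> a - b \<in> R"
    and m: "\<And>a b. a \<in> R \<Longrightarrow> b \<in> R \<Longrightarrow> a * b \<in> R"
    using assms unfolding is_subring_def by blast+
  show 0: "0 \<in> R" using d[OF 1 1] by simp
  show u: "\<And>a. a \<in> R \<Longrightarrow> - a \<in> R" using d[OF 0] by simp
  show "\<And>a b. a \<in> R \<Longrightarrow> b \<in> R \<Longrightarrow> a + b \<in> R" using d u by (metis diff_minus_eq_add)
  show "\<And>a n. a \<in> R \<Longrightarrow> a ^ n \<in> R" subgoal for a n by (induction n) (auto intro: 1 m) done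
qed

lemma subfield_imp_subring: "is_subfield F \<Longrightarrow> is_subring F"
  unfolding is_subfield_def is_subring_def by blast

lemma is_subfieldD:
  assumes "is_subfield F"
  shows "1 \<in> F" "0 \<in> F"
    and "\<And>a b. a \<in> F \<Longrightarrow> b \<in> F \<Longrightarrow> a - b \<in> F"
    and "\<And>a b. a \<in> F \<Longrightarrow> b \<in> F \<Longrightarrow> a + b \<in> F"
    and "\<And>a b. a \<in> F \<Longrightarrow> b \<in> F \<Longrightarrow> a * b \<in> F"
    and "\<And>a. a \<in> F \<Longrightarrow> inverse a \<in> F"
    and "\<And>a. a \<in> F \<Longrightarrow> - a \<in> F"
    and "\<And>a b. a \<in> F \<Longrightarrow> b \<in> F \<Longrightarrow> a / b \<in> F"
    and "\<And>a n. a \<in> F \<Longrightarrow> a ^ n \<in> F"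
  using assms is_subringD[OF subfield_imp_subring[OF assms]]
  by (simp_all add: is_subfield_def divide_inverse)

lemma subring_sum:
  assumes "is_subring R" "\<And>i. i \<in> A \<Longrightarrow> f i \<in> R"
  shows "sum f A \<in> R"
  using assms(2) by (induction A rule: infinite_finite_induct) (auto intro: is_subringD[OF assms(1)])

lemma subring_prod:
  assumes "is_subring R" "\<And>i. i \<in> A \<Longrightarrow> f i \<in> R"
  shows "prod f A \<in> R"
  using assms(2) by (induction A rule: infinite_finite_induct) (auto intro: is_subringD[OF assms(1)])

lemma is_subfield_UNIV [simp]: "is_subfield UNIV"
  by (simp add: is_subfield_def)

lemma is_subfield_Inter: "(\<And>F. F \<in> \<F> \<Longrightarrow> is_subfield F) \<Longrightarrow> is_subfield (\<Inter>\<F>)"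
  unfolding is_subfield_def by blast

lemma is_subfield_Int: "is_subfield F \<Longrightarrow> is_subfield G \<Longrightarrow> is_subfield (F \<inter> G)"
  unfolding is_subfield_def by blast

lemma field_adjoin_subfield [intro]: "is_subfield (field_adjoin K S)"
  unfolding field_adjoin_def by (rule is_subfield_Inter) auto

lemma field_adjoin_incl: "K \<subseteq> field_adjoin K S" "S \<subseteq> field_adjoin K S"
  unfolding field_adjoin_def by auto

lemma field_adjoin_least: "is_subfield F \<Longrightarrow> K \<subseteq> F \<Longrightarrow> S \<subseteq> F \<Longrightarrow> field_adjoin K S \<subseteq> F"
  unfolding field_adjoin_def by auto

subsection \<open>Polynomials with coefficients in a subring\<close>

lemma poly_overD: "poly_over K p \<Longrightarrow> coeff p i \<in> K"
  by (simp add: poly_over_def)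

lemma poly_over_mono: "poly_over K p \<Longrightarrow> K \<subseteq> L \<Longrightarrow> poly_over L p"
  by (auto simp: poly_over_def)

context
  fixes R :: "'a::field set"
  assumes R: "is_subring R"
begin

lemma poly_over_0: "poly_over R 0"
  and poly_over_1: "poly_over R 1"
  using is_subringD[OF R] by (auto simp: poly_over_def coeff_1)

lemma poly_over_add: "poly_over R p \<Longrightarrow> poly_over R q \<Longrightarrow> poly_over R (p + q)"
  and poly_over_diff: "poly_over R p \<Longrightarrow> poly_over R q \<Longrightarrow> poly_over R (p - q)"
  and poly_over_smult: "c \<in> R \<Longrightarrow> poly_over R p \<Longrightarrow> poly_over R (smult c p)"
  using is_subringD[OF R] by (auto simp: poly_over_def)

lemma poly_over_mult: "poly_over R p \<Longrightarrow> poly_over R q \<Longrightarrow> poly_over R (p * q)"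
  using is_subringD[OF R] by (auto simp: poly_over_def coeff_mult intro!: subring_sum[OF R])

lemma poly_over_monom: "c \<in> R \<Longrightarrow> poly_over R (monom c n)"
  using is_subringD[OF R] by (auto simp: poly_over_def)

lemma poly_over_pCons: "c \<in> R \<Longrightarrow> poly_over R p \<Longrightarrow> poly_over R (pCons c p)"
  by (auto simp: poly_over_def coeff_pCons split: nat.splits)

lemma poly_over_pCons_iff: "poly_over R (pCons c p) \<longleftrightarrow> c \<in> R \<and> poly_over R p"
  by (auto simp: poly_over_def coeff_pCons split: nat.splits)

lemma poly_over_prod: "(\<And>i. i \<in> A \<Longrightarrow> poly_over R (f i)) \<Longrightarrow> poly_over R (prod f A)"
  by (induction A rule: infinite_finite_induct) (auto intro: poly_over_1 poly_over_mult)

lemma poly_over_power: "poly_over R p \<Longrightarrow> poly_over R (p ^ n)"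
  by (induction n) (auto intro: poly_over_1 poly_over_mult)

lemma poly_over_pcompose: "poly_over R p \<Longrightarrow> poly_over R q \<Longrightarrow> poly_over R (pcompose p q)"
proof (induction p)
  case 0
  then show ?case by (simp add: poly_over_0)
next
  case (pCons a p)
  then show ?case
    by (auto simp: pcompose_pCons poly_over_pCons_iff intro!: poly_over_add poly_over_mult
        poly_over_pCons poly_over_0)
qed

lemma poly_over_pderiv: "poly_over R p \<Longrightarrow> poly_over R (pderiv p)"
proof (induction p)
  case 0
  then show ?case by (simp add: poly_over_0)
next
  case (pCons a p)
  then show ?case
    by (auto simp: pderiv_pCons poly_over_pCons_iff intro!: poly_over_add
        poly_over_pCons is_subringD[OF R])
qed

lemma poly_in_subring: "poly_over R p \<Longrightarrow> a \<in> R \<Longrightarrow> poly p a \<in> R"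
  by (auto simp: poly_altdef poly_over_def intro!: subring_sum[OF R] is_subringD[OF R])

lemma poly_over_synthetic_div: "poly_over R p \<Longrightarrow> c \<in> R \<Longrightarrow> poly_over R (synthetic_div p c)"
  by (induction p) (auto simp: poly_over_0 poly_over_pCons_iff poly_in_subring)

end

text \<open>For a subring this is the ring generated by \<open>a\<close> over it. For an ideal
  \<open>I\<close> of a subring \<open>A\<close> it is the extension of \<open>I\<close> to that
  ring over \<open>A\<close>.\<close>

definition poly_values :: "'a::field set \<Rightarrow> 'a \<Rightarrow> 'a set" where
  "poly_values R a = {poly g a | g. poly_over R g}"

lemma poly_values:
  assumes R: "is_subring R"
  shows "is_subring (poly_values R a)" "R \<subseteq> poly_values R a" "a \<in> poly_values R a"
proof -
  have I: "poly_over R g \<Longrightarrow> poly g a \<in> poly_values R a" for g unfolding poly_values_def by blast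
  show "is_subring (poly_values R a)"
    unfolding is_subring_def
  proof (intro conjI ballI)
    show "1 \<in> poly_values R a" using I[OF poly_over_1[OF R]] by simp
    fix x y assume "x \<in> poly_values R a" "y \<in> poly_values R a"
    then obtain g h where "poly_over R g" "x = poly g a" "poly_over R h" "y = poly h a"
      unfolding poly_values_def by blast
    then show "x - y \<in> poly_values R a" "x * y \<in> poly_values R a"
      using I[of "g - h"] I[of "g * h"] poly_over_diff[OF R] poly_over_mult[OF R] by simp_all
  qed
  show "R \<subseteq> poly_values R a"
  proof
    fix r assume "r \<in> R"
    then show "r \<in> poly_values R a"
      using I[of "[:r:]"] by (simp add: poly_over_pCons_iff[OF R] poly_over_0[OF R])
  qed
  show "a \<in> poly_values R a"
    using I[of "[:0, 1:]"] by (simp add: poly_over_pCons_iff[OF R] poly_over_0[OF R] is_subringD[OF R])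
qed

lemma poly_over_reflect:
  assumes "is_subring R" "poly_over R p"
  shows "poly_over R (reflect_poly p)"
  using assms(2) is_subringD[OF assms(1)] by (auto simp: poly_over_def coeff_reflect_poly)

text \<open>The divisor is monic, so no leading coefficient has to be inverted and everything stays
  over the subring.\<close>

lemma poly_over_reduce:
  fixes m :: "'a::field poly"
  assumes R: "is_subring R" and m: "poly_over R m" "lead_coeff m = 1" and g: "poly_over R g"
  shows "\<exists>q r. poly_over R q \<and> poly_over R r \<and> g = q * m + r \<and> (r = 0 \<or> degree r < degree m)"
  using g
proof (induction "degree g" arbitrary: g rule: less_induct)
  case less
  show ?case
  proof (cases "g = 0 \<or> degree g < degree m")
    case True
    then show ?thesis using less.prems poly_over_0[OF R]
      by (intro exI[of _ 0] exI[of _ g]) auto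
  next
    case False
    define t where "t = monom (lead_coeff g) (degree g - degree m)"
    have t: "poly_over R t"
      unfolding t_def by (intro poly_over_monom[OF R] poly_overD[OF less.prems])
    have m0: "m \<noteq> 0" using m by auto
    define h where "h = g - t * m"
    have h: "poly_over R h" unfolding h_def
      by (intro poly_over_diff[OF R] poly_over_mult[OF R] less.prems t m)
    have dt: "degree (t * m) = degree g"
      using False m0 by (simp add: t_def degree_mult_eq degree_monom_eq)
    have lt: "coeff (t * m) (degree g) = lead_coeff g"
      using lead_coeff_mult[of t m] m(2) False
      by (simp add: dt) (simp add: t_def degree_monom_eq)
    have dh: "h = 0 \<or> degree h < degree g"
    proof (cases "degree g = 0")
      case True
      then have "coeff h i = 0" for i
        using lt dt by (cases i) (auto simp: h_def coeff_eq_0)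
      then show ?thesis by (simp add: poly_eq_iff)
    next
      case False
      have "degree h \<le> degree g" unfolding h_def using dt by (simp add: degree_diff_le)
      moreover have "coeff h (degree g) = 0" using lt by (simp add: h_def)
      ultimately show ?thesis
        by (metis leading_coeff_0_iff le_neq_implies_less)
    qed
    obtain q r where qr: "poly_over R q" "poly_over R r" "h = q * m + r" "r = 0 \<or> degree r < degree m"
    proof (cases "h = 0")
      case True
      then show ?thesis using that[of 0 0] poly_over_0[OF R] by auto
    next
      case False
      then show ?thesis using less.hyps[OF _ h] dh that by blast
    qed
    then show ?thesis
      by (intro exI[of _ "t + q"] exI[of _ r])
         (auto simp: h_def algebra_simps intro: poly_over_add[OF R] t)
  qed
qed

subsection \<open>Minimal polynomials\<close>

lemma algebraic_over_mono: "algebraic_over K a \<Longrightarrow> K \<subseteq> L \<Longrightarrow> algebraic_over L a"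
  unfolding algebraic_over_def by (meson poly_over_mono)

lemma algebraic_over_self:
  assumes "is_subfield F" "a \<in> F" shows "algebraic_over F a"
  unfolding algebraic_over_def
  by (intro exI[of _ "[:-a, 1:]"])
     (use assms is_subfieldD[OF assms(1)] in \<open>auto simp: poly_over_def coeff_pCons split: nat.splits\<close>)

lemma minpoly_exists:
  assumes F: "is_subfield F" and a: "algebraic_over F a"
  shows "\<exists>m. is_minpoly F a m"
proof -
  let ?P = "\<lambda>n. \<exists>p. p \<noteq> 0 \<and> poly_over F p \<and> poly p a = 0 \<and> degree p = n"
  have "\<exists>n. ?P n" using a unfolding algebraic_over_def by blast
  then obtain p where p: "p \<noteq> 0" "poly_over F p" "poly p a = 0" "degree p = (LEAST n. ?P n)"
    using LeastI_ex[of ?P] by blast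
  have min: "degree p \<le> degree q" if "q \<noteq> 0" "poly_over F q" "poly q a = 0" for q
    using Least_le[of ?P "degree q"] that p(4) by auto
  let ?m = "smult (inverse (lead_coeff p)) p"
  have "is_minpoly F a ?m"
    unfolding is_minpoly_def
    using p(1-3) min is_subfieldD(6)[OF F poly_overD[OF p(2)]] poly_over_smult[OF subfield_imp_subring[OF F]]
    by auto
  then show ?thesis ..
qed

lemma is_minpolyD:
  assumes "is_minpoly F a m"
  shows "poly_over F m" "lead_coeff m = 1" "poly m a = 0" "m \<noteq> 0" "degree m > 0"
    "\<And>q. q \<noteq> 0 \<Longrightarrow> poly_over F q \<Longrightarrow> poly q a = 0 \<Longrightarrow> degree m \<le> degree q"
proof -
  show *: "poly_over F m" "lead_coeff m = 1" "poly m a = 0"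
    "\<And>q. q \<noteq> 0 \<Longrightarrow> poly_over F q \<Longrightarrow> poly q a = 0 \<Longrightarrow> degree m \<le> degree q"
    using assms by (auto simp: is_minpoly_def)
  show "m \<noteq> 0" using * by auto
  show "degree m > 0"
  proof (rule ccontr)
    assume "\<not> ?thesis"
    then obtain c where "m = [:c:]" by (meson degree_eq_zeroE gr0I)
    then show False using * by auto
  qed
qed

lemma minpoly_divides:
  assumes F: "is_subfield F" and m: "is_minpoly F a m" and q: "poly_over F q" "poly q a = 0"
  shows "\<exists>s. poly_over F s \<and> q = s * m"
proof -
  obtain s r where sr: "poly_over F s" "poly_over F r" "q = s * m + r" "r = 0 \<or> degree r < degree m"
    using poly_over_reduce[OF subfield_imp_subring[OF F] is_minpolyD(1,2)[OF m] q(1)] by blast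
  have "poly r a = 0" using sr(3) q(2) is_minpolyD(3)[OF m] by simp
  then have "r = 0" using is_minpolyD(6)[OF m _ sr(2)] sr(4) by fastforce
  then show ?thesis using sr by auto
qed

text \<open>Irreducibility: in \<open>m = s * n\<close> with \<open>n\<close> minimal for
  \<open>b\<close>, the element \<open>a\<close> cannot be a root of the shorter factor
  \<open>s\<close>, so \<open>n\<close> vanishes at \<open>a\<close> and is no shorter than
  \<open>m\<close>.\<close>

lemma minpoly_root:
  assumes F: "is_subfield F" and m: "is_minpoly F a m" and b: "poly m b = 0"
  shows "is_minpoly F b m"
proof -
  have "algebraic_over F b"
    using is_minpolyD[OF m] b unfolding algebraic_over_def by blast
  then obtain n where n: "is_minpoly F b n" using minpoly_exists[OF F] by blast
  obtain s where s: "poly_over F s" "m = s * n"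
    using minpoly_divides[OF F n is_minpolyD(1)[OF m] b] by blast
  have s0: "s \<noteq> 0" "n \<noteq> 0" using s is_minpolyD(4)[OF m] by auto
  have deg: "degree m = degree s + degree n" using s s0 by (simp add: degree_mult_eq)
  have "poly s a = 0 \<or> poly n a = 0" using is_minpolyD(3)[OF m] s by simp
  then have "poly n a = 0"
    using is_minpolyD(6)[OF m s0(1) s(1)] deg is_minpolyD(5)[OF n] by fastforce
  then have "degree m \<le> degree n"
    using is_minpolyD(6)[OF m s0(2) is_minpolyD(1)[OF n]] by simp
  then show ?thesis
    using n m b unfolding is_minpoly_def by (meson le_trans)
qed

lemma degree_pderiv_less:
  fixes p :: "'a::field poly"
  assumes "degree p > 0" shows "degree (pderiv p) < degree p"
proof -
  have "degree (pderiv p) \<le> degree p - 1"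
    by (rule degree_le) (auto simp: coeff_pderiv coeff_eq_0)
  with assms show ?thesis by linarith
qed

lemma linear_power2_dvd_iff:
  fixes p :: "'a::field poly"
  shows "[:-a, 1:]\<^sup>2 dvd p \<longleftrightarrow> poly p a = 0 \<and> poly (pderiv p) a = 0"
proof
  assume "[:-a, 1:]\<^sup>2 dvd p"
  then obtain q where "p = [:-a, 1:] * ([:-a, 1:] * q)"
    unfolding dvd_def power2_eq_square mult.assoc by blast
  then show "poly p a = 0 \<and> poly (pderiv p) a = 0"
    by (simp only: pderiv_mult) (simp add: pderiv_pCons)
next
  assume *: "poly p a = 0 \<and> poly (pderiv p) a = 0"
  then obtain q where q: "p = [:-a, 1:] * q" by (auto simp: poly_eq_0_iff_dvd dvd_def)
  have "poly q a = 0"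
    using * unfolding q by (simp only: pderiv_mult) (simp add: pderiv_pCons)
  then obtain r where "q = [:-a, 1:] * r" by (auto simp: poly_eq_0_iff_dvd dvd_def)
  then have "p = [:-a, 1:]\<^sup>2 * r"
    using q by (simp only: power2_eq_square mult.assoc)
  then show "[:-a, 1:]\<^sup>2 dvd p" by (rule dvdI)
qed

lemma rsquarefree_iff:
  fixes p :: "'a::field poly"
  shows "rsquarefree p \<longleftrightarrow> p \<noteq> 0 \<and> (\<forall>a. poly p a = 0 \<longrightarrow> poly (pderiv p) a \<noteq> 0)"
proof (cases "p = 0")
  case False
  have "(order a p = 0 \<or> order a p = 1) \<longleftrightarrow> \<not> 2 \<le> order a p" for a by auto
  also have "\<dots> a \<longleftrightarrow> \<not> (poly p a = 0 \<and> poly (pderiv p) a = 0)" for a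
    using False linear_power2_dvd_iff[of a p] by (simp add: order_divides)
  finally show ?thesis using False unfolding rsquarefree_def by blast
qed (simp add: rsquarefree_def)

lemma rsquarefree_factorization:
  fixes p :: "'a::alg_closed_field poly"
  assumes p: "rsquarefree p"
  shows "p = smult (lead_coeff p) (\<Prod>r | poly p r = 0. [:-r, 1:])"
    and "card {r. poly p r = 0} = degree p"
proof -
  have p0: "p \<noteq> 0" using p by (simp add: rsquarefree_def)
  obtain A where A: "size A = degree p" "p = smult (lead_coeff p) (\<Prod>x\<in>#A. [:-x, 1:])"
    using alg_closed_imp_factorization[OF p0] by blast
  have root: "poly p r = 0 \<longleftrightarrow> r \<in># A" for r
  proof -
    have "poly (\<Prod>x\<in>#A. [:-x, 1:]) r = 0 \<longleftrightarrow> r \<in># A"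
      by (induction A) auto
    then show ?thesis using p0 by (subst A(2)) simp
  qed
  have "count A a \<le> 1" for a
  proof (rule ccontr)
    assume "\<not> ?thesis"
    then have "{#a, a#} \<subseteq># A" by (simp add: subseteq_mset_def)
    then obtain B where "A = {#a, a#} + B" by (metis subset_mset.le_iff_add)
    then have "A = add_mset a (add_mset a B)" by simp
    then have "(\<Prod>x\<in>#A. [:-x, 1:]) = [:-a, 1:]\<^sup>2 * (\<Prod>x\<in>#B. [:-x, 1:])"
      by (simp only: power2_eq_square mult.assoc prod_mset.insert image_mset_add_mset prod_mset.add_mset)
    then have "[:-a, 1:]\<^sup>2 dvd (\<Prod>x\<in>#A. [:-x, 1:])" by (rule dvdI)
    then have "[:-a, 1:]\<^sup>2 dvd p" using A(2) dvd_smult by metis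
    then show False using p unfolding linear_power2_dvd_iff rsquarefree_iff by blast
  qed
  note count = this
  have "A = mset_set (set_mset A)"
  proof (intro multiset_eqI)
    fix a
    have "count A a \<le> 1" by (rule count)
    then show "count A a = count (mset_set (set_mset A)) a"
      by (cases "a \<in># A") (auto simp: le_Suc_eq count_eq_zero_iff)
  qed
  moreover have set: "{r. poly p r = 0} = set_mset A" using root by auto
  ultimately have Aset: "mset_set {r. poly p r = 0} = A" by simp
  show "card {r. poly p r = 0} = degree p"
    using A(1) size_mset_set[of "{r. poly p r = 0}"] unfolding Aset by simp
  have "(\<Prod>r | poly p r = 0. [:-r, 1:]) = (\<Prod>x\<in>#A. [:-x, 1:])"
    unfolding prod_unfold_prod_mset Aset ..
  with A(2) show "p = smult (lead_coeff p) (\<Prod>r | poly p r = 0. [:-r, 1:])" by simp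
qed

text \<open>A multiple root would have \<open>m\<close> as minimal polynomial as well, yet be a root
  of the nonzero derivative of smaller degree.\<close>

lemma minpoly_rsquarefree:
  assumes F: "is_subfield F" and m: "is_minpoly F a m" and d: "pderiv m \<noteq> 0"
  shows "rsquarefree m"
  unfolding rsquarefree_iff
proof (intro conjI allI impI notI)
  fix r assume r: "poly m r = 0" "poly (pderiv m) r = 0"
  have "degree m \<le> degree (pderiv m)"
    using is_minpolyD(6)[OF minpoly_root[OF F m r(1)] d _ r(2)]
      poly_over_pderiv[OF subfield_imp_subring[OF F] is_minpolyD(1)[OF m]] by blast
  then show False using degree_pderiv_less[OF is_minpolyD(5)[OF m]] by linarith
qed (use is_minpolyD(4)[OF m] in simp)

subsection \<open>The relative algebraic closure is an algebraically closed subfield\<close>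

definition span_over :: "'a::field set \<Rightarrow> 'a set \<Rightarrow> 'a set" where
  "span_over F B = {\<Sum>b\<in>B. c b * b | c. \<forall>b\<in>B. c b \<in> F}"

lemma span_overI: "x = (\<Sum>b\<in>B. c b * b) \<Longrightarrow> \<forall>b\<in>B. c b \<in> F \<Longrightarrow> x \<in> span_over F B"
  unfolding span_over_def by blast

text \<open>Gaussian elimination: a vector \<open>y j\<close> with nonzero coefficient at the new
  generator \<open>b\<close> clears \<open>b\<close> from the others, which leaves one generator and
  one vector fewer.\<close>

lemma span_over_dependent:
  fixes y :: "'i \<Rightarrow> 'a::field"
  assumes F: "is_subfield F" and "finite B" "finite I" "card B < card I"
    and "\<And>i. i \<in> I \<Longrightarrow> y i \<in> span_over F B"
  shows "\<exists>c. (\<forall>i\<in>I. c i \<in> F) \<and> (\<exists>i\<in>I. c i \<noteq> 0) \<and> (\<Sum>i\<in>I. c i * y i) = 0"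
  using assms(2-)
proof (induction B arbitrary: I y rule: finite_induct)
  case empty
  then obtain i where "i \<in> I" by fastforce
  then show ?case using empty is_subfieldD[OF F]
    by (intro exI[of _ "\<lambda>_. 1"]) (auto simp: span_over_def)
next
  case (insert b B)
  have "\<forall>i\<in>I. \<exists>u z. u \<in> F \<and> z \<in> span_over F B \<and> y i = u * b + z"
  proof
    fix i assume "i \<in> I"
    then obtain c where c: "\<forall>b'\<in>insert b B. c b' \<in> F" "y i = (\<Sum>b'\<in>insert b B. c b' * b')"
      using insert.prems(3) unfolding span_over_def by blast
    have "(\<Sum>b'\<in>B. c b' * b') \<in> span_over F B"
      using c(1) unfolding span_over_def by blast
    then show "\<exists>u z. u \<in> F \<and> z \<in> span_over F B \<and> y i = u * b + z"
      using c insert.hyps by (intro exI[of _ "c b"] exI[of _ "\<Sum>b'\<in>B. c b' * b'"]) auto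
  qed
  then obtain u z where uz: "\<And>i. i \<in> I \<Longrightarrow> u i \<in> F" "\<And>i. i \<in> I \<Longrightarrow> z i \<in> span_over F B"
    "\<And>i. i \<in> I \<Longrightarrow> y i = u i * b + z i" by metis
  show ?case
  proof (cases "\<forall>i\<in>I. u i = 0")
    case True
    then have "\<And>i. i \<in> I \<Longrightarrow> y i \<in> span_over F B" using uz by auto
    then show ?thesis using insert.IH[of I y] insert.prems insert.hyps by auto
  next
    case False
    then obtain j where j: "j \<in> I" "u j \<noteq> 0" by blast
    let ?I = "I - {j}"
    let ?y = "\<lambda>i. y i - (u i / u j) * y j"
    have "?y i \<in> span_over F B" if i: "i \<in> ?I" for i
    proof -
      have *: "?y i = z i - (u i / u j) * z j"
        using uz(3)[of i] uz(3)[OF j(1)] i j by (simp add: field_simps)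
      obtain c d where c: "\<forall>b\<in>B. c b \<in> F" "z i = (\<Sum>b\<in>B. c b * b)"
        and d: "\<forall>b\<in>B. d b \<in> F" "z j = (\<Sum>b\<in>B. d b * b)"
        using uz(2)[of i] uz(2)[OF j(1)] i unfolding span_over_def by blast
      have "?y i = (\<Sum>b\<in>B. (c b - (u i / u j) * d b) * b)"
        unfolding * c(2) d(2) by (simp add: sum_subtractf sum_distrib_left algebra_simps)
      moreover have "\<forall>b\<in>B. c b - (u i / u j) * d b \<in> F"
        using c(1) d(1) uz(1) i j by (auto intro!: is_subfieldD[OF F])
      ultimately show ?thesis by (rule span_overI)
    qed
    moreover have "finite ?I" "card B < card ?I" using insert.prems insert.hyps j by auto
    ultimately obtain c where c: "\<forall>i\<in>?I. c i \<in> F" "\<exists>i\<in>?I. c i \<noteq> 0" "(\<Sum>i\<in>?I. c i * ?y i) = 0"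
      using insert.IH[of ?I ?y] by auto
    \<comment> \<open>The coefficient of the pivot \<open>y j\<close> makes up for the multiples of
      it subtracted from the other vectors.\<close>
    define t where "t = - (\<Sum>i\<in>?I. c i * (u i / u j))"
    have t: "t \<in> F" unfolding t_def
      using c(1) uz(1) j by (auto intro!: is_subfieldD[OF F] subring_sum[OF subfield_imp_subring[OF F]])
    have "(\<Sum>i\<in>I. (c(j := t)) i * y i) = t * y j + (\<Sum>i\<in>?I. c i * y i)"
      using j insert.prems(1) by (subst sum.remove[of _ j]) auto
    also have "\<dots> = (\<Sum>i\<in>?I. c i * ?y i)"
      unfolding t_def by (simp add: sum_subtractf right_diff_distrib sum_distrib_right mult.assoc)
    finally have "(\<Sum>i\<in>I. (c(j := t)) i * y i) = 0" using c(3) by simp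
    moreover have "\<forall>i\<in>I. (c(j := t)) i \<in> F" "\<exists>i\<in>I. (c(j := t)) i \<noteq> 0"
      using c(1,2) t by auto
    ultimately show ?thesis by blast
  qed
qed

text \<open>Containment in a span replaces equality, and \<open>B\<close> need not lie in
  \<open>R\<close>: a bound on the number of independent elements is all that algebraicity
  needs.\<close>

definition module_finite :: "'a::field set \<Rightarrow> 'a set \<Rightarrow> bool" where
  "module_finite F R \<longleftrightarrow> is_subring R \<and> F \<subseteq> R \<and> (\<exists>B. finite B \<and> R \<subseteq> span_over F B)"

lemma module_finite_algebraic:
  assumes F: "is_subfield F" and R: "module_finite F R" and a: "a \<in> R"
  shows "algebraic_over F a"
proof -
  obtain B where B: "finite B" "R \<subseteq> span_over F B" and R': "is_subring R"
    using R unfolding module_finite_def by blast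
  have "\<And>i. i \<in> {..card B} \<Longrightarrow> a ^ i \<in> span_over F B"
    using B is_subringD(7)[OF R' a] by blast
  then obtain c where c: "\<forall>i\<in>{..card B}. c i \<in> F" "\<exists>i\<in>{..card B}. c i \<noteq> 0"
    "(\<Sum>i\<in>{..card B}. c i * a ^ i) = 0"
    using span_over_dependent[OF F B(1), of "{..card B}" "\<lambda>i. a ^ i"] by auto
  define p where "p = (\<Sum>i\<le>card B. monom (c i) i)"
  have cp: "coeff p i = (if i \<le> card B then c i else 0)" for i
    by (simp add: p_def coeff_sum)
  have "poly p a = 0" using c(3) by (simp add: p_def poly_sum poly_monom)
  moreover have "p \<noteq> 0" using c(2) cp by (metis atMost_iff coeff_0)
  moreover have "poly_over F p" using c(1) is_subfieldD(2)[OF F] by (simp add: poly_over_def cp)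
  ultimately show ?thesis unfolding algebraic_over_def by blast
qed

lemma module_finite_refl: "is_subfield F \<Longrightarrow> module_finite F F"
  unfolding module_finite_def span_over_def
  by (auto simp: subfield_imp_subring intro!: exI[of _ "{1}"])

text \<open>Generators of \<open>R\<close> times powers of \<open>a\<close> below
  \<open>degree m\<close> generate the new ring. Coefficients of \<open>m\<close> in
  \<open>R\<close> rather than in \<open>F\<close> are what makes algebraicity transitive.\<close>

lemma module_finite_adjoin:
  assumes F: "is_subfield F" and R: "module_finite F R"
    and m: "poly_over R m" "lead_coeff m = 1" "poly m a = 0"
  shows "\<exists>R'. module_finite F R' \<and> R \<subseteq> R' \<and> a \<in> R'"
proof -
  obtain B where B: "finite B" "R \<subseteq> span_over F B" and R': "is_subring R" and FR: "F \<subseteq> R"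
    using R unfolding module_finite_def by blast
  let ?R = "poly_values R a"
  define h :: "'a \<times> nat \<Rightarrow> 'a" where "h = (\<lambda>(b, i). b * a ^ i)"
  have "?R \<subseteq> span_over F (h ` (B \<times> {..<degree m}))" (is "_ \<subseteq> span_over F ?C")
  proof
    fix x assume "x \<in> ?R"
    then obtain g where g: "poly_over R g" "x = poly g a" unfolding poly_values_def by blast
    obtain q r where qr: "poly_over R r" "g = q * m + r" "r = 0 \<or> degree r < degree m"
      using poly_over_reduce[OF R' m(1,2) g(1)] by blast
    have xr: "x = poly r a" using g qr m by simp
    have "\<forall>i. \<exists>c. (\<forall>b\<in>B. c b \<in> F) \<and> coeff r i = (\<Sum>b\<in>B. c b * b)"
    proof
      fix i
      have "coeff r i \<in> span_over F B" using B(2) poly_overD[OF qr(1)] by blast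
      then show "\<exists>c. (\<forall>b\<in>B. c b \<in> F) \<and> coeff r i = (\<Sum>b\<in>B. c b * b)"
        unfolding span_over_def by blast
    qed
    then obtain c where c: "\<And>i b. b \<in> B \<Longrightarrow> c i b \<in> F" "\<And>i. coeff r i = (\<Sum>b\<in>B. c i b * b)"
      by metis
    \<comment> \<open>Different pairs can have the same product, so coefficients are added up over
      each fibre of \<open>h\<close>.\<close>
    define e where "e y = (\<Sum>z\<in>{z \<in> B \<times> {..<degree m}. h z = y}. c (snd z) (fst z))" for y
    have "x = (\<Sum>i<degree m. coeff r i * a ^ i)"
    proof (cases "r = 0")
      case False
      then show ?thesis unfolding xr poly_altdef using qr(3)
        by (intro sum.mono_neutral_left) (auto simp: coeff_eq_0)
    qed (simp add: xr)
    also have "\<dots> = (\<Sum>i<degree m. \<Sum>b\<in>B. c i b * (b * a ^ i))"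
      by (simp add: c(2) sum_distrib_right mult.assoc)
    also have "\<dots> = (\<Sum>b\<in>B. \<Sum>i<degree m. c i b * (b * a ^ i))"
      by (rule sum.swap)
    also have "\<dots> = (\<Sum>z\<in>B \<times> {..<degree m}. c (snd z) (fst z) * h z)"
      by (simp add: sum.cartesian_product h_def case_prod_beta)
    also have "\<dots> = (\<Sum>y\<in>?C. \<Sum>z\<in>{z \<in> B \<times> {..<degree m}. h z = y}. c (snd z) (fst z) * h z)"
      using B(1) by (intro sum.image_gen) auto
    also have "\<dots> = (\<Sum>y\<in>?C. e y * y)"
      unfolding e_def sum_distrib_right by (intro sum.cong) auto
    finally have "x = (\<Sum>y\<in>?C. e y * y)" .
    moreover have "\<forall>y\<in>?C. e y \<in> F"
      unfolding e_def using c(1) by (auto intro!: subring_sum[OF subfield_imp_subring[OF F]])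
    ultimately show "x \<in> span_over F ?C" by (rule span_overI)
  qed
  moreover have "finite (h ` (B \<times> {..<degree m}))" using B(1) by simp
  ultimately have "module_finite F ?R"
    using FR poly_values(1,2)[OF R'] unfolding module_finite_def by (metis order_trans)
  then show ?thesis using poly_values(2,3)[OF R'] by blast
qed

lemma module_finite_adjoin_algebraic:
  assumes F: "is_subfield F" and R: "module_finite F R" and a: "algebraic_over F a"
  shows "\<exists>R'. module_finite F R' \<and> R \<subseteq> R' \<and> a \<in> R'"
proof -
  obtain m where m: "is_minpoly F a m" using minpoly_exists[OF F a] by blast
  have "F \<subseteq> R" using R unfolding module_finite_def by blast
  then show ?thesis
    using module_finite_adjoin[OF F R _ is_minpolyD(2,3)[OF m]] poly_over_mono[OF is_minpolyD(1)[OF m]]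
    by blast
qed

lemma module_finite_adjoin_finite:
  assumes F: "is_subfield F" and "finite A" "\<And>a. a \<in> A \<Longrightarrow> algebraic_over F a"
  shows "\<exists>R. module_finite F R \<and> A \<subseteq> R"
  using assms(2,3)
proof (induction A rule: finite_induct)
  case empty
  then show ?case using module_finite_refl[OF F] by blast
next
  case (insert a A)
  then obtain R where "module_finite F R" "A \<subseteq> R" by auto
  then show ?case using module_finite_adjoin_algebraic[OF F] insert.prems by (metis insertI1 insert_subset order_trans)
qed

definition alg_closure :: "'a::field set \<Rightarrow> 'a set" where
  "alg_closure F = {a. algebraic_over F a}"

text \<open>Two algebraic elements lie in one ring that is a finite module, hence so do their
  difference and product; for the inverse, the reversed polynomial serves.\<close>

lemma alg_closure_subfield:
  assumes F: "is_subfield F" shows "is_subfield (alg_closure F)"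
  unfolding is_subfield_def
proof (intro conjI ballI)
  show "1 \<in> alg_closure F"
    using algebraic_over_self[OF F] is_subfieldD[OF F] by (simp add: alg_closure_def)
  fix a assume a: "a \<in> alg_closure F"
  {
    fix b assume b: "b \<in> alg_closure F"
    obtain R where R: "module_finite F R" "{a, b} \<subseteq> R"
      using module_finite_adjoin_finite[OF F, of "{a, b}"] a b by (auto simp: alg_closure_def)
    then have "is_subring R" unfolding module_finite_def by blast
    then show "a - b \<in> alg_closure F" "a * b \<in> alg_closure F"
      using R module_finite_algebraic[OF F R(1)] is_subringD[of R] by (auto simp: alg_closure_def)
  }
  show "inverse a \<in> alg_closure F"
  proof (cases "a = 0")
    case False
    obtain p where p: "p \<noteq> 0" "poly_over F p" "poly p a = 0"
      using a unfolding alg_closure_def algebraic_over_def by blast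
    have "poly (reflect_poly p) (inverse a) = 0"
      using poly_reflect_poly_nz[of "inverse a" p] False p by simp
    moreover have "reflect_poly p \<noteq> 0" using p by simp
    ultimately show ?thesis
      using poly_over_reflect[OF subfield_imp_subring[OF F] p(2)]
      unfolding alg_closure_def algebraic_over_def by blast
  qed (use a in simp)
qed

lemma alg_closure_incl: "is_subfield F \<Longrightarrow> F \<subseteq> alg_closure F"
  using algebraic_over_self by (auto simp: alg_closure_def)

lemma alg_closure_closed:
  assumes F: "is_subfield F" and a: "algebraic_over (alg_closure F) a"
  shows "a \<in> alg_closure F"
proof -
  obtain m where m: "is_minpoly (alg_closure F) a m"
    using minpoly_exists[OF alg_closure_subfield[OF F] a] by blast
  have "\<And>c. c \<in> set (coeffs m) \<Longrightarrow> algebraic_over F c"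
    using poly_overD[OF is_minpolyD(1)[OF m]] by (auto simp: alg_closure_def coeffs_def split: if_splits)
  then obtain R where R: "module_finite F R" "set (coeffs m) \<subseteq> R"
    using module_finite_adjoin_finite[OF F, of "set (coeffs m)"] by blast
  have R': "is_subring R" using R(1) unfolding module_finite_def by blast
  have "coeff m i \<in> R" for i
  proof -
    have "coeff m i \<in> insert 0 (set (coeffs m))" by (metis range_coeff rangeI)
    then show ?thesis using R(2) is_subringD(2)[OF R'] by auto
  qed
  then have "poly_over R m" by (simp add: poly_over_def)
  then obtain R2 where "module_finite F R2" "a \<in> R2"
    using module_finite_adjoin[OF F R(1) _ is_minpolyD(2,3)[OF m]] by blast
  then show ?thesis using module_finite_algebraic[OF F] by (simp add: alg_closure_def)
qed

lemma alg_closure_root: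
  assumes F: "is_subfield F" and p: "poly_over (alg_closure F) p" "p \<noteq> 0" "poly p a = 0"
  shows "a \<in> alg_closure F"
  using alg_closure_closed[OF F] p unfolding algebraic_over_def by blast

lemma alg_closure_idem:
  assumes F: "is_subfield F" and G: "F \<subseteq> G" "G \<subseteq> alg_closure F"
  shows "alg_closure G = alg_closure F"
proof
  show "alg_closure G \<subseteq> alg_closure F"
    using alg_closure_closed[OF F] algebraic_over_mono[OF _ G(2)] unfolding alg_closure_def by blast
  show "alg_closure F \<subseteq> alg_closure G"
    using algebraic_over_mono[OF _ G(1)] unfolding alg_closure_def by blast
qed

lemma poly_transcendental_eq:
  assumes F: "is_subfield F" and x: "\<not> algebraic_over F x" and
    "poly_over (alg_closure F) p" "poly_over (alg_closure F) q" "poly p x = poly q x"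
  shows "p = q"
proof (rule ccontr)
  assume "p \<noteq> q"
  then have "x \<in> alg_closure F"
    using alg_closure_root[OF F poly_over_diff[OF subfield_imp_subring[OF alg_closure_subfield[OF F]]
          assms(3,4)], of x] assms(5) by simp
  then show False using x by (simp add: alg_closure_def)
qed

section \<open>Simple extensions, transcendental and algebraic\<close>

lemma field_adjoin_single:
  fixes H :: "'a::field set"
  assumes H: "is_subfield H"
  shows "field_adjoin H {x} = {poly p x / poly q x | p q. poly_over H p \<and> poly_over H q}" (is "_ = ?Q")
proof
  have HR: "is_subring H" using subfield_imp_subring[OF H] .
  have "is_subfield ?Q"
    unfolding is_subfield_def
  proof (intro conjI ballI)
    show "1 \<in> ?Q" using poly_over_1[OF HR] by (force intro: exI[of _ 1])
    fix a assume "a \<in> ?Q"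
    then obtain p q where pq: "poly_over H p" "poly_over H q" "a = poly p x / poly q x" by blast
    \<comment> \<open>A fraction whose denominator vanishes at \<open>x\<close> is \<open>0\<close>
      by the division convention and is rewritten as \<open>0 / 1\<close> before fractions are
      combined.\<close>
    have pq': "\<exists>p q. poly_over H p \<and> poly_over H q \<and> a = poly p x / poly q x \<and> poly q x \<noteq> 0"
    proof (cases "poly q x = 0")
      case True
      then show ?thesis using pq poly_over_0[OF HR] poly_over_1[OF HR]
        by (intro exI[of _ 0] exI[of _ 1]) auto
    qed (use pq in blast)
    show "inverse a \<in> ?Q" using pq by (force intro: exI[of _ q] exI[of _ p])
    fix b assume "b \<in> ?Q"
    then obtain r s where rs: "poly_over H r" "poly_over H s" "b = poly r x / poly s x" by blast
    show "a * b \<in> ?Q"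
      using pq rs poly_over_mult[OF HR] by (force intro: exI[of _ "p * r"] exI[of _ "q * s"])
    have rs': "\<exists>p q. poly_over H p \<and> poly_over H q \<and> b = poly p x / poly q x \<and> poly q x \<noteq> 0"
    proof (cases "poly s x = 0")
      case True
      then show ?thesis using rs poly_over_0[OF HR] poly_over_1[OF HR]
        by (intro exI[of _ 0] exI[of _ 1]) auto
    qed (use rs in blast)
    obtain p1 q1 p2 q2 where *: "poly_over H p1" "poly_over H q1" "a = poly p1 x / poly q1 x" "poly q1 x \<noteq> 0"
      "poly_over H p2" "poly_over H q2" "b = poly p2 x / poly q2 x" "poly q2 x \<noteq> 0"
      using pq' rs' by blast
    have "a - b = poly (p1 * q2 - p2 * q1) x / poly (q1 * q2) x"
      unfolding *(3,7) using *(4,8) by (simp add: diff_frac_eq)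
    moreover have "poly_over H (p1 * q2 - p2 * q1)" "poly_over H (q1 * q2)"
      using * by (auto intro!: poly_over_diff[OF HR] poly_over_mult[OF HR])
    ultimately show "a - b \<in> ?Q" by blast
  qed
  moreover have "H \<subseteq> ?Q"
  proof
    fix h assume "h \<in> H"
    then have "poly_over H [:h:]" by (simp add: poly_over_pCons_iff[OF HR] poly_over_0[OF HR])
    moreover have "h = poly [:h:] x / poly 1 x" by simp
    ultimately show "h \<in> ?Q" using poly_over_1[OF HR] by blast
  qed
  moreover have "{x} \<subseteq> ?Q"
  proof -
    have "poly_over H [:0, 1:]"
      by (simp add: poly_over_pCons_iff[OF HR] poly_over_0[OF HR] is_subringD[OF HR])
    moreover have "x = poly [:0, 1:] x / poly 1 x" by simp
    ultimately show "{x} \<subseteq> ?Q" using poly_over_1[OF HR] by blast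
  qed
  ultimately show "field_adjoin H {x} \<subseteq> ?Q" by (rule field_adjoin_least)
  show "?Q \<subseteq> field_adjoin H {x}"
  proof
    fix a assume "a \<in> ?Q"
    then obtain p q where pq: "poly_over H p" "poly_over H q" "a = poly p x / poly q x" by blast
    let ?A = "field_adjoin H {x}"
    have "poly p x \<in> ?A" "poly q x \<in> ?A"
      using pq field_adjoin_incl(1)[of H "{x}"] field_adjoin_incl(2)[of "{x}" H]
      by (auto intro!: poly_in_subring subfield_imp_subring poly_over_mono[of H])
    then show "a \<in> ?A" using pq is_subfieldD(8)[OF field_adjoin_subfield] by blast
  qed
qed

text \<open>If \<open>c = p(x) / q(x)\<close> is algebraic, transcendence of \<open>x\<close> gives
  \<open>p = c q\<close> as polynomials, and one nonzero coefficient of \<open>q\<close> exhibits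
  \<open>c\<close> as a quotient in \<open>H\<close>.\<close>

lemma field_adjoin_transcendental_Int:
  assumes F: "is_subfield F" and x: "\<not> algebraic_over F x" and H: "is_subfield H" "H \<subseteq> alg_closure F"
  shows "field_adjoin H {x} \<inter> alg_closure F = H"
proof
  show "H \<subseteq> field_adjoin H {x} \<inter> alg_closure F" using field_adjoin_incl H by auto
  have HR: "is_subring H" using subfield_imp_subring[OF H(1)] .
  show "field_adjoin H {x} \<inter> alg_closure F \<subseteq> H"
  proof
    fix c assume c: "c \<in> field_adjoin H {x} \<inter> alg_closure F"
    then obtain p q where pq: "poly_over H p" "poly_over H q" "c = poly p x / poly q x"
      unfolding field_adjoin_single[OF H(1)] by blast
    show "c \<in> H"
    proof (cases "poly q x = 0")
      case True
      then show ?thesis using pq is_subfieldD[OF H(1)] by simp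
    next
      case False
      have "poly p x = poly (smult c q) x" using pq False by simp
      then have "p = smult c q"
        using pq(1,2) H(2) c
        by (intro poly_transcendental_eq[OF F x] poly_over_smult
            subfield_imp_subring[OF alg_closure_subfield[OF F]]) (auto intro: poly_over_mono)
      moreover obtain i where i: "coeff q i \<noteq> 0" using False by (metis poly_0 poly_eqI coeff_0)
      ultimately have "c = coeff p i / coeff q i" by simp
      then show ?thesis using is_subfieldD(8)[OF H(1)] poly_overD[OF pq(1)] poly_overD[OF pq(2)] by metis
    qed
  qed
qed

text \<open>The constant term of the minimal polynomial is nonzero, since otherwise a factor could
  be split off; dividing by it expresses the inverse as a polynomial in \<open>y\<close>.\<close>

lemma algebraic_inverse_poly:
  assumes F: "is_subfield F" and y: "algebraic_over F y" "y \<noteq> 0"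
  shows "\<exists>r. poly_over F r \<and> y * poly r y = 1"
proof -
  obtain m where m: "is_minpoly F y m" using minpoly_exists[OF F y(1)] by blast
  obtain c s where cs: "m = pCons c s" by (cases m)
  have FR: "is_subring F" using subfield_imp_subring[OF F] .
  have c: "c \<in> F" and s: "poly_over F s"
    using is_minpolyD(1)[OF m] unfolding cs by (simp_all add: poly_over_pCons_iff[OF FR])
  have eq: "c + y * poly s y = 0" using is_minpolyD(3)[OF m] unfolding cs by simp
  have "c \<noteq> 0"
  proof
    assume c0: "c = 0"
    then have "s \<noteq> 0" using is_minpolyD(4)[OF m] cs by auto
    moreover from this have "degree m = Suc (degree s)" by (simp add: cs)
    moreover have "poly s y = 0" using eq c0 y by simp
    ultimately show False using is_minpolyD(6)[OF m _ s] by fastforce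
  qed
  then have "y * poly (smult (- inverse c) s) y = 1"
    using minus_unique[OF eq] by (simp add: field_simps flip: minus_equation_iff[of c])
  moreover have "poly_over F (smult (- inverse c) s)"
    by (intro poly_over_smult[OF FR] s is_subfieldD[OF F] c)
  ultimately show ?thesis by blast
qed

lemma subring_algebraic_subfield:
  assumes F: "is_subfield F" and R: "is_subring R" "F \<subseteq> R" and alg: "\<And>y. y \<in> R \<Longrightarrow> algebraic_over F y"
  shows "is_subfield R"
proof -
  have "inverse y \<in> R" if y: "y \<in> R" for y
  proof (cases "y = 0")
    case False
    obtain r where r: "poly_over F r" "y * poly r y = 1"
      using algebraic_inverse_poly[OF F alg[OF y] False] by blast
    have "poly r y \<in> R" using poly_in_subring[OF R(1) poly_over_mono[OF r(1) R(2)] y] .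
    moreover have "inverse y = poly r y" using r(2) by (rule inverse_unique)
    ultimately show ?thesis by simp
  qed (use y in simp)
  then show ?thesis using R(1) unfolding is_subfield_def is_subring_def by blast
qed

lemma field_adjoin_algebraic:
  assumes F: "is_subfield F" and b: "algebraic_over F b"
  shows "field_adjoin F {b} = poly_values F b" (is "_ = ?R")
proof
  note R = poly_values[OF subfield_imp_subring[OF F], of b]
  have "b \<in> alg_closure F" using b by (simp add: alg_closure_def)
  then have alg: "y \<in> alg_closure F" if "y \<in> ?R" for y
    using that alg_closure_incl[OF F] unfolding poly_values_def
    by (auto intro!: poly_in_subring[OF subfield_imp_subring[OF alg_closure_subfield[OF F]]] intro: poly_over_mono)
  then have "is_subfield ?R"
    using R by (intro subring_algebraic_subfield[OF F]) (auto simp: alg_closure_def)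
  then show "field_adjoin F {b} \<subseteq> ?R"
    using R by (intro field_adjoin_least) auto
  show "?R \<subseteq> field_adjoin F {b}"
    using field_adjoin_incl(1)[of F "{b}"] field_adjoin_incl(2)[of "{b}" F] unfolding poly_values_def
    by (auto intro!: poly_in_subring[OF subfield_imp_subring[OF field_adjoin_subfield]] intro: poly_over_mono)
qed

section \<open>Automorphisms\<close>

definition aut_over :: "'a::field set \<Rightarrow> ('a \<Rightarrow> 'a) \<Rightarrow> bool" where
  "aut_over F \<tau> \<longleftrightarrow> bij \<tau> \<and> (\<forall>a b. \<tau> (a + b) = \<tau> a + \<tau> b) \<and> (\<forall>a b. \<tau> (a * b) = \<tau> a * \<tau> b) \<and>
     (\<forall>a\<in>F. \<tau> a = a)"

lemma aut_overD:
  fixes \<tau> :: "'a::field \<Rightarrow> 'a"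
  assumes "aut_over F \<tau>"
  shows "bij \<tau>" "inj \<tau>"
    and "\<And>a b. \<tau> (a + b) = \<tau> a + \<tau> b"
    and "\<And>a b. \<tau> (a * b) = \<tau> a * \<tau> b"
    and "\<And>a. a \<in> F \<Longrightarrow> \<tau> a = a"
    and "\<tau> 0 = 0" "\<tau> 1 = 1"
    and "\<And>a. \<tau> (- a) = - \<tau> a"
    and "\<And>a b. \<tau> (a - b) = \<tau> a - \<tau> b"
    and "\<And>a n. \<tau> (a ^ n) = \<tau> a ^ n"
    and "\<And>a. \<tau> (inverse a) = inverse (\<tau> a)"
    and "\<And>a b. \<tau> (a / b) = \<tau> a / \<tau> b"
    and "\<And>a. \<tau> a = 0 \<longleftrightarrow> a = 0"
    and "\<And>a b. \<tau> a = \<tau> b \<longleftrightarrow> a = b"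
proof -
  show b: "bij \<tau>" and add: "\<And>a b. \<tau> (a + b) = \<tau> a + \<tau> b"
    and mult: "\<And>a b. \<tau> (a * b) = \<tau> a * \<tau> b" and "\<And>a. a \<in> F \<Longrightarrow> \<tau> a = a"
    using assms unfolding aut_over_def by blast+
  show inj: "inj \<tau>" using b by (rule bij_is_inj)
  then show eq: "\<And>a b. \<tau> a = \<tau> b \<longleftrightarrow> a = b" by (simp add: inj_eq)
  show 0: "\<tau> 0 = 0" by (metis add add.right_neutral add_cancel_right_right)
  then show z: "\<And>a. \<tau> a = 0 \<longleftrightarrow> a = 0" using eq by metis
  show 1: "\<tau> 1 = 1" using mult[of 1 1] z[of 1] by simp
  show m: "\<And>a. \<tau> (- a) = - \<tau> a" using add 0 by (metis add_eq_0_iff)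
  show "\<And>a b. \<tau> (a - b) = \<tau> a - \<tau> b" using add m by (metis diff_conv_add_uminus)
  show "\<And>a n. \<tau> (a ^ n) = \<tau> a ^ n" subgoal for a n by (induction n) (auto simp: 1 mult) done
  show i: "\<And>a. \<tau> (inverse a) = inverse (\<tau> a)"
    subgoal for a
    proof (cases "a = 0")
      case False
      then have "\<tau> a * \<tau> (inverse a) = 1" by (simp add: mult[symmetric] 1)
      then show ?thesis by (rule inverse_unique[symmetric])
    qed (simp add: 0)
    done
  show "\<And>a b. \<tau> (a / b) = \<tau> a / \<tau> b" by (simp add: divide_inverse mult i)
qed

lemma aut_over_mono: "aut_over F \<tau> \<Longrightarrow> G \<subseteq> F \<Longrightarrow> aut_over G \<tau>"
  unfolding aut_over_def by blast

lemma aut_over_sum: "aut_over F \<tau> \<Longrightarrow> \<tau> (sum f A) = (\<Sum>i\<in>A. \<tau> (f i))"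
  by (induction A rule: infinite_finite_induct) (simp_all add: aut_overD)

lemma aut_over_prod: "aut_over F \<tau> \<Longrightarrow> \<tau> (prod f A) = (\<Prod>i\<in>A. \<tau> (f i))"
  by (induction A rule: infinite_finite_induct) (simp_all add: aut_overD)

lemma aut_over_poly: "aut_over F \<tau> \<Longrightarrow> poly_over F p \<Longrightarrow> \<tau> (poly p a) = poly p (\<tau> a)"
  by (simp add: poly_altdef aut_over_sum aut_overD poly_over_def)

lemma aut_over_root: "aut_over F \<tau> \<Longrightarrow> poly_over F p \<Longrightarrow> poly p a = 0 \<Longrightarrow> poly p (\<tau> a) = 0"
  by (metis aut_over_poly aut_overD(6))

lemma aut_over_id: "aut_over F id"
  by (simp add: aut_over_def)

lemma aut_over_comp: "aut_over F \<sigma> \<Longrightarrow> aut_over F \<tau> \<Longrightarrow> aut_over F (\<sigma> \<circ> \<tau>)"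
  unfolding aut_over_def by (auto intro: bij_comp)

lemma aut_over_inv:
  assumes "aut_over F \<tau>" shows "aut_over F (inv_into UNIV \<tau>)"
proof -
  have s: "surj \<tau>" using aut_overD(1)[OF assms] by (rule bij_is_surj)
  have i: "inj \<tau>" using aut_overD(2)[OF assms] .
  show ?thesis unfolding aut_over_def
  proof (intro conjI allI ballI)
    show "bij (inv_into UNIV \<tau>)" using aut_overD(1)[OF assms] by (rule bij_imp_bij_inv)
    show "inv_into UNIV \<tau> (a + b) = inv_into UNIV \<tau> a + inv_into UNIV \<tau> b" for a b
      by (rule inv_f_eq[OF i]) (simp add: aut_overD[OF assms] surj_f_inv_f[OF s])
    show "inv_into UNIV \<tau> (a * b) = inv_into UNIV \<tau> a * inv_into UNIV \<tau> b" for a b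
      by (rule inv_f_eq[OF i]) (simp add: aut_overD[OF assms] surj_f_inv_f[OF s])
    show "inv_into UNIV \<tau> a = a" if "a \<in> F" for a
      by (rule inv_f_eq[OF i]) (simp add: aut_overD[OF assms] that)
  qed
qed

subsection \<open>Partial embeddings\<close>

text \<open>
  A partial embedding is represented by its graph, so that unions of chains are unions of sets. No
  closure under inverses is demanded: it follows when everything is algebraic over the fixed field.
\<close>

definition emb :: "'a::field set \<Rightarrow> ('a \<times> 'a) set \<Rightarrow> bool" where
  "emb F G \<longleftrightarrow> (\<forall>a\<in>F. (a, a) \<in> G) \<and> (\<forall>a b c d. (a, b) \<in> G \<longrightarrow> (c, d) \<in> G \<longrightarrow> (a - c, b - d) \<in> G) \<and>
     (\<forall>a b c d. (a, b) \<in> G \<longrightarrow> (c, d) \<in> G \<longrightarrow> (a * c, b * d) \<in> G) \<and> (\<forall>b. (0, b) \<in> G \<longrightarrow> b = 0)"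

definition poly_rel :: "('a::field \<times> 'a) set \<Rightarrow> 'a poly \<Rightarrow> 'a poly \<Rightarrow> bool" where
  "poly_rel G p q \<longleftrightarrow> (\<forall>i. (coeff p i, coeff q i) \<in> G)"

text \<open>The type is an algebraic closure of \<open>F\<close>, which is what makes partial
  embeddings over \<open>F\<close> extend to automorphisms.\<close>

locale ambient =
  fixes F :: "'a::alg_closed_field set"
  assumes F: "is_subfield F" and alg: "\<And>y. algebraic_over F y"
begin

lemmas FR = subfield_imp_subring[OF F]

lemma alg_over: "F \<subseteq> M \<Longrightarrow> algebraic_over M y"
  using algebraic_over_mono[OF alg] .

context
  fixes G assumes G: "emb F G"
begin

lemma emb_F: "a \<in> F \<Longrightarrow> (a, a) \<in> G"
  and emb_diff: "(a, b) \<in> G \<Longrightarrow> (c, d) \<in> G \<Longrightarrow> (a - c, b - d) \<in> G"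
  and emb_mult: "(a, b) \<in> G \<Longrightarrow> (c, d) \<in> G \<Longrightarrow> (a * c, b * d) \<in> G"
  and emb_0D: "(0, b) \<in> G \<Longrightarrow> b = 0"
  using G unfolding emb_def by blast+

lemma emb_0: "(0, 0) \<in> G" and emb_1: "(1, 1) \<in> G"
  using emb_F is_subfieldD[OF F] by auto

lemma emb_add: "(a, b) \<in> G \<Longrightarrow> (c, d) \<in> G \<Longrightarrow> (a + c, b + d) \<in> G"
  using emb_diff[OF _ emb_diff[OF emb_0, of c d], of a b] by simp

lemma emb_unique: "(a, b) \<in> G \<Longrightarrow> (a, b') \<in> G \<Longrightarrow> b = b'"
  using emb_diff[of a b a b'] emb_0D by fastforce

lemma emb_power: "(a, b) \<in> G \<Longrightarrow> (a ^ n, b ^ n) \<in> G"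
  by (induction n) (auto intro: emb_1 emb_mult)

lemma emb_sum: "(\<And>i. i \<in> A \<Longrightarrow> (f i, g i) \<in> G) \<Longrightarrow> (sum f A, sum g A) \<in> G"
  by (induction A rule: infinite_finite_induct) (auto intro: emb_0 emb_add)

lemma poly_rel_refl: "poly_over F p \<Longrightarrow> poly_rel G p p"
  by (simp add: poly_rel_def poly_over_def emb_F)

lemma emb_poly:
  assumes "poly_rel G p q" "(a, b) \<in> G" shows "(poly p a, poly q b) \<in> G"
proof -
  define n where "n = max (degree p) (degree q)"
  have "poly p a = (\<Sum>i\<le>n. coeff p i * a ^ i)" "poly q b = (\<Sum>i\<le>n. coeff q i * b ^ i)"
    unfolding poly_altdef n_def by (intro sum.mono_neutral_left; auto simp: coeff_eq_0)+
  then show ?thesis using assms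
    by (auto simp: poly_rel_def intro!: emb_sum emb_mult emb_power)
qed

lemma emb_inverse:
  assumes "(a, b) \<in> G" shows "(inverse a, inverse b) \<in> G"
proof (cases "a = 0")
  case True
  then have "b = 0" using assms emb_0D by blast
  then show ?thesis using True emb_0 by simp
next
  case False
  obtain r where r: "poly_over F r" "a * poly r a = 1"
    using algebraic_inverse_poly[OF F alg False] by blast
  have *: "(poly r a, poly r b) \<in> G" using emb_poly[OF poly_rel_refl[OF r(1)] assms] .
  have "b * poly r b = 1" using emb_unique[OF emb_mult[OF assms *, unfolded r(2)] emb_1] .
  then show ?thesis using * r(2) inverse_unique by metis
qed

lemma emb_eq_0_iff: "(a, b) \<in> G \<Longrightarrow> a = 0 \<longleftrightarrow> b = 0"
proof -
  assume ab: "(a, b) \<in> G"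
  have "b \<noteq> 0" if "a \<noteq> 0"
    using emb_unique[OF emb_1, of "b * inverse b"] emb_mult[OF ab emb_inverse[OF ab]] that by auto
  then show ?thesis using emb_0D ab by blast
qed

lemma emb_Domain: "is_subfield (Domain G)"
  unfolding is_subfield_def
proof (intro conjI ballI)
  show "1 \<in> Domain G" using emb_1 by (rule DomainI)
  show "inverse a \<in> Domain G" if "a \<in> Domain G" for a
    using that by (elim DomainE) (rule DomainI, rule emb_inverse)
  show "a - b \<in> Domain G" if "a \<in> Domain G" "b \<in> Domain G" for a b
    using that by (elim DomainE) (rule DomainI, rule emb_diff)
  show "a * b \<in> Domain G" if "a \<in> Domain G" "b \<in> Domain G" for a b
    using that by (elim DomainE) (rule DomainI, rule emb_mult)
qed

lemma emb_Domain_incl: "F \<subseteq> Domain G"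
  using emb_F by blast

lemma poly_rel_diff: "poly_rel G p q \<Longrightarrow> poly_rel G r s \<Longrightarrow> poly_rel G (p - r) (q - s)"
  by (simp add: poly_rel_def emb_diff)

lemma poly_rel_mult: "poly_rel G p q \<Longrightarrow> poly_rel G r s \<Longrightarrow> poly_rel G (p * r) (q * s)"
  by (simp add: poly_rel_def coeff_mult emb_mult emb_sum)

lemma poly_rel_unique: "poly_rel G p q \<Longrightarrow> poly_rel G p r \<Longrightarrow> q = r"
  by (auto simp: poly_rel_def poly_eq_iff intro: emb_unique)

lemma poly_rel_degree: "poly_rel G p q \<Longrightarrow> degree p = degree q"
proof -
  assume *: "poly_rel G p q"
  have "coeff p i = 0 \<longleftrightarrow> coeff q i = 0" for i
    using * emb_eq_0_iff unfolding poly_rel_def by blast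
  then show ?thesis unfolding degree_def by simp
qed

lemma poly_rel_exists:
  assumes "poly_over (Domain G) p" shows "\<exists>q. poly_rel G p q"
proof
  define f where "f a = (THE b. (a, b) \<in> G)" for a
  have f: "(a, f a) \<in> G" if "a \<in> Domain G" for a
  proof -
    obtain b where b: "(a, b) \<in> G" using \<open>a \<in> Domain G\<close> by blast
    show ?thesis unfolding f_def by (rule theI, rule b) (rule emb_unique[OF _ b])
  qed
  have "f 0 = 0" using f[of 0] emb_0 emb_0D by blast
  then show "poly_rel G p (map_poly f p)"
    using f assms by (simp add: poly_rel_def coeff_map_poly poly_over_def)
qed

lemma poly_rel_over: "poly_rel G p q \<Longrightarrow> poly_over (Domain G) p"
  by (auto simp: poly_rel_def poly_over_def)

lemma poly_rel_const: "(a, b) \<in> G \<Longrightarrow> poly_rel G [:a:] [:b:]"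
  using emb_0 by (auto simp: poly_rel_def coeff_pCons split: nat.splits)

definition adjoin :: "'a \<Rightarrow> 'a \<Rightarrow> ('a \<times> 'a) set" where
  "adjoin z z' = {(poly g z, poly g' z') | g g'. poly_rel G g g'}"

lemma minpoly_image_vanish:
  assumes m: "is_minpoly (Domain G) z m" "poly_rel G m m'" "poly m' z' = 0"
    and g: "poly_rel G g g'" "poly g z = 0"
  shows "poly g' z' = 0"
proof -
  obtain s where s: "poly_over (Domain G) s" "g = s * m"
    using minpoly_divides[OF emb_Domain m(1) poly_rel_over[OF g(1)] g(2)] by blast
  obtain s' where "poly_rel G s s'" using poly_rel_exists[OF s(1)] by blast
  then have "poly_rel G g (s' * m')" unfolding s(2) using poly_rel_mult m(2) by blast
  then have "g' = s' * m'" using poly_rel_unique g(1) by blast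
  then show ?thesis using m(3) by simp
qed

lemma adjoin_emb:
  assumes m: "is_minpoly (Domain G) z m" "poly_rel G m m'" "poly m' z' = 0"
  shows "emb F (adjoin z z')" "G \<subseteq> adjoin z z'" "(z, z') \<in> adjoin z z'"
proof -
  show *: "G \<subseteq> adjoin z z'"
  proof
    fix p assume "p \<in> G"
    then obtain a b where "p = (a, b)" "(a, b) \<in> G" by (cases p) auto
    then show "p \<in> adjoin z z'" unfolding adjoin_def
      using poly_rel_const[of a b] by (force intro: exI[of _ "[:a:]"] exI[of _ "[:b:]"])
  qed
  have "poly_rel G [:0, 1:] [:0, 1:]"
    using emb_0 emb_1 by (auto simp: poly_rel_def coeff_pCons split: nat.splits)
  then show "(z, z') \<in> adjoin z z'"
    unfolding adjoin_def by (force intro: exI[of _ "[:0, 1:]"])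
  show "emb F (adjoin z z')"
    unfolding emb_def
  proof (intro conjI allI impI ballI)
    show "(a, a) \<in> adjoin z z'" if "a \<in> F" for a using * emb_F that by blast
    fix a b assume "(a, b) \<in> adjoin z z'"
    then obtain g g' where g: "poly_rel G g g'" "a = poly g z" "b = poly g' z'"
      unfolding adjoin_def by blast
    fix c d assume "(c, d) \<in> adjoin z z'"
    then obtain h h' where h: "poly_rel G h h'" "c = poly h z" "d = poly h' z'"
      unfolding adjoin_def by blast
    show "(a - c, b - d) \<in> adjoin z z'" unfolding adjoin_def
      using poly_rel_diff[OF g(1) h(1)] g h by (force intro: exI[of _ "g - h"] exI[of _ "g' - h'"])
    show "(a * c, b * d) \<in> adjoin z z'" unfolding adjoin_def
      using poly_rel_mult[OF g(1) h(1)] g h by (force intro: exI[of _ "g * h"] exI[of _ "g' * h'"])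
  next
    fix b assume "(0, b) \<in> adjoin z z'"
    then obtain g g' where g: "poly_rel G g g'" "0 = poly g z" "b = poly g' z'"
      unfolding adjoin_def by blast
    show "b = 0" using minpoly_image_vanish[OF m g(1)] g by simp
  qed
qed

lemma minpoly_image:
  assumes m: "is_minpoly (Domain G) z m"
  obtains m' where "poly_rel G m m'" "lead_coeff m' = 1" "degree m' = degree m" "m' \<noteq> 0"
proof -
  obtain m' where m': "poly_rel G m m'" using poly_rel_exists[OF is_minpolyD(1)[OF m]] by blast
  have d: "degree m' = degree m" using poly_rel_degree[OF m'] by simp
  have "(1, lead_coeff m') \<in> G"
    using m' is_minpolyD(2)[OF m] unfolding poly_rel_def d by metis
  then have "lead_coeff m' = 1" using emb_unique emb_1 by blast
  moreover from this have "m' \<noteq> 0" by auto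
  ultimately show ?thesis using that m' d by blast
qed

end

lemma emb_Union:
  assumes "\<C> \<noteq> {}" and chain: "\<And>X Y. X \<in> \<C> \<Longrightarrow> Y \<in> \<C> \<Longrightarrow> X \<subseteq> Y \<or> Y \<subseteq> X"
    and e: "\<And>X. X \<in> \<C> \<Longrightarrow> emb F X"
  shows "emb F (\<Union>\<C>)"
  unfolding emb_def
proof (intro conjI allI impI ballI)
  show "(a, a) \<in> \<Union>\<C>" if "a \<in> F" for a using emb_F[OF e] that assms(1) by blast
  show "b = 0" if "(0, b) \<in> \<Union>\<C>" for b using emb_0D[OF e] that by blast
  fix a b c d assume "(a, b) \<in> \<Union>\<C>" "(c, d) \<in> \<Union>\<C>"
  then obtain X where "X \<in> \<C>" "(a, b) \<in> X" "(c, d) \<in> X" using chain by blast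
  then show "(a - c, b - d) \<in> \<Union>\<C>" "(a * c, b * d) \<in> \<Union>\<C>"
    using emb_diff[OF e] emb_mult[OF e] by blast+
qed

text \<open>Surjectivity comes for free: a polynomial over \<open>F\<close> has finitely many roots,
  which the injective map permutes, and every element is such a root.\<close>

lemma aut_of_emb:
  assumes G: "emb F G" and D: "Domain G = UNIV"
  shows "\<exists>\<tau>. aut_over F \<tau> \<and> (\<forall>a b. (a, b) \<in> G \<longleftrightarrow> \<tau> a = b)"
proof -
  have "\<forall>a. \<exists>b. (a, b) \<in> G" using D by blast
  then obtain \<tau> where t: "\<And>a. (a, \<tau> a) \<in> G" by metis
  have graph: "(a, b) \<in> G \<longleftrightarrow> \<tau> a = b" for a b using t emb_unique[OF G] by blast
  have add: "\<tau> (a + b) = \<tau> a + \<tau> b" and mult: "\<tau> (a * b) = \<tau> a * \<tau> b" for a b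
    using emb_add[OF G t t] emb_mult[OF G t t] unfolding graph by blast+
  have diff: "\<tau> (a - b) = \<tau> a - \<tau> b" for a b
    using emb_diff[OF G t t] unfolding graph by blast
  have inj: "inj \<tau>"
  proof (rule injI)
    fix a b assume "\<tau> a = \<tau> b"
    then have "(a - b, 0) \<in> G" unfolding graph diff by simp
    then show "a = b" using emb_eq_0_iff[OF G] by fastforce
  qed
  have "surj \<tau>"
  proof -
    have "b \<in> range \<tau>" for b
    proof -
      obtain p where p: "p \<noteq> 0" "poly_over F p" "poly p b = 0"
        using alg[of b] unfolding algebraic_over_def by blast
      let ?R = "{r. poly p r = 0}"
      have "\<tau> ` ?R \<subseteq> ?R"
      proof safe
        fix r assume "poly p r = 0"
        then show "poly p (\<tau> r) = 0"
          using emb_poly[OF G poly_rel_refl[OF G p(2)] t[of r]] emb_0D[OF G] by simp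
      qed
      then have "\<tau> ` ?R = ?R"
        using inj poly_roots_finite[OF p(1)] by (intro endo_inj_surj) (auto intro: inj_on_subset)
      then show ?thesis using p(3) by blast
    qed
    then show ?thesis by blast
  qed
  with inj have "bij \<tau>" by (rule bijI)
  then have "aut_over F \<tau>"
    unfolding aut_over_def using add mult emb_F[OF G] graph by blast
  then show ?thesis using graph by blast
qed

text \<open>The property \<open>P\<close> is carried through Zorn's lemma. It is trivial for plain
  extensions and is preservation of \<open>V\<close> for extensions that respect the
  valuation.\<close>

lemma emb_extend_aut:
  assumes G: "emb F G" "\<And>a b. (a, b) \<in> G \<Longrightarrow> P a b"
    and step: "\<And>H z. emb F H \<Longrightarrow> (\<And>a b. (a, b) \<in> H \<Longrightarrow> P a b) \<Longrightarrow>
      \<exists>H'. emb F H' \<and> H \<subseteq> H' \<and> z \<in> Domain H' \<and> (\<forall>a b. (a, b) \<in> H' \<longrightarrow> P a b)"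
  shows "\<exists>\<tau>. aut_over F \<tau> \<and> (\<forall>a b. (a, b) \<in> G \<longrightarrow> \<tau> a = b) \<and> (\<forall>a. P a (\<tau> a))"
proof -
  let ?A = "{H. emb F H \<and> G \<subseteq> H \<and> (\<forall>a b. (a, b) \<in> H \<longrightarrow> P a b)}"
  have "\<exists>M\<in>?A. \<forall>X\<in>?A. M \<subseteq> X \<longrightarrow> X = M"
  proof (rule subset_Zorn_nonempty)
    show "?A \<noteq> {}" using G by blast
    fix \<C> assume C: "\<C> \<noteq> {}" "subset.chain ?A \<C>"
    have "emb F (\<Union>\<C>)"
      using C by (intro emb_Union) (auto simp: subset_chain_def)
    then show "\<Union>\<C> \<in> ?A" using C by (auto simp: subset_chain_def)
  qed
  then obtain M where M: "M \<in> ?A" and "\<forall>X\<in>?A. M \<subseteq> X \<longrightarrow> X = M" (is ?max) by (rule bexE)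
  have max: "X = M" if "X \<in> ?A" "M \<subseteq> X" for X
  proof -
    from \<open>?max\<close> that(1) have "M \<subseteq> X \<longrightarrow> X = M" by (rule bspec)
    then show ?thesis using that(2) by (rule mp)
  qed
  have "z \<in> Domain M" for z
  proof -
    obtain H' where H': "emb F H'" "M \<subseteq> H'" "z \<in> Domain H'" "\<forall>a b. (a, b) \<in> H' \<longrightarrow> P a b"
      using step[of M z] M by blast
    then have "H' = M" using M by (intro max) auto
    then show ?thesis using H' by blast
  qed
  then obtain \<tau> where \<tau>: "aut_over F \<tau>" "\<forall>a b. (a, b) \<in> M \<longleftrightarrow> \<tau> a = b"
    using aut_of_emb[of M] M by blast
  then show ?thesis using M by blast
qed

lemma emb_extend_aut_simple:
  assumes G: "emb F G"
  shows "\<exists>\<tau>. aut_over F \<tau> \<and> (\<forall>a b. (a, b) \<in> G \<longrightarrow> \<tau> a = b)"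
proof -
  have "\<exists>H'. emb F H' \<and> H \<subseteq> H' \<and> z \<in> Domain H' \<and> (\<forall>a b. (a, b) \<in> H' \<longrightarrow> True)"
    if H: "emb F H" for H z
  proof -
    obtain m where m: "is_minpoly (Domain H) z m"
      using minpoly_exists[OF emb_Domain[OF H] alg_over[OF emb_Domain_incl[OF H]]] by blast
    obtain m' where m': "poly_rel H m m'" "degree m' = degree m" using minpoly_image[OF H m] by blast
    obtain z' where "poly m' z' = 0"
      using alg_closed_imp_poly_has_root[of m'] is_minpolyD(5)[OF m] m'(2) by auto
    then show ?thesis using adjoin_emb[OF H m m'(1)] by (meson DomainI)
  qed
  then show ?thesis
    using emb_extend_aut[of G "\<lambda>_ _. True"] G by blast
qed

lemma emb_Id: "is_subfield M \<Longrightarrow> F \<subseteq> M \<Longrightarrow> emb F (Id_on M)"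
  unfolding emb_def by (auto simp: is_subfieldD)

lemma minpoly_conjugate:
  assumes m: "is_minpoly F c m" and c': "poly m c' = 0"
  shows "\<exists>\<tau>. aut_over F \<tau> \<and> \<tau> c = c'"
proof -
  have I: "emb F (Id_on F)" using emb_Id[OF F] by simp
  have r: "poly_rel (Id_on F) m m"
    using poly_rel_refl[OF I is_minpolyD(1)[OF m]] .
  have m': "is_minpoly (Domain (Id_on F)) c m" using m by simp
  show ?thesis
    using emb_extend_aut_simple[OF adjoin_emb(1)[OF I m' r c']] adjoin_emb(3)[OF I m' r c'] by blast
qed

text \<open>All roots of \<open>m\<close> are conjugates of \<open>c\<close>, so \<open>c\<close> is
  the only one and the squarefree \<open>m\<close> is linear.\<close>

lemma rsquarefree_fixed:
  assumes m: "is_minpoly F c m" "rsquarefree m" and fixed: "\<And>\<tau>. aut_over F \<tau> \<Longrightarrow> \<tau> c = c"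
  shows "c \<in> F"
proof -
  have "{r. poly m r = 0} = {c}"
  proof (intro equalityI subsetI)
    fix r assume "r \<in> {r. poly m r = 0}"
    then obtain \<tau> where "aut_over F \<tau>" "\<tau> c = r" using minpoly_conjugate[OF m(1)] by auto
    then show "r \<in> {c}" using fixed by auto
  qed (use is_minpolyD(3)[OF m(1)] in auto)
  then have "m = [:-c, 1:]"
    using rsquarefree_factorization(1)[OF m(2)] is_minpolyD(2)[OF m(1)] by simp
  then have "- c \<in> F" using poly_overD[OF is_minpolyD(1)[OF m(1)], of 0] by simp
  then show ?thesis using is_subfieldD(7)[OF F] by fastforce
qed

end

text \<open>The coefficient of degree \<open>i\<close> is annihilated by \<open>i\<close>, so only
  exponents divisible by the characteristic occur; positive degree then excludes characteristic
  zero.\<close>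

lemma pderiv_eq_0_imp_pcompose:
  fixes m :: "'a::field poly"
  assumes "pderiv m = 0" "degree m > 0" and R: "is_subring R" "poly_over R m"
  shows "CHAR('a) > 0 \<and> (\<exists>h. poly_over R h \<and> h \<noteq> 0 \<and> degree h < degree m \<and>
    (\<forall>a. poly m a = poly h (a ^ CHAR('a))))"
proof -
  let ?p = "CHAR('a)"
  have z: "of_nat i * coeff m i = 0" for i
    using arg_cong[OF assms(1), of "\<lambda>q. coeff q (i - 1)"] by (cases i) (auto simp: coeff_pderiv)
  have dv: "?p dvd i" if "coeff m i \<noteq> 0" for i
    using z[of i] that by (simp add: of_nat_eq_0_iff_char_dvd)
  have "?p dvd degree m" using dv[of "degree m"] assms(2) by fastforce
  then have p: "?p > 0" using assms(2) by (auto intro: Nat.gr0I)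
  then have p1: "?p > 1" using CHAR_not_1'[where 'a='a] by linarith
  define n where "n = degree m div ?p"
  define h where "h = (\<Sum>j\<le>n. monom (coeff m (?p * j)) j)"
  have deg: "degree m = ?p * n" unfolding n_def using \<open>?p dvd degree m\<close> by simp
  have ch: "coeff h j = (if j \<le> n then coeff m (?p * j) else 0)" for j
    by (simp add: h_def coeff_sum)
  have ph: "poly m a = poly h (a ^ ?p)" for a
  proof -
    have "poly m a = (\<Sum>i\<le>?p * n. coeff m i * a ^ i)" by (simp add: poly_altdef deg)
    also have "\<dots> = (\<Sum>i\<in>(\<lambda>j. ?p * j) ` {..n}. coeff m i * a ^ i)"
    proof (rule sum.mono_neutral_right)
      show "\<forall>i\<in>{..?p * n} - (\<lambda>j. ?p * j) ` {..n}. coeff m i * a ^ i = 0"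
      proof
        fix i assume i: "i \<in> {..?p * n} - (\<lambda>j. ?p * j) ` {..n}"
        show "coeff m i * a ^ i = 0"
        proof (rule ccontr)
          assume "coeff m i * a ^ i \<noteq> 0"
          then obtain j where "i = ?p * j" using dv by (metis dvdE mult_eq_0_iff)
          then show False using i p by auto
        qed
      qed
    qed auto
    also have "\<dots> = (\<Sum>j\<le>n. coeff m (?p * j) * a ^ (?p * j))"
      using p by (subst sum.reindex) (auto simp: inj_on_def)
    also have "\<dots> = poly h (a ^ ?p)"
      by (simp add: h_def poly_sum poly_monom power_mult)
    finally show ?thesis .
  qed
  have "n > 0" using deg assms(2) by auto
  have "degree h \<le> n" by (rule degree_le) (simp add: ch)
  moreover have "n < degree m" using deg p1 \<open>n > 0\<close> by simp
  moreover have "h \<noteq> 0"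
    using ch[of n] assms(2) deg by (metis coeff_0 degree_0 leading_coeff_0_iff le_refl less_irrefl)
  moreover have "poly_over R h"
    using poly_overD[OF R(2)] is_subringD(2)[OF R(1)] by (simp add: poly_over_def ch)
  ultimately show ?thesis using p ph by (metis le_less_trans)
qed

text \<open>The exponent \<open>k\<close> minimizes the degree of the minimal polynomial. Were its
  derivative zero, the next power would have a smaller degree. The clause on \<open>CHAR('a)\<close>
  rules out the meaningless power \<open>b ^ 0\<close> in characteristic zero.\<close>

lemma separable_power:
  fixes b :: "'a::field"
  assumes F: "is_subfield F" and b: "algebraic_over F b"
  shows "\<exists>k m. (CHAR('a) > 0 \<or> k = 0) \<and> is_minpoly F (b ^ CHAR('a) ^ k) m \<and> rsquarefree m"
proof -
  let ?p = "CHAR('a)"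
  let ?Q = "\<lambda>n. \<exists>k m. (?p > 0 \<or> k = 0) \<and> is_minpoly F (b ^ ?p ^ k) m \<and> degree m = n"
  have ex: "\<exists>m. is_minpoly F (b ^ ?p ^ k) m" for k
    using is_subfieldD(9)[OF alg_closure_subfield[OF F]] b minpoly_exists[OF F]
    by (simp add: alg_closure_def)
  then have "\<exists>n. ?Q n" by blast
  then obtain k m where m: "is_minpoly F (b ^ ?p ^ k) m" "degree m = (LEAST n. ?Q n)"
    and k: "?p > 0 \<or> k = 0"
    using LeastI_ex[OF \<open>\<exists>n. ?Q n\<close>] by blast
  have "pderiv m \<noteq> 0"
  proof
    assume "pderiv m = 0"
    then obtain h where h: "poly_over F h" "h \<noteq> 0" "degree h < degree m"
      "\<And>a. poly m a = poly h (a ^ ?p)" and p: "?p > 0"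
      using pderiv_eq_0_imp_pcompose[OF _ is_minpolyD(5)[OF m(1)] subfield_imp_subring[OF F] is_minpolyD(1)[OF m(1)]]
      by blast
    obtain m2 where m2: "is_minpoly F (b ^ ?p ^ Suc k) m2" using ex by blast
    have "poly h (b ^ ?p ^ Suc k) = 0"
      using h(4)[of "b ^ ?p ^ k"] is_minpolyD(3)[OF m(1)] by (simp add: power_mult[symmetric] mult.commute)
    then have "degree m2 \<le> degree h" using is_minpolyD(6)[OF m2 h(2) h(1)] by simp
    moreover have "degree m \<le> degree m2"
      unfolding m(2) using m2 p by (intro Least_le) blast
    ultimately show False using h(3) by linarith
  qed
  then show ?thesis using minpoly_rsquarefree[OF F m(1)] m(1) k by blast
qed

lemma (in ambient) fixed_imp_power_mem:
  assumes fixed: "\<And>\<tau>. aut_over F \<tau> \<Longrightarrow> \<tau> c = c"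
  shows "\<exists>k. (CHAR('a) > 0 \<or> k = 0) \<and> c ^ CHAR('a) ^ k \<in> F"
proof -
  obtain k m where m: "is_minpoly F (c ^ CHAR('a) ^ k) m" "rsquarefree m" and k: "CHAR('a) > 0 \<or> k = 0"
    using separable_power[OF F alg, of c] by blast
  have "\<tau> (c ^ CHAR('a) ^ k) = c ^ CHAR('a) ^ k" if "aut_over F \<tau>" for \<tau>
    using fixed[OF that] aut_overD(10)[OF that] by simp
  then show ?thesis using rsquarefree_fixed[OF m] k by blast
qed

text \<open>Separable closedness within the ambient field, phrased through simple roots because
  these are what Hensel's Lemma produces.\<close>

definition simple_root_closed :: "'a::field set \<Rightarrow> bool" where
  "simple_root_closed F \<longleftrightarrow> (\<forall>f b. poly_over F f \<and> poly f b = 0 \<and> poly (pderiv f) b \<noteq> 0 \<longrightarrow> b \<in> F)"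

text \<open>
  A purely inseparable element is never reached by adjoining simple roots: take a subfield maximal
  among those avoiding \<open>c\<close>. If \<open>b\<close> is a simple root with minimal polynomial \<open>m\<close> and \<open>c = g(b)\<close> with
  \<open>deg g < deg m\<close>, then all the distinct roots of \<open>m\<close> are roots of \<open>(g - c)\<^sup>p\<close>, so \<open>g\<close> is constant.
\<close>

lemma inseparable_avoids_simple_roots:
  fixes c :: "'a::alg_closed_field"
  assumes F0: "is_subfield F0" and c: "c \<notin> F0" "c ^ CHAR('a) \<in> F0" and p: "CHAR('a) > 0"
  shows "\<exists>F. is_subfield F \<and> F0 \<subseteq> F \<and> c \<notin> F \<and> simple_root_closed F"
proof -
  let ?A = "{F. is_subfield F \<and> F0 \<subseteq> F \<and> c \<notin> F}"
  have "\<exists>M\<in>?A. \<forall>X\<in>?A. M \<subseteq> X \<longrightarrow> X = M"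
  proof (rule subset_Zorn_nonempty)
    show "?A \<noteq> {}" using F0 c by blast
    fix \<C> assume C: "\<C> \<noteq> {}" "subset.chain ?A \<C>"
    have ch: "X \<subseteq> Y \<or> Y \<subseteq> X" if "X \<in> \<C>" "Y \<in> \<C>" for X Y
      using C(2) that by (auto simp: subset_chain_def)
    have sub: "is_subfield X" if "X \<in> \<C>" for X using C(2) that by (auto simp: subset_chain_def)
    have "is_subfield (\<Union>\<C>)"
      unfolding is_subfield_def
    proof (intro conjI ballI)
      show "1 \<in> \<Union>\<C>" using C(1) sub is_subfieldD(1) by blast
      show "inverse a \<in> \<Union>\<C>" if "a \<in> \<Union>\<C>" for a using that sub is_subfieldD(6) by blast
      fix a b assume "a \<in> \<Union>\<C>" "b \<in> \<Union>\<C>"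
      then obtain X where X: "X \<in> \<C>" "a \<in> X" "b \<in> X" using ch by blast
      then show "a - b \<in> \<Union>\<C>" "a * b \<in> \<Union>\<C>"
        using is_subfieldD(3,5)[OF sub[OF X(1)]] by blast+
    qed
    then show "\<Union>\<C> \<in> ?A" using C by (auto simp: subset_chain_def)
  qed
  then obtain M where M: "M \<in> ?A" and "\<forall>X\<in>?A. M \<subseteq> X \<longrightarrow> X = M" (is ?max) by (rule bexE)
  have max: "X = M" if "X \<in> ?A" "M \<subseteq> X" for X
  proof -
    from \<open>?max\<close> that(1) have "M \<subseteq> X \<longrightarrow> X = M" by (rule bspec)
    then show ?thesis using that(2) by (rule mp)
  qed
  have MF: "is_subfield M" and F0M: "F0 \<subseteq> M" and cM: "c \<notin> M" using M by auto
  note MR = subfield_imp_subring[OF MF]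
  have "b \<in> M" if b: "poly_over M f" "poly f b = 0" "poly (pderiv f) b \<noteq> 0" for f b
  proof (rule ccontr)
    assume bM: "b \<notin> M"
    have "f \<noteq> 0" using b(3) by auto
    then have ba: "algebraic_over M b" using b unfolding algebraic_over_def by blast
    have "c \<in> field_adjoin M {b}"
    proof (rule ccontr)
      assume "c \<notin> field_adjoin M {b}"
      then have "field_adjoin M {b} = M"
        using field_adjoin_incl(1)[of M "{b}"] F0M by (intro max) auto
      then show False using bM field_adjoin_incl(2)[of "{b}" M] by blast
    qed
    then obtain g0 where g0: "poly_over M g0" "c = poly g0 b"
      unfolding field_adjoin_algebraic[OF MF ba] poly_values_def by blast
    obtain m where m: "is_minpoly M b m" using minpoly_exists[OF MF ba] by blast
    obtain s where s: "f = s * m" using minpoly_divides[OF MF m b(1,2)] by blast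
    have "pderiv m \<noteq> 0"
      using b(3) is_minpolyD(3)[OF m] unfolding s by (auto simp: pderiv_mult)
    then have rsq: "rsquarefree m" using minpoly_rsquarefree[OF MF m] by blast
    obtain q g where g: "poly_over M g" "g0 = q * m + g" "g = 0 \<or> degree g < degree m"
      using poly_over_reduce[OF MR is_minpolyD(1,2)[OF m] g0(1)] by blast
    have cg: "poly g b = c" using g0(2) is_minpolyD(3)[OF m] unfolding g(2) by simp
    have root: "poly g r = c" if r: "poly m r = 0" for r
    proof -
      \<comment> \<open>Although \<open>c\<close> is outside \<open>M\<close>, this polynomial is
        over \<open>M\<close> because the power of \<open>c\<close> is in it; vanishing at
        \<open>b\<close>, it is divisible by \<open>m\<close>.\<close>
      let ?h = "g ^ CHAR('a) - [:c ^ CHAR('a):]"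
      have "poly_over M [:c ^ CHAR('a):]"
        using c(2) F0M by (auto intro!: poly_over_pCons[OF MR] poly_over_0[OF MR])
      then have "poly_over M ?h" using g(1) by (intro poly_over_diff[OF MR] poly_over_power[OF MR])
      moreover have "poly ?h b = 0" using cg by simp
      ultimately obtain t where "?h = t * m" using minpoly_divides[OF MF m] by blast
      then have "poly ?h r = 0" using r by simp
      then have *: "poly g r ^ CHAR('a) = c ^ CHAR('a)" by simp
      have "prime CHAR('a)" using prime_CHAR_semidom[OF p] .
      then have "(poly g r - c + c) ^ CHAR('a) = (poly g r - c) ^ CHAR('a) + c ^ CHAR('a)"
        by (intro freshmans_dream) auto
      then have "(poly g r - c) ^ CHAR('a) = 0" using * by simp
      then show ?thesis by simp
    qed
    have "g = [:c:]"
    proof (rule ccontr)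
      assume ne: "g \<noteq> [:c:]"
      let ?h = "g - [:c:]"
      have h0: "?h \<noteq> 0" using ne by simp
      have "degree ?h < degree m"
        using g(3) is_minpolyD(5)[OF m] by (auto intro!: degree_diff_less)
      moreover have "card {r. poly m r = 0} \<le> card {r. poly ?h r = 0}"
        using root by (intro card_mono poly_roots_finite h0) auto
      moreover have "card {r. poly ?h r = 0} \<le> degree ?h"
        using card_poly_roots_bound[OF h0] .
      ultimately show False using rsquarefree_factorization(2)[OF rsq] by linarith
    qed
    then have "c \<in> M" using poly_overD[OF g(1), of 0] by simp
    then show False using cM by blast
  qed
  then have "simple_root_closed M" unfolding simple_root_closed_def by blast
  then show ?thesis using M by blast
qed

section \<open>Valuation subrings\<close>

text \<open>\<open>wle V a b\<close> means \<open>v a \<le> v b\<close> for the valuation \<open>v\<close> with ring \<open>V\<close>, where \<open>v 0 = \<infinity>\<close>.\<close>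

definition wle :: "'a::field set \<Rightarrow> 'a \<Rightarrow> 'a \<Rightarrow> bool" where
  "wle V a b \<longleftrightarrow> (\<exists>c\<in>V. b = c * a)"

locale valuation_subring =
  fixes V :: "'a::field set"
  assumes subring: "is_subring V" and total: "a \<in> V \<or> inverse a \<in> V"
begin

text \<open>The order is that of values: \<open>1 \<prec> a\<close> says that \<open>a\<close> lies
  in the maximal ideal, and for \<open>a \<in> V\<close> the relation \<open>a \<preceq> 1\<close>
  says that \<open>a\<close> is a unit.\<close>

abbreviation le (infix "\<preceq>" 50) where "a \<preceq> b \<equiv> wle V a b"
abbreviation lt (infix "\<prec>" 50) where "a \<prec> b \<equiv> \<not> wle V b a"

lemmas V_rules = is_subringD[OF subring]

lemma le_iff: "a \<noteq> 0 \<Longrightarrow> a \<preceq> b \<longleftrightarrow> b / a \<in> V"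
  unfolding wle_def by (metis nonzero_eq_divide_eq)

lemma le_0 [simp]: "a \<preceq> 0"
  unfolding wle_def using V_rules(2) by force

lemma zero_le_iff [simp]: "0 \<preceq> a \<longleftrightarrow> a = 0"
  unfolding wle_def using V_rules(2) by auto

lemma le_refl [simp]: "a \<preceq> a"
  unfolding wle_def using V_rules(1) by force

lemma le_trans [trans]: "a \<preceq> b \<Longrightarrow> b \<preceq> c \<Longrightarrow> a \<preceq> c"
  unfolding wle_def using V_rules(5) by (metis mult.assoc)

lemma le_total: "a \<preceq> b \<or> b \<preceq> a"
proof (cases "a = 0 \<or> b = 0")
  case False
  then show ?thesis using total[of "a / b"] by (auto simp: le_iff)
qed auto

lemma mem_iff: "a \<in> V \<longleftrightarrow> 1 \<preceq> a"
  by (simp add: wle_def)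

lemma le_mult_left: "a \<preceq> b \<Longrightarrow> c * a \<preceq> c * b"
  unfolding wle_def by (metis mult.left_commute)

lemma le_mult_right: "a \<preceq> b \<Longrightarrow> a * c \<preceq> b * c"
  using le_mult_left by (metis mult.commute)

lemma le_mult_cancel [simp]: "c \<noteq> 0 \<Longrightarrow> c * a \<preceq> c * b \<longleftrightarrow> a \<preceq> b"
  using le_mult_left[of "c * a" "c * b" "inverse c"] le_mult_left[of a b c]
  by (auto simp: mult.assoc[symmetric])

lemma le_mult_cancel_right [simp]: "c \<noteq> 0 \<Longrightarrow> a * c \<preceq> b * c \<longleftrightarrow> a \<preceq> b"
  using le_mult_cancel by (metis mult.commute)

lemma le_mult: "a \<preceq> b \<Longrightarrow> c \<preceq> d \<Longrightarrow> a * c \<preceq> b * d"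
  using le_mult_left le_mult_right le_trans by blast

lemma le_add: "a \<preceq> b \<Longrightarrow> a \<preceq> c \<Longrightarrow> a \<preceq> b + c"
  unfolding wle_def using V_rules(4) by (metis distrib_right)

lemma le_diff: "a \<preceq> b \<Longrightarrow> a \<preceq> c \<Longrightarrow> a \<preceq> b - c"
  unfolding wle_def using V_rules(3) by (metis left_diff_distrib)

lemma le_uminus [simp]: "a \<preceq> - b \<longleftrightarrow> a \<preceq> b"
  using le_diff[OF le_0, of a b] le_diff[OF le_0, of a "- b"] by auto

lemma uminus_le [simp]: "- a \<preceq> b \<longleftrightarrow> a \<preceq> b"
  using le_mult_left[of "- a" b "-1"] le_mult_left[of a b "-1"] by auto

lemma le_minus_commute: "a \<preceq> b - c \<longleftrightarrow> a \<preceq> c - b"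
  by (metis le_uminus minus_diff_eq)

lemma minus_le_commute: "b - c \<preceq> a \<longleftrightarrow> c - b \<preceq> a"
  by (metis uminus_le minus_diff_eq)

lemma lt_imp_le: "a \<prec> b \<Longrightarrow> a \<preceq> b"
  using le_total by blast

lemma lt_le_trans: "a \<prec> b \<Longrightarrow> b \<preceq> c \<Longrightarrow> a \<prec> c"
  and le_lt_trans: "a \<preceq> b \<Longrightarrow> b \<prec> c \<Longrightarrow> a \<prec> c"
  and lt_trans: "a \<prec> b \<Longrightarrow> b \<prec> c \<Longrightarrow> a \<prec> c"
  using le_trans le_total by blast+

lemma lt_add: "a \<prec> b \<Longrightarrow> a \<prec> c \<Longrightarrow> a \<prec> b + c"
  using le_total[of b c] le_add[of b b c] le_add[of c b c] lt_le_trans by (metis le_refl)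

lemma lt_diff: "a \<prec> b \<Longrightarrow> a \<prec> c \<Longrightarrow> a \<prec> b - c"
  using lt_add[where a = a and b = b and c = "- c"] by simp

lemma lt_sum: "a \<noteq> 0 \<Longrightarrow> (\<And>i. i \<in> A \<Longrightarrow> a \<prec> f i) \<Longrightarrow> a \<prec> sum f A"
  by (induction A rule: infinite_finite_induct) (simp_all add: lt_add)

lemma lt_mult: "a \<prec> b \<Longrightarrow> c \<preceq> d \<Longrightarrow> c \<noteq> 0 \<Longrightarrow> a * c \<prec> b * d"
  by (metis le_mult_cancel_right le_mult_left lt_le_trans)

lemma dominant_add:
  assumes "a \<prec> b" shows "a \<preceq> a + b" "a + b \<preceq> a"
proof -
  show "a \<preceq> a + b" using assms by (simp add: le_add lt_imp_le)
  show "a + b \<preceq> a"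
  proof (rule ccontr)
    assume "a \<prec> a + b"
    then have "a \<prec> (a + b) - b" using assms by (rule lt_diff)
    then show False by simp
  qed
qed

lemma le_power: "a \<preceq> b \<Longrightarrow> a ^ n \<preceq> b ^ n"
  by (induction n) (auto intro: le_mult)

lemma lt_power: "a \<prec> b \<Longrightarrow> n > 0 \<Longrightarrow> a ^ n \<prec> b ^ n"
proof (induction n)
  case (Suc n)
  then have "a \<noteq> 0" by auto
  then show ?case using lt_mult[OF Suc.prems(1) le_power[OF lt_imp_le[OF Suc.prems(1)], of n]] by simp
qed simp

lemma le_inverse: "a \<preceq> b \<Longrightarrow> b \<noteq> 0 \<Longrightarrow> inverse b \<preceq> inverse a"
proof -
  assume *: "a \<preceq> b" "b \<noteq> 0"
  then have "a \<noteq> 0" by auto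
  then show ?thesis using *(1) *(2) by (simp add: le_iff divide_inverse mult.commute)
qed

lemma le_inverse_iff: "a \<noteq> 0 \<Longrightarrow> b \<noteq> 0 \<Longrightarrow> inverse b \<preceq> inverse a \<longleftrightarrow> a \<preceq> b"
  using le_inverse[of a b] le_inverse[of "inverse b" "inverse a"] by auto

lemma mem_power: "n > 0 \<Longrightarrow> a ^ n \<in> V \<longleftrightarrow> a \<in> V"
  using lt_power[where a = a and b = 1 and n = n] le_power[of 1 a n] by (auto simp: mem_iff)

lemma le_one_iff: "a \<preceq> 1 \<longleftrightarrow> a \<noteq> 0 \<and> inverse a \<in> V"
  by (cases "a = 0") (simp_all add: le_iff divide_inverse)

lemma mem_le: "a \<in> V \<Longrightarrow> b \<preceq> a * b"
  by (auto simp: wle_def)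

lemma poly_diff_le:
  assumes "poly_over V f" "a \<in> V" "b \<in> V" shows "b - a \<preceq> poly f b - poly f a"
proof -
  have "poly f b = (b - a) * poly (synthetic_div f a) b + poly f a"
    using arg_cong[OF synthetic_div_correct'[of a f], of "\<lambda>p. poly p b"] by (simp add: algebra_simps)
  moreover have "poly (synthetic_div f a) b \<in> V"
    using assms by (intro poly_in_subring[OF subring] poly_over_synthetic_div[OF subring])
  ultimately show ?thesis unfolding wle_def by (metis add_diff_cancel_right' mult.commute)
qed

end

locale valued_closed = valuation_subring V for V :: "'a::alg_closed_field set"
begin

text \<open>Both bounds come from \<open>f / f(0) = \<Prod> (1 - X / r)\<close>, the product over the roots \<open>r\<close> of \<open>f\<close>.\<close>

lemma coeff_le_of_roots:
  assumes "f \<noteq> 0" "\<And>r. poly f r = 0 \<Longrightarrow> r \<preceq> 1"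
  shows "coeff f 0 \<preceq> coeff f i"
  using assms
proof (induction "degree f" arbitrary: f i)
  case 0
  then show ?case by (cases i) (auto simp: coeff_eq_0)
next
  case (Suc n)
  obtain r where r: "poly f r = 0" using alg_closed_imp_poly_has_root[of f] Suc.hyps(2) by auto
  then obtain g where g: "f = [:-r, 1:] * g" by (auto simp: poly_eq_0_iff_dvd dvd_def)
  have g0: "g \<noteq> 0" using Suc.prems g by auto
  have "degree f = Suc (degree g)" using g0 unfolding g by (subst degree_mult_eq) auto
  then have IH: "coeff g 0 \<preceq> coeff g i" for i using Suc g0 g by auto
  have r1: "r \<preceq> 1" using Suc.prems r by blast
  have c0: "coeff f 0 = - (r * coeff g 0)" unfolding g by simp
  show ?case
  proof (cases i)
    case (Suc j)
    have "coeff f i = coeff g j - r * coeff g i" unfolding g Suc by simp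
    moreover have "r * coeff g 0 \<preceq> coeff g j" using le_mult[OF r1 IH[of j]] by simp
    moreover have "r * coeff g 0 \<preceq> r * coeff g i" using IH by (rule le_mult_left)
    ultimately show ?thesis by (simp add: c0 le_diff)
  qed simp
qed

lemma coeff_lt_of_roots:
  assumes "f \<noteq> 0" "\<And>r. poly f r = 0 \<Longrightarrow> r \<prec> 1" "i > 0"
  shows "coeff f 0 \<prec> coeff f i"
  using assms
proof (induction "degree f" arbitrary: f i)
  case 0
  then have "coeff f 0 \<noteq> 0" by (metis leading_coeff_0_iff)
  then show ?case using 0 by (auto simp: coeff_eq_0)
next
  case (Suc n)
  obtain r where r: "poly f r = 0" using alg_closed_imp_poly_has_root[of f] Suc.hyps(2) by auto
  then obtain g where g: "f = [:-r, 1:] * g" by (auto simp: poly_eq_0_iff_dvd dvd_def)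
  have g0: "g \<noteq> 0" using Suc.prems g by auto
  have "degree f = Suc (degree g)" using g0 unfolding g by (subst degree_mult_eq) auto
  then have IH: "coeff g 0 \<prec> coeff g i" if "i > 0" for i using Suc g0 g that by auto
  have le: "coeff g 0 \<preceq> coeff g j" for j using IH[of j] lt_imp_le by (cases "j = 0") auto
  have r1: "r \<prec> 1" using Suc.prems r by blast
  then have "r \<noteq> 0" by auto
  have c0: "coeff f 0 = - (r * coeff g 0)" unfolding g by simp
  have "coeff g 0 \<noteq> 0" using IH[of 1] by auto
  obtain j where j: "i = Suc j" using Suc.prems(3) by (cases i) auto
  have "coeff f i = coeff g j - r * coeff g i" unfolding g j by simp
  moreover have "r * coeff g 0 \<prec> coeff g j"
    using lt_mult[OF r1 le[of j] \<open>coeff g 0 \<noteq> 0\<close>] by simp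
  moreover have "r * coeff g 0 \<prec> r * coeff g i" using IH[OF Suc.prems(3)] \<open>r \<noteq> 0\<close> by simp
  ultimately show ?case by (simp add: c0 lt_diff)
qed

text \<open>The shifted polynomial has \<open>f(a)\<close> and \<open>f'(a)\<close> as its first two
  coefficients. Were all its roots outside the maximal ideal, the constant coefficient would have
  the least value, although \<open>f'(a)\<close> is a unit and \<open>f(a)\<close> is not.\<close>

lemma hensel_root_exists:
  assumes "poly_over V f" "a \<in> V" and fa: "1 \<prec> poly f a" and f'a: "poly (pderiv f) a \<preceq> 1"
  shows "\<exists>b. poly f b = 0 \<and> 1 \<prec> b - a"
proof -
  let ?g = "pcompose f [:a, 1:]"
  have c0: "coeff ?g 0 = poly f a" by simp
  have "coeff ?g 1 = poly (pderiv ?g) 0"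
    by (simp add: poly_0_coeff_0 coeff_pderiv)
  also have "\<dots> = poly (pderiv f) a"
    by (simp add: pderiv_pcompose pderiv_pCons poly_pcompose)
  finally have c1: "coeff ?g 1 = poly (pderiv f) a" .
  have "?g \<noteq> 0" using c1 f'a by auto
  have "\<not> (\<forall>r. poly ?g r = 0 \<longrightarrow> r \<preceq> 1)"
  proof
    assume "\<forall>r. poly ?g r = 0 \<longrightarrow> r \<preceq> 1"
    then have "poly f a \<preceq> poly (pderiv f) a"
      using coeff_le_of_roots[OF \<open>?g \<noteq> 0\<close>, of 1] c0 c1 by auto
    then show False using fa f'a le_trans by blast
  qed
  then obtain r where "poly ?g r = 0" "1 \<prec> r" by blast
  then show ?thesis by (intro exI[of _ "a + r"]) (simp add: poly_pcompose)
qed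

text \<open>With two roots, \<open>f = (X - b) g\<close> and \<open>g(c) = 0\<close>, so both terms
  of \<open>f'(a) = (a - b) g'(a) + g(a)\<close> lie in the maximal ideal.\<close>

lemma hensel_root_unique:
  assumes f: "poly_over V f" and a: "a \<in> V" and f'a: "poly (pderiv f) a \<preceq> 1"
    and b: "poly f b = 0" "1 \<prec> b - a" and c: "poly f c = 0" "1 \<prec> c - a"
  shows "b = c"
proof (rule ccontr)
  assume "b \<noteq> c"
  have bV: "b \<in> V" and cV: "c \<in> V"
    using b(2) c(2) a V_rules(4)[of "b - a" a] V_rules(4)[of "c - a" a] by (auto simp: mem_iff lt_imp_le)
  let ?g = "synthetic_div f b"
  have g: "f = [:-b, 1:] * ?g" using synthetic_div_correct'[of b f] b(1) by simp
  have gV: "poly_over V ?g" using poly_over_synthetic_div[OF subring f bV] .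
  have "poly f c = (c - b) * poly ?g c"
    using arg_cong[OF g, of "\<lambda>p. poly p c"] by (simp add: algebra_simps)
  then have gc: "poly ?g c = 0" using c(1) \<open>b \<noteq> c\<close> by simp
  have "pderiv f = [:-b, 1:] * pderiv ?g + ?g * pderiv [:-b, 1:]" by (subst g) (rule pderiv_mult)
  then have "poly (pderiv f) a = poly ([:-b, 1:] * pderiv ?g + ?g * pderiv [:-b, 1:]) a"
    by (simp only:)
  then have "poly (pderiv f) a = (a - b) * poly (pderiv ?g) a + poly ?g a"
    by (simp add: pderiv_pCons algebra_simps)
  moreover have "1 \<prec> (a - b) * poly (pderiv ?g) a"
  proof -
    have "poly (pderiv ?g) a \<in> V"
      using poly_in_subring[OF subring poly_over_pderiv[OF subring gV] a] .
    then have "a - b \<preceq> (a - b) * poly (pderiv ?g) a" by (metis mem_le mult.commute)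
    moreover have "1 \<prec> a - b" using b(2) minus_le_commute by blast
    ultimately show ?thesis using lt_le_trans by blast
  qed
  moreover have "1 \<prec> poly ?g a"
  proof -
    have "a - c \<preceq> poly ?g a - poly ?g c" using poly_diff_le[OF gV cV a] .
    moreover have "1 \<prec> a - c" using c(2) minus_le_commute by blast
    ultimately show ?thesis unfolding gc diff_zero using lt_le_trans by blast
  qed
  ultimately have "1 \<prec> poly (pderiv f) a" using lt_add by simp
  then show False using f'a by blast
qed

end

subsection \<open>Henselian subfields\<close>

definition hensel :: "'a::field set \<Rightarrow> 'a set \<Rightarrow> bool" where
  "hensel V F \<longleftrightarrow> (\<forall>f a. poly_over (F \<inter> V) f \<and> a \<in> F \<inter> V \<and> \<not> wle V (poly f a) 1 \<and>
     wle V (poly (pderiv f) a) 1 \<longrightarrow> (\<exists>b\<in>F \<inter> V. poly f b = 0 \<and> \<not> wle V (b - a) 1))"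

definition hensel_hull :: "'a::field set \<Rightarrow> 'a set \<Rightarrow> 'a set" where
  "hensel_hull V L = \<Inter>{F. is_subfield F \<and> L \<subseteq> F \<and> hensel V F}"

text \<open>Two instances matter: the whole type, and the algebraic closure of \<open>K\<close>, on
  which alone an automorphism may be known to preserve \<open>V\<close>.\<close>

definition root_closed :: "'a::field set \<Rightarrow> bool" where
  "root_closed A \<longleftrightarrow> is_subfield A \<and> (\<forall>p b. poly_over A p \<and> p \<noteq> 0 \<and> poly p b = 0 \<longrightarrow> b \<in> A)"

lemma root_closed_UNIV: "root_closed UNIV"
  by (simp add: root_closed_def)

lemma root_closed_alg_closure: "is_subfield F \<Longrightarrow> root_closed (alg_closure F)"
  using alg_closure_subfield alg_closure_root unfolding root_closed_def by blast

context valued_closed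
begin

text \<open>An automorphism sends the Hensel root \<open>b\<close> to another root of
  \<open>f\<close> close to \<open>a\<close>, which is \<open>b\<close> by uniqueness. Only the
  value of \<open>b - a \<in> A\<close> is compared, so invariance on \<open>A\<close>
  suffices.\<close>

lemma hensel_fixed_field:
  assumes A: "root_closed A" and T: "\<And>\<tau>. \<tau> \<in> T \<Longrightarrow> aut_over F \<tau>"
    and pres: "\<And>\<tau> a. \<tau> \<in> T \<Longrightarrow> a \<in> A \<Longrightarrow> a \<in> V \<longleftrightarrow> \<tau> a \<in> V"
  shows "is_subfield {a \<in> A. \<forall>\<tau>\<in>T. \<tau> a = a}" "hensel V {a \<in> A. \<forall>\<tau>\<in>T. \<tau> a = a}"
proof -
  let ?E = "{a \<in> A. \<forall>\<tau>\<in>T. \<tau> a = a}"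
  have AF: "is_subfield A" using A unfolding root_closed_def by blast
  show "is_subfield ?E"
  proof -
    have "is_subfield {a. \<tau> a = a}" if "\<tau> \<in> T" for \<tau>
      using aut_overD[OF T[OF that]] by (simp add: is_subfield_def)
    then have "is_subfield (\<Inter>(insert A ((\<lambda>\<tau>. {a. \<tau> a = a}) ` T)))"
      using AF by (intro is_subfield_Inter) auto
    moreover have "?E = \<Inter>(insert A ((\<lambda>\<tau>. {a. \<tau> a = a}) ` T))" by auto
    ultimately show ?thesis by simp
  qed
  show "hensel V ?E"
    unfolding hensel_def
  proof (intro allI impI; elim conjE)
    fix f a assume f: "poly_over (?E \<inter> V) f" and a: "a \<in> ?E \<inter> V" and fa: "1 \<prec> poly f a"
      and f'a: "poly (pderiv f) a \<preceq> 1"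
    have fV: "poly_over V f" and fA: "poly_over A f" using f by (auto simp: poly_over_def)
    have aV: "a \<in> V" using a by blast
    obtain b where b: "poly f b = 0" "1 \<prec> b - a"
      using hensel_root_exists[OF fV aV fa f'a] by blast
    have "f \<noteq> 0" using f'a by auto
    then have bA: "b \<in> A" using A fA b(1) unfolding root_closed_def by blast
    have bV: "b \<in> V" using b(2) aV V_rules(4)[of "b - a" a] by (auto simp: mem_iff lt_imp_le)
    have "\<tau> b = b" if t: "\<tau> \<in> T" for \<tau>
    proof -
      note tau = aut_overD[OF T[OF t]]
      have "\<tau> (coeff f i) = coeff f i" for i using poly_overD[OF f] t by auto
      then have "\<tau> (poly f b) = poly f (\<tau> b)"
        by (simp add: poly_altdef aut_over_sum[OF T[OF t]] tau)
      then have "poly f (\<tau> b) = 0" using b tau by simp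
      moreover have "1 \<prec> \<tau> b - a"
      proof -
        have "b - a \<in> A" using bA a is_subfieldD[OF AF] by auto
        then have "inverse (b - a) \<in> V \<longleftrightarrow> \<tau> (inverse (b - a)) \<in> V"
          using pres[OF t] is_subfieldD(6)[OF AF] by blast
        moreover have "\<tau> (b - a) = \<tau> b - a" using a t tau by simp
        ultimately show ?thesis using b(2) tau unfolding le_one_iff by (metis)
      qed
      ultimately show ?thesis using hensel_root_unique[OF fV aV f'a] b by blast
    qed
    then show "\<exists>b\<in>?E \<inter> V. poly f b = 0 \<and> 1 \<prec> b - a" using b bA bV by blast
  qed
qed

lemma hensel_root_closed: "root_closed A \<Longrightarrow> hensel V A"
  using hensel_fixed_field(2)[of A "{}"] by simp

text \<open>The derivative at the Hensel root is congruent to the unit \<open>f'(a)\<close>, so the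
  root is simple.\<close>

lemma hensel_simple_root_closed:
  assumes "simple_root_closed F" shows "hensel V F"
  unfolding hensel_def
proof (intro allI impI; elim conjE)
  fix f a assume f: "poly_over (F \<inter> V) f" and a: "a \<in> F \<inter> V" and fa: "1 \<prec> poly f a"
    and f'a: "poly (pderiv f) a \<preceq> 1"
  have fV: "poly_over V f" and fF: "poly_over F f" using f by (auto simp: poly_over_def)
  have aV: "a \<in> V" using a by blast
  obtain b where b: "poly f b = 0" "1 \<prec> b - a"
    using hensel_root_exists[OF fV aV fa f'a] by blast
  have bV: "b \<in> V" using b(2) aV V_rules(4)[of "b - a" a] by (auto simp: mem_iff lt_imp_le)
  have "b - a \<preceq> poly (pderiv f) b - poly (pderiv f) a"
    using poly_diff_le[OF poly_over_pderiv[OF subring fV] aV bV] .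
  then have "poly (pderiv f) b \<noteq> 0"
    using b(2) f'a le_trans lt_le_trans by (metis diff_0 le_uminus)
  then have "b \<in> F" using assms fF b(1) unfolding simple_root_closed_def by blast
  then show "\<exists>b\<in>F \<inter> V. poly f b = 0 \<and> 1 \<prec> b - a" using b bV by blast
qed

text \<open>By uniqueness the Hensel roots found in the different fields coincide. Hence the hull is
  itself henselian.\<close>

lemma hensel_Inter:
  assumes ne: "\<F> \<noteq> {}" and h: "\<And>F. F \<in> \<F> \<Longrightarrow> hensel V F"
  shows "hensel V (\<Inter>\<F>)"
  unfolding hensel_def
proof (intro allI impI; elim conjE)
  fix f a assume f: "poly_over (\<Inter>\<F> \<inter> V) f" and a: "a \<in> \<Inter>\<F> \<inter> V" and fa: "1 \<prec> poly f a"
    and f'a: "poly (pderiv f) a \<preceq> 1"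
  have fV: "poly_over V f" using f by (auto simp: poly_over_def)
  have aV: "a \<in> V" using a by blast
  have ex: "\<exists>b\<in>F \<inter> V. poly f b = 0 \<and> 1 \<prec> b - a" if F: "F \<in> \<F>" for F
  proof -
    have "poly_over (F \<inter> V) f" "a \<in> F \<inter> V" using f a F by (auto simp: poly_over_def)
    then show ?thesis using h[OF F] fa f'a unfolding hensel_def by blast
  qed
  obtain F0 where "F0 \<in> \<F>" using ne by blast
  then obtain b where b: "b \<in> V" "poly f b = 0" "1 \<prec> b - a" using ex by blast
  have "b \<in> F" if "F \<in> \<F>" for F
    using ex[OF that] hensel_root_unique[OF fV aV f'a b(2,3)] by blast
  then show "\<exists>b\<in>\<Inter>\<F> \<inter> V. poly f b = 0 \<and> 1 \<prec> b - a" using b by blast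
qed

lemma hensel_hull:
  shows "is_subfield (hensel_hull V L)" "L \<subseteq> hensel_hull V L" "hensel V (hensel_hull V L)"
  unfolding hensel_hull_def
  using hensel_root_closed[OF root_closed_UNIV]
  by (auto intro!: is_subfield_Inter hensel_Inter)

lemma hensel_hull_least:
  "is_subfield F \<Longrightarrow> L \<subseteq> F \<Longrightarrow> hensel V F \<Longrightarrow> hensel_hull V L \<subseteq> F"
  unfolding hensel_hull_def by blast

lemma hensel_hull_root_closed: "root_closed A \<Longrightarrow> L \<subseteq> A \<Longrightarrow> hensel_hull V L \<subseteq> A"
  using hensel_hull_least hensel_root_closed root_closed_def by blast

lemma hensel_hull_mono: "L \<subseteq> hensel_hull V L' \<Longrightarrow> hensel_hull V L \<subseteq> hensel_hull V L'"
  using hensel_hull hensel_hull_least by blast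

lemma hensel_hull_fixed:
  assumes A: "root_closed A" and t: "aut_over L \<tau>" and L: "L \<subseteq> A"
    and pres: "\<And>a. a \<in> A \<Longrightarrow> a \<in> V \<longleftrightarrow> \<tau> a \<in> V" and c: "c \<in> hensel_hull V L"
  shows "\<tau> c = c"
proof -
  have "is_subfield {a \<in> A. \<forall>\<tau>\<in>{\<tau>}. \<tau> a = a}" "hensel V {a \<in> A. \<forall>\<tau>\<in>{\<tau>}. \<tau> a = a}"
    using hensel_fixed_field[OF A, of "{\<tau>}" L] t pres by auto
  moreover have "L \<subseteq> {a \<in> A. \<forall>\<tau>\<in>{\<tau>}. \<tau> a = a}" using L aut_overD(5)[OF t] by auto
  ultimately show ?thesis using hensel_hull_least c by blast
qed

end

text \<open>Henselianity of \<open>F\<close> depends on \<open>F \<inter> V\<close> only, which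
  permits a change between rings that agree on the algebraic elements.\<close>

lemma hensel_cong:
  assumes F: "is_subfield F" and VW: "F \<inter> V = F \<inter> W"
    and V: "valuation_subring V" and W: "valuation_subring W"
  shows "hensel V F \<longleftrightarrow> hensel W F"
proof -
  have *: "wle V a 1 \<longleftrightarrow> wle W a 1" if "a \<in> F" for a
    using that VW is_subfieldD(6)[OF F that]
    unfolding valuation_subring.le_one_iff[OF V] valuation_subring.le_one_iff[OF W] by blast
  have FR: "is_subring F" using subfield_imp_subring[OF F] .
  have "wle V (poly f a) 1 \<longleftrightarrow> wle W (poly f a) 1" "wle V (poly (pderiv f) a) 1 \<longleftrightarrow> wle W (poly (pderiv f) a) 1"
    if "poly_over (F \<inter> W) f" "a \<in> F" for f a
    using that poly_over_mono[of "F \<inter> W" f F] by (auto intro!: * poly_in_subring[OF FR] poly_over_pderiv[OF FR])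
  moreover have "wle V (b - a) 1 \<longleftrightarrow> wle W (b - a) 1" if "b \<in> F" "a \<in> F" for a b
    using that is_subfieldD(3)[OF F] * by blast
  ultimately show ?thesis unfolding hensel_def VW by (metis IntD1)
qed

subsection \<open>Existence of valuation rings\<close>

definition is_ideal_of :: "'a::field set \<Rightarrow> 'a set \<Rightarrow> bool" where
  "is_ideal_of I A \<longleftrightarrow> 0 \<in> I \<and> I \<subseteq> A \<and> (\<forall>a\<in>I. \<forall>b\<in>I. a + b \<in> I) \<and> (\<forall>a\<in>A. \<forall>b\<in>I. a * b \<in> I)"

lemma is_ideal_ofD:
  assumes "is_ideal_of I A"
  shows "0 \<in> I" "I \<subseteq> A" "\<And>a b. a \<in> I \<Longrightarrow> b \<in> I \<Longrightarrow> a + b \<in> I" "\<And>a b. a \<in> A \<Longrightarrow> b \<in> I \<Longrightarrow> a * b \<in> I"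
  using assms unfolding is_ideal_of_def by blast+

lemma ideal_sum: "is_ideal_of I A \<Longrightarrow> (\<And>i. i \<in> X \<Longrightarrow> f i \<in> I) \<Longrightarrow> sum f X \<in> I"
  by (induction X rule: infinite_finite_induct) (auto intro: is_ideal_ofD)

lemma ideal_adjoin:
  assumes A: "is_subring A" and I: "is_ideal_of I A"
  shows "is_ideal_of (poly_values I a) (poly_values A a)" "I \<subseteq> poly_values I a"
proof -
  note ID = is_ideal_ofD[OF I]
  have J: "poly_over I g \<Longrightarrow> poly g a \<in> poly_values I a" for g unfolding poly_values_def by blast
  show "is_ideal_of (poly_values I a) (poly_values A a)"
    unfolding is_ideal_of_def
  proof (intro conjI ballI)
    show "0 \<in> poly_values I a" using J[of 0] ID(1) by (simp add: poly_over_def)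
    show "poly_values I a \<subseteq> poly_values A a"
      unfolding poly_values_def using poly_over_mono[OF _ ID(2)] by blast
    fix y assume "y \<in> poly_values I a"
    then obtain h where h: "poly_over I h" "y = poly h a" unfolding poly_values_def by blast
    show "x + y \<in> poly_values I a" if "x \<in> poly_values I a" for x
    proof -
      from that obtain g where g: "poly_over I g" "x = poly g a" unfolding poly_values_def by blast
      then show ?thesis using J[of "g + h"] h ID(3) by (simp add: poly_over_def)
    qed
    show "x * y \<in> poly_values I a" if "x \<in> poly_values A a" for x
    proof -
      from that obtain g where g: "poly_over A g" "x = poly g a" unfolding poly_values_def by blast
      have "poly_over I (g * h)"
        using g h ID(4) by (auto simp: poly_over_def coeff_mult intro!: ideal_sum[OF I])
      then show ?thesis using J g h by force
    qed
  qed
  show "I \<subseteq> poly_values I a"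
  proof
    fix r assume "r \<in> I"
    then have "poly_over I [:r:]" using ID(1) by (auto simp: poly_over_def coeff_pCons split: nat.splits)
    then show "r \<in> poly_values I a" using J by force
  qed
qed

text \<open>
  In a local ring with maximal ideal \<open>I\<close>, relations \<open>1 = g(a)\<close> and \<open>1 = h(1/a)\<close> over \<open>I\<close> of minimal
  degrees \<open>n \<ge> m\<close> contradict each other: the second one expresses \<open>a\<^sup>n\<close> by lower powers.
\<close>

lemma no_inverse_relations:
  assumes A: "is_subring A" and I: "is_ideal_of I A"
    and unit: "\<And>u. u \<in> I \<Longrightarrow> inverse (1 - u) \<in> A" and one: "1 \<notin> I"
    and a: "a \<noteq> 0" and g: "poly_over I g" "poly g a = 1" and h: "poly_over I h" "poly h (inverse a) = 1"
    and deg: "degree h \<le> degree g"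
    and min: "\<And>g'. poly_over I g' \<Longrightarrow> poly g' a = 1 \<Longrightarrow> degree g \<le> degree g'"
  shows False
proof -
  note ID = is_ideal_ofD[OF I]
  let ?n = "degree g" and ?m = "degree h"
  have hs: "(\<Sum>i\<le>?m. coeff h i * inverse a ^ i) = 1" using h(2) by (simp add: poly_altdef)
  have m0: "?m > 0"
  proof (rule ccontr)
    assume "\<not> ?thesis"
    then have "coeff h 0 = 1" using hs by simp
    then show False using poly_overD[OF h(1), of 0] one by simp
  qed
  define w where "w = inverse (1 - coeff h 0)"
  have w: "w \<in> A" unfolding w_def using unit poly_overD[OF h(1)] by blast
  have w1: "1 - coeff h 0 \<noteq> 0" using poly_overD[OF h(1), of 0] one by auto
  have "1 - coeff h 0 = (\<Sum>i\<in>{1..?m}. coeff h i * inverse a ^ i)"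
  proof -
    have "(\<Sum>i\<le>?m. coeff h i * inverse a ^ i) = coeff h 0 + (\<Sum>i\<in>{1..?m}. coeff h i * inverse a ^ i)"
      by (subst sum.remove[of _ 0]) (auto intro!: sum.cong)
    then show ?thesis using hs by (simp add: algebra_simps)
  qed
  then have "1 = w * (\<Sum>i\<in>{1..?m}. coeff h i * inverse a ^ i)"
    unfolding w_def using w1 by (metis left_inverse)
  then have "a ^ ?n = (\<Sum>i\<in>{1..?m}. w * coeff h i * (inverse a ^ i * a ^ ?n))"
    by (metis (no_types, lifting) mult.assoc mult_1 sum.cong sum_distrib_left sum_distrib_right)
  also have "\<dots> = (\<Sum>i\<in>{1..?m}. w * coeff h i * a ^ (?n - i))"
    using a deg by (intro sum.cong) (auto simp: power_diff power_inverse field_simps)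
  finally have an: "a ^ ?n = (\<Sum>i\<in>{1..?m}. w * coeff h i * a ^ (?n - i))" .
  define q where "q = (\<Sum>i\<in>{1..?m}. monom (w * coeff h i) (?n - i))"
  have q: "poly q a = a ^ ?n" unfolding q_def an by (simp add: poly_sum poly_monom)
  have qI: "poly_over I q"
    unfolding q_def poly_over_def coeff_sum
    using ID(1) ID(4)[OF w poly_overD[OF h(1)]] by (auto intro!: ideal_sum[OF I])
  \<comment> \<open>The leading power of \<open>a\<close> is replaced by means of \<open>q\<close>,
    whose degree is below \<open>?n\<close>; the relation survives with smaller degree.\<close>
  define g' where "g' = g - monom (lead_coeff g) ?n + smult (lead_coeff g) q"
  have "poly g' a = 1" unfolding g'_def by (simp add: g(2) q poly_monom)
  moreover have "coeff g' i \<in> I" for i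
  proof -
    have "coeff g' i = (if i = ?n then 0 else coeff g i) + lead_coeff g * coeff q i"
      unfolding g'_def by simp
    moreover have "(if i = ?n then 0 else coeff g i) \<in> I" using ID(1) poly_overD[OF g(1)] by simp
    moreover have "lead_coeff g * coeff q i \<in> I"
      using ID(2) poly_overD[OF g(1)] poly_overD[OF qI] by (intro ID(4)) blast+
    ultimately show ?thesis using ID(3) by simp
  qed
  ultimately have "?n \<le> degree g'" using min by (simp add: poly_over_def)
  moreover have "coeff g' i = 0" if "i \<ge> ?n" for i
  proof -
    have "coeff q i = 0"
      unfolding q_def coeff_sum using that m0 deg by (intro sum.neutral) auto
    then show ?thesis unfolding g'_def using that by (auto simp: coeff_eq_0)
  qed
  then have "g' = 0 \<or> degree g' < ?n"
    by (metis leading_coeff_0_iff not_le)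
  moreover have "g' \<noteq> 0" using \<open>poly g' a = 1\<close> by auto
  ultimately show False by simp
qed

text \<open>Chevalley's extension theorem, from a maximal pair of a ring \<open>B\<close> and a
  proper ideal \<open>J\<close>: if neither \<open>a\<close> nor its inverse were in
  \<open>B\<close>, maximality would give each of them a relation over \<open>J\<close>, and the two
  are incompatible.\<close>

theorem valuation_subring_exists:
  fixes A :: "'a::field set"
  assumes A: "is_subring A" and I: "is_ideal_of I A" "1 \<notin> I"
  shows "\<exists>V. valuation_subring V \<and> A \<subseteq> V \<and> (\<forall>a\<in>I. \<not> wle V a 1)"
proof -
  \<comment> \<open>A ring and an ideal are coded as one set, tagged \<open>0\<close> and
    \<open>1\<close>, so that inclusion of pairs becomes inclusion of sets.\<close>
  let ?P = "{(B \<times> {0::nat}) \<union> (J \<times> {1}) | B J. is_subring B \<and> A \<subseteq> B \<and> is_ideal_of J B \<and> I \<subseteq> J \<and> 1 \<notin> J}"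
  have P: "\<exists>M\<in>?P. \<forall>X\<in>?P. M \<subseteq> X \<longrightarrow> X = M"
  proof (rule subset_Zorn_nonempty)
    show "?P \<noteq> {}" using A I by blast
    fix \<C> assume C: "\<C> \<noteq> {}" "subset.chain ?P \<C>"
    have ch: "X \<subseteq> Y \<or> Y \<subseteq> X" if "X \<in> \<C>" "Y \<in> \<C>" for X Y
      using C(2) that by (auto simp: subset_chain_def)
    define B where "B = {a. (a, 0) \<in> \<Union>\<C>}"
    define J where "J = {a. (a, 1) \<in> \<Union>\<C>}"
    have D: "\<exists>B J. X = (B \<times> {0::nat}) \<union> (J \<times> {1}) \<and> is_subring B \<and> A \<subseteq> B \<and> is_ideal_of J B \<and> I \<subseteq> J \<and> 1 \<notin> J"
      if "X \<in> \<C>" for X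
      using C(2) that unfolding subset_chain_def by blast
    have sec: "is_subring {a. (a, 0) \<in> X} \<and> A \<subseteq> {a. (a, 0) \<in> X} \<and> is_ideal_of {a. (a, 1) \<in> X} {a. (a, 0) \<in> X} \<and>
        I \<subseteq> {a. (a, 1) \<in> X} \<and> 1 \<notin> {a. (a, 1) \<in> X} \<and> X \<subseteq> UNIV \<times> {0, 1}" if X: "X \<in> \<C>" for X
    proof -
      obtain B J where *: "X = (B \<times> {0::nat}) \<union> (J \<times> {1})" "is_subring B \<and> A \<subseteq> B \<and> is_ideal_of J B \<and> I \<subseteq> J \<and> 1 \<notin> J"
        using D[OF X] by blast
      have "{a. (a, 0) \<in> X} = B" "{a. (a, 1) \<in> X} = J" using *(1) by auto
      then show ?thesis using * by auto
    qed
    have two: "\<exists>X\<in>\<C>. p \<in> X \<and> q \<in> X" if "p \<in> \<Union>\<C>" "q \<in> \<Union>\<C>" for p q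
      using that ch by blast
    have "is_subring B"
      unfolding is_subring_def
    proof (intro conjI ballI)
      show "1 \<in> B" using C(1) sec is_subringD(1) unfolding B_def by fast
      fix a b assume "a \<in> B" "b \<in> B"
      then have "(a, 0) \<in> \<Union>\<C>" "(b, 0) \<in> \<Union>\<C>" unfolding B_def by simp_all
      from two[OF this] obtain X where X: "X \<in> \<C>" "(a, 0) \<in> X" "(b, 0) \<in> X" by blast
      then show "a - b \<in> B" "a * b \<in> B"
        using sec[OF X(1)] is_subringD(3,5)[of "{a. (a, 0) \<in> X}" a b] unfolding B_def by blast+
    qed
    moreover have "is_ideal_of J B"
      unfolding is_ideal_of_def
    proof (intro conjI ballI)
      show "0 \<in> J" using C(1) sec is_ideal_ofD(1) unfolding J_def by fast
      show "J \<subseteq> B" using sec is_ideal_ofD(2) unfolding J_def B_def by fast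
      fix b assume b: "b \<in> J"
      show "a + b \<in> J" if "a \<in> J" for a
      proof -
        have "(a, 1) \<in> \<Union>\<C>" "(b, 1) \<in> \<Union>\<C>" using b that unfolding J_def by simp_all
        from two[OF this] obtain X where X: "X \<in> \<C>" "(a, 1) \<in> X" "(b, 1) \<in> X" by blast
        then show ?thesis
          using sec[OF X(1)] is_ideal_ofD(3)[of "{a. (a, 1) \<in> X}" "{a. (a, 0) \<in> X}" a b] unfolding J_def by blast
      qed
      show "a * b \<in> J" if "a \<in> B" for a
      proof -
        have "(a, 0) \<in> \<Union>\<C>" "(b, 1) \<in> \<Union>\<C>" using b that unfolding J_def B_def by simp_all
        from two[OF this] obtain X where X: "X \<in> \<C>" "(a, 0) \<in> X" "(b, 1) \<in> X" by blast
        then show ?thesis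
          using sec[OF X(1)] is_ideal_ofD(4)[of "{a. (a, 1) \<in> X}" "{a. (a, 0) \<in> X}" a b] unfolding J_def by blast
      qed
    qed
    moreover have "A \<subseteq> B" "I \<subseteq> J" "1 \<notin> J" using C(1) sec unfolding B_def J_def by fast+
    moreover have "\<Union>\<C> = (B \<times> {0}) \<union> (J \<times> {1})"
      using sec unfolding B_def J_def by fastforce
    ultimately show "\<Union>\<C> \<in> ?P" by blast
  qed
  then obtain B J where B: "is_subring B" "A \<subseteq> B" and J: "is_ideal_of J B" "I \<subseteq> J" "1 \<notin> J"
    and max': "\<forall>X\<in>?P. (B \<times> {0}) \<union> (J \<times> {1}) \<subseteq> X \<longrightarrow> X = (B \<times> {0}) \<union> (J \<times> {1})" by blast
  have max: "B' = B \<and> J' = J"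
    if "is_subring B'" "B \<subseteq> B'" "is_ideal_of J' B'" "J \<subseteq> J'" "1 \<notin> J'" for B' J'
  proof -
    have "(B' \<times> {0}) \<union> (J' \<times> {1}) \<in> ?P"
      using that B J by (intro CollectI exI[of _ B'] exI[of _ J'] conjI refl) auto
    moreover have "(B \<times> {0}) \<union> (J \<times> {1}) \<subseteq> (B' \<times> {0::nat}) \<union> (J' \<times> {1})" using that by blast
    ultimately have eq: "(B' \<times> {0}) \<union> (J' \<times> {1}) = (B \<times> {0::nat}) \<union> (J \<times> {1})"
      using bspec[OF max'] by simp
    have "a \<in> B' \<longleftrightarrow> a \<in> B" "a \<in> J' \<longleftrightarrow> a \<in> J" for a
      using arg_cong[OF eq, of "\<lambda>S. (a, 0) \<in> S"] arg_cong[OF eq, of "\<lambda>S. (a, 1) \<in> S"] by simp_all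
    then show ?thesis by blast
  qed
  note BD = is_subringD[OF B(1)] and JD = is_ideal_ofD[OF J(1)]
  have adj: "a \<in> B" if "\<And>g. poly_over J g \<Longrightarrow> poly g a \<noteq> 1" for a
  proof -
    have "poly_values B a = B \<and> poly_values J a = J"
    proof (rule max)
      show "1 \<notin> poly_values J a" unfolding poly_values_def using that by force
    qed (intro poly_values[OF B(1)] ideal_adjoin[OF B(1) J(1)])+
    then show ?thesis using poly_values(3)[OF B(1), of a] by blast
  qed
  \<comment> \<open>Otherwise maximality gives a relation over \<open>J\<close> for the inverse;
    clearing denominators puts a power of \<open>1 - u\<close> into \<open>J\<close>, although it is
    congruent to \<open>1\<close> modulo \<open>J\<close>.\<close>
  have unit: "inverse (1 - u) \<in> B" if u: "u \<in> J" for u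
  proof (rule ccontr)
    assume "inverse (1 - u) \<notin> B"
    have "1 - u \<noteq> 0" using u J(3) by auto
    let ?a = "inverse (1 - u)"
    obtain g where g: "poly_over J g" "poly g ?a = 1" using adj \<open>?a \<notin> B\<close> by blast
    let ?n = "degree g"
    have eq: "(1 - u) ^ ?n = (\<Sum>i\<le>?n. coeff g i * (1 - u) ^ (?n - i))"
    proof -
      have "(1 - u) ^ ?n = poly g ?a * (1 - u) ^ ?n" using g by simp
      also have "\<dots> = (\<Sum>i\<le>?n. coeff g i * (?a ^ i * (1 - u) ^ ?n))"
        by (simp add: poly_altdef sum_distrib_right mult.assoc)
      also have "\<dots> = (\<Sum>i\<le>?n. coeff g i * (1 - u) ^ (?n - i))"
        using \<open>1 - u \<noteq> 0\<close> by (intro sum.cong) (auto simp: power_diff power_inverse field_simps)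
      finally show ?thesis .
    qed
    have uB: "1 - u \<in> B" using u JD(2) BD(1,3) by blast
    have "(1 - u) ^ ?n \<in> J"
      unfolding eq using poly_overD[OF g(1)] JD(4) BD(7)[OF uB]
      by (intro ideal_sum[OF J(1)]) (metis mult.commute)
    moreover have "1 - (1 - u) ^ k \<in> J" for k
    proof (induction k)
      case (Suc k)
      have "1 - (1 - u) ^ Suc k = (1 - (1 - u) ^ k) + (1 - u) ^ k * u" by (simp add: algebra_simps)
      then show ?case using Suc JD(3) JD(4)[OF BD(7)[OF uB] u] by metis
    qed (simp add: JD)
    ultimately have "(1 - u) ^ ?n + (1 - (1 - u) ^ ?n) \<in> J" using JD(3) by blast
    then show False using J(3) by simp
  qed
  have tot: "a \<in> B \<or> inverse a \<in> B" for a
  proof (rule ccontr)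
    assume *: "\<not> ?thesis"
    then have a0: "a \<noteq> 0" using BD(2) by auto
    let ?Q = "\<lambda>a n. \<exists>g. poly_over J g \<and> poly g a = 1 \<and> degree g = n"
    have "\<exists>n. ?Q a n" "\<exists>n. ?Q (inverse a) n" using * adj by blast+
    then obtain g h where g: "poly_over J g" "poly g a = 1" "degree g = (LEAST n. ?Q a n)"
      and h: "poly_over J h" "poly h (inverse a) = 1" "degree h = (LEAST n. ?Q (inverse a) n)"
      using LeastI_ex[of "?Q a"] LeastI_ex[of "?Q (inverse a)"] by blast
    have mg: "degree g \<le> degree g'" if "poly_over J g'" "poly g' a = 1" for g'
      unfolding g(3) using that by (intro Least_le) blast
    have mh: "degree h \<le> degree g'" if "poly_over J g'" "poly g' (inverse a) = 1" for g'
      unfolding h(3) using that by (intro Least_le) blast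
    show False
    proof (cases "degree h \<le> degree g")
      case True
      then show False using no_inverse_relations[OF B(1) J(1) unit J(3) a0 g(1,2) h(1,2) _ mg] by blast
    next
      case False
      then show False
        using no_inverse_relations[OF B(1) J(1) unit J(3), of "inverse a" h g] a0 g(1,2) h(1,2) mh by simp
    qed
  qed
  have "valuation_subring B" using B(1) tot by unfold_locales
  moreover have "\<not> wle B a 1" if "a \<in> I" for a
  proof
    assume "wle B a 1"
    then obtain c where "c \<in> B" "1 = c * a" unfolding wle_def by blast
    then show False using JD(4)[of c a] that J by auto
  qed
  ultimately show ?thesis using B(2) by blast
qed

subsection \<open>Values of algebraic elements\<close>

context valuation_subring
begin

text \<open>A term of strictly least value would determine the value of the sum.\<close>

lemma sum_zero_imp_equal_values:
  assumes "finite A" "A \<noteq> {}" "\<And>i. i \<in> A \<Longrightarrow> f i \<noteq> 0" "sum f A = 0"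
  shows "\<exists>i\<in>A. \<exists>j\<in>A. i \<noteq> j \<and> f i \<preceq> f j \<and> f j \<preceq> f i"
proof (rule ccontr)
  assume no: "\<not> ?thesis"
  have "\<exists>i\<in>A. \<forall>j\<in>A. f i \<preceq> f j"
    using assms(1,2)
  proof (induction A rule: finite_ne_induct)
    case (insert x X)
    then obtain i where "i \<in> X" "\<forall>j\<in>X. f i \<preceq> f j" by blast
    then show ?case using le_total[of "f i" "f x"] le_trans le_refl by (metis insert_iff)
  qed auto
  then obtain i where i: "i \<in> A" "\<forall>j\<in>A. f i \<preceq> f j" by blast
  have "f i \<prec> (\<Sum>j\<in>A - {i}. f j)"
    using i no assms(3) by (intro lt_sum) auto
  then have "f i + (\<Sum>j\<in>A - {i}. f j) \<noteq> 0"
    using dominant_add(2)[where a = "f i" and b = "sum f (A - {i})"] assms(3)[OF i(1)] by auto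
  then show False using assms(1,4) i(1) by (simp add: sum.remove[of A i f])
qed

text \<open>In \<open>p(y) = 0\<close> two monomials have equal value; \<open>n\<close> is the
  difference of their exponents and \<open>c\<close> the quotient of their coefficients.\<close>

lemma algebraic_value_torsion:
  assumes F: "is_subfield F" and y: "algebraic_over F y" "y \<noteq> 0"
  shows "\<exists>n>0. \<exists>c\<in>F - {0}. y ^ n \<preceq> c \<and> c \<preceq> y ^ n"
proof -
  obtain p where p: "p \<noteq> 0" "poly_over F p" "poly p y = 0"
    using y unfolding algebraic_over_def by blast
  let ?A = "{i. i \<le> degree p \<and> coeff p i \<noteq> 0}"
  have "(\<Sum>i\<in>?A. coeff p i * y ^ i) = poly p y"
    unfolding poly_altdef by (intro sum.mono_neutral_left) auto
  moreover have "?A \<noteq> {}" using p(1) by (auto intro: exI[of _ "degree p"])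
  ultimately obtain i j where ij: "i \<in> ?A" "j \<in> ?A" "i \<noteq> j"
    "coeff p i * y ^ i \<preceq> coeff p j * y ^ j" "coeff p j * y ^ j \<preceq> coeff p i * y ^ i"
    using sum_zero_imp_equal_values[of ?A "\<lambda>i. coeff p i * y ^ i"] p(3) y(2) by auto
  have main: ?thesis if ij: "i \<in> ?A" "j \<in> ?A" "i < j"
    "coeff p i * y ^ i \<preceq> coeff p j * y ^ j" "coeff p j * y ^ j \<preceq> coeff p i * y ^ i" for i j
  proof (intro exI[of _ "j - i"] conjI bexI[of _ "coeff p i / coeff p j"])
    have *: "coeff p i * y ^ i = (coeff p j * y ^ i) * (coeff p i / coeff p j)"
      "coeff p j * y ^ j = (coeff p j * y ^ i) * y ^ (j - i)"
      using ij y(2) by (auto simp: power_add[symmetric])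
    have nz: "coeff p j * y ^ i \<noteq> 0" using ij y(2) by simp
    show "y ^ (j - i) \<preceq> coeff p i / coeff p j" "coeff p i / coeff p j \<preceq> y ^ (j - i)"
      using ij(4,5) unfolding * le_mult_cancel[OF nz] by blast+
    show "coeff p i / coeff p j \<in> F - {0}"
      using ij is_subfieldD(8)[OF F] poly_overD[OF p(2)] by auto
  qed (use ij in simp)
  show ?thesis using main[of i j] main[of j i] ij by (metis linorder_neqE_nat)
qed

text \<open>A positive value is at most its multiples, one of which is attained in \<open>F\<close>;
  the factor \<open>t\<close> makes the bound strict.\<close>

lemma cofinal:
  assumes F: "is_subfield F" and t: "t \<in> F" "t \<noteq> 0" "1 \<prec> t" and y: "algebraic_over F y" "y \<noteq> 0"
  shows "\<exists>d\<in>F - {0}. y \<prec> d"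
proof (cases "y \<preceq> 1")
  case True
  then show ?thesis using t le_lt_trans by blast
next
  case False
  obtain n c where c: "n > 0" "c \<in> F - {0}" "y ^ n \<preceq> c" using algebraic_value_torsion[OF F y] by blast
  obtain k where n: "n = Suc k" using c(1) by (cases n) auto
  have "y \<preceq> y ^ n" using le_mult_left[OF le_power[OF lt_imp_le[OF False], of k], of y] by (simp add: n)
  then have "y \<preceq> c" using c le_trans by blast
  moreover have "c \<prec> c * t" using t c le_mult_cancel[of c t 1] by auto
  ultimately have "y \<prec> c * t" using le_lt_trans by blast
  then show ?thesis using t c is_subfieldD(5)[OF F] by (intro bexI[of _ "c * t"]) auto
qed

lemma cofinal_finite:
  assumes F: "is_subfield F" and t: "t \<in> F" "t \<noteq> 0" "1 \<prec> t"
    and Y: "finite Y" "\<And>y. y \<in> Y \<Longrightarrow> algebraic_over F y \<and> y \<noteq> 0"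
  shows "\<exists>d\<in>F - {0}. \<forall>y\<in>Y. y \<prec> d"
  using Y
proof (induction Y rule: finite_induct)
  case (insert y Y)
  obtain d where d: "d \<in> F - {0}" "\<forall>y\<in>Y. y \<prec> d" using insert by auto
  obtain e where e: "e \<in> F - {0}" "y \<prec> e" using cofinal[OF F t] insert.prems by blast
  show ?case
  proof (cases "d \<preceq> e")
    case True
    then show ?thesis using d e lt_le_trans by (intro bexI[of _ e]) auto
  next
    case False
    then show ?thesis using d e lt_trans by (intro bexI[of _ d]) auto
  qed
qed (use t in blast)

end

section \<open>Hensel's Lemma and roots of extremal value\<close>

lemma coeff_prod_linear:
  assumes "finite R"
  shows "coeff (\<Prod>r\<in>R. [:-r, 1:]) (card R) = (1::'a::field)"
    and "Suc n = card R \<Longrightarrow> coeff (\<Prod>r\<in>R. [:-r, 1:]) n = - (\<Sum>r\<in>R. r)"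
proof -
  have "coeff (\<Prod>r\<in>R. [:-r, 1:]) (card R) = 1 \<and>
    (\<forall>n. Suc n = card R \<longrightarrow> coeff (\<Prod>r\<in>R. [:-r, 1:]) n = - (\<Sum>r\<in>R. r))"
    using assms
  proof (induction R rule: finite_induct)
    case (insert x R)
    have deg: "degree (\<Prod>r\<in>R. [:-r, 1:]) \<le> card R"
      using degree_prod_sum_le[OF insert.hyps(1), of "\<lambda>r. [:-r, 1:]"] by simp
    have "coeff (\<Prod>r\<in>insert x R. [:-r, 1:]) i =
        (case i of 0 \<Rightarrow> 0 | Suc j \<Rightarrow> coeff (\<Prod>r\<in>R. [:-r, 1:]) j) - x * coeff (\<Prod>r\<in>R. [:-r, 1:]) i" for i
      using insert.hyps by (simp add: coeff_pCons)
    moreover have "coeff (\<Prod>r\<in>R. [:-r, 1:]) (Suc (card R)) = 0" using deg by (intro coeff_eq_0) simp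
    ultimately show ?case
      using insert by (auto split: nat.splits)
  qed simp
  then show "coeff (\<Prod>r\<in>R. [:-r, 1:]) (card R) = (1::'a)"
    and "Suc n = card R \<Longrightarrow> coeff (\<Prod>r\<in>R. [:-r, 1:]) n = - (\<Sum>r\<in>R. r)" by blast+
qed

context valued_closed
begin

lemma prod_le_one: "(\<And>i. i \<in> X \<Longrightarrow> f i \<preceq> 1) \<Longrightarrow> prod f X \<preceq> 1"
proof (induction X rule: infinite_finite_induct)
  case (insert i X)
  then have "f i * prod f X \<preceq> 1 * 1" by (intro le_mult) auto
  then show ?case using insert by simp
qed auto

text \<open>The root \<open>c\<close> determines the value of the sum \<open>s\<close> of all roots,
  which lies in \<open>H\<close>. After division by \<open>s\<close> it is congruent to
  \<open>1\<close> and the other roots to \<open>0\<close>, so Hensel's Lemma at the approximate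
  root \<open>1\<close> yields \<open>c / s\<close>.\<close>

lemma unique_least_root_mem:
  assumes H: "is_subfield H" "hensel V H" and R: "finite R" "poly_over H (\<Prod>r\<in>R. [:-r, 1:])"
    and c: "c \<in> R" "c \<noteq> 0" and least: "\<And>r. r \<in> R \<Longrightarrow> r \<noteq> c \<Longrightarrow> c \<prec> r"
  shows "c \<in> H"
proof -
  note HD = is_subfieldD[OF H(1)] and HR = subfield_imp_subring[OF H(1)]
  let ?f = "\<Prod>r\<in>R. [:-r, 1:]"
  define s where "s = (\<Sum>r\<in>R. r)"
  define t where "t = (\<Sum>r\<in>R - {c}. r)"
  have st: "s = c + t" unfolding s_def t_def using R c by (simp add: sum.remove)
  have ct: "c \<prec> t" unfolding t_def using least c(2) by (intro lt_sum) auto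
  have sc: "s \<preceq> c" "c \<preceq> s" unfolding st using dominant_add[OF ct] by blast+
  have s0: "s \<noteq> 0" using sc(2) sc(1) c(2) by auto
  obtain n where n: "Suc n = card R" using R c by (metis card_gt_0_iff empty_iff gr0_implies_Suc)
  have "- s \<in> H" using coeff_prod_linear(2)[OF R(1) n] poly_overD[OF R(2), of n] by (simp add: s_def)
  then have sH: "s \<in> H" using HD(7) by fastforce
  define g where "g = (\<Prod>r\<in>R. [:-(r / s), 1:])"
  define h where "h = (\<Prod>r\<in>R - {c}. [:-(r / s), 1:])"
  have gh: "g = [:-(c / s), 1:] * h" unfolding g_def h_def using R c by (simp add: prod.remove)
  have "pcompose ?f [:0, s:] = (\<Prod>r\<in>R. smult s [:-(r / s), 1:])"
    unfolding pcompose_prod using s0 by (intro prod.cong) (auto simp: pcompose_pCons)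
  also have "\<dots> = smult (s ^ card R) g" unfolding prod_smult g_def by simp
  finally have "g = smult (inverse (s ^ card R)) (pcompose ?f [:0, s:])" using s0 by simp
  then have gH: "poly_over H g"
    using sH R(2) HD by (auto intro!: poly_over_smult[OF HR] poly_over_pcompose[OF HR] poly_over_pCons[OF HR] poly_over_0[OF HR])
  have rs: "r / s \<in> V" if "r \<in> R" for r
  proof -
    have "s \<preceq> r" using that least[of r] sc(1) le_trans lt_imp_le by (cases "r = c") blast+
    then show ?thesis using s0 by (simp add: le_iff)
  qed
  have lin: "poly_over V [:-(r / s), 1:]" if "r \<in> R" for r
    using rs[OF that] V_rules by (auto intro!: poly_over_pCons[OF subring] poly_over_0[OF subring])
  have gV: "poly_over V g" and hV: "poly_over V h"
    unfolding g_def h_def using lin by (auto intro!: poly_over_prod[OF subring])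
  have small: "1 \<prec> r / s" if "r \<in> R" "r \<noteq> c" for r
  proof -
    have "s \<prec> r" using least[OF that] sc(1) le_lt_trans by blast
    then show ?thesis using s0 le_mult_cancel[of s "r / s" 1] by simp
  qed
  have cs: "1 \<prec> 1 - c / s"
  proof -
    have "s \<prec> t" using ct sc(1) le_lt_trans by blast
    moreover have "s * (1 - c / s) = t" using s0 st by (simp add: field_simps)
    ultimately show ?thesis using s0 le_mult_cancel[of s "1 - c / s" 1] by simp
  qed
  have csle: "1 \<prec> (1 - c / s) * u" if "u \<in> V" for u
    using lt_le_trans[OF cs, of "u * (1 - c / s)"] mem_le[OF that] by (simp add: mult.commute)
  have "poly g 1 = (1 - c / s) * poly h 1" unfolding gh by (simp add: algebra_simps)
  then have g1: "1 \<prec> poly g 1" using csle poly_in_subring[OF subring hV V_rules(1)] by metis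
  have "poly h 1 = (\<Prod>r\<in>R - {c}. 1 - r / s)" unfolding h_def by (simp add: poly_prod)
  also have "\<dots> \<preceq> 1"
  proof (rule prod_le_one)
    fix r assume "r \<in> R - {c}"
    then have "1 + - (r / s) \<preceq> 1" using small by (intro dominant_add(2)) auto
    then show "1 - r / s \<preceq> 1" by simp
  qed
  finally have h1: "poly h 1 \<preceq> 1" .
  have "poly (pderiv g) 1 = poly h 1 + (1 - c / s) * poly (pderiv h) 1"
    unfolding gh pderiv_mult by (simp add: pderiv_pCons algebra_simps)
  moreover have "1 \<prec> (1 - c / s) * poly (pderiv h) 1"
    using csle poly_in_subring[OF subring poly_over_pderiv[OF subring hV] V_rules(1)] by metis
  then have "poly h 1 \<prec> (1 - c / s) * poly (pderiv h) 1" using h1 le_lt_trans by blast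
  ultimately have g'1: "poly (pderiv g) 1 \<preceq> 1"
    using dominant_add(2)[where a = "poly h 1"] h1 le_trans by metis
  obtain b where b: "b \<in> H \<inter> V" "poly g b = 0" "1 \<prec> b - 1"
  proof -
    have "poly_over (H \<inter> V) g" "1 \<in> H \<inter> V" using gH gV HD(1) V_rules(1) by (auto simp: poly_over_def)
    then show ?thesis using H(2) g1 g'1 that unfolding hensel_def by blast
  qed
  obtain r where r: "r \<in> R" "b = r / s" using b(2) R(1) unfolding g_def by (auto simp: poly_prod)
  have "r = c"
  proof (rule ccontr)
    assume "r \<noteq> c"
    then have "1 \<prec> b" using small r by blast
    then have "1 \<prec> b - (b - 1)" using b(3) by (rule lt_diff)
    then show False by (simp only: diff_diff_eq2 add_diff_cancel_left' le_refl not_True_eq_False)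
  qed
  then have "c = b * s" using r s0 by simp
  then show ?thesis using b(1) sH HD(5) by blast
qed

text \<open>No Galois group is involved: \<open>x\<close> being closer to \<open>a\<close> than the
  other conjugates makes \<open>1 / (a - x)\<close> the root of strictly least value among the
  \<open>1 / (r - x)\<close>.\<close>

theorem krasner:
  assumes m: "is_minpoly K a m" "rsquarefree m" and H: "is_subfield H" "hensel V H" "K \<subseteq> H" "x \<in> H"
    and close: "\<And>a'. poly m a' = 0 \<Longrightarrow> a' \<noteq> a \<Longrightarrow> a - a' \<prec> x - a"
  shows "a \<in> H"
proof (cases "x = a")
  case False
  note HD = is_subfieldD[OF H(1)] and HR = subfield_imp_subring[OF H(1)]
  let ?R = "{a'. poly m a' = 0}"
  have fin: "finite ?R" using poly_roots_finite is_minpolyD(4)[OF m(1)] by blast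
  have nz: "a' - x \<noteq> 0" if "a' \<in> ?R" for a'
    using close[of a'] that False le_minus_commute[of "x - a" a x] by auto
  have mf: "m = (\<Prod>r\<in>?R. [:-r, 1:])"
    using rsquarefree_factorization(1)[OF m(2)] is_minpolyD(2)[OF m(1)] by simp
  let ?P = "\<Prod>r\<in>?R. [:-(inverse (r - x)), 1:]"
  \<comment> \<open>The reversal of \<open>m(X + x)\<close> has the roots
    \<open>1 / (r - x)\<close>, and it is over \<open>H\<close> because \<open>x\<close> lies in
    \<open>H\<close>.\<close>
  let ?m1 = "reflect_poly (pcompose m [:x, 1:])"
  define c where "c = (\<Prod>r\<in>?R. - (r - x))"
  have c0: "c \<noteq> 0" unfolding c_def using nz fin by auto
  have "?m1 = (\<Prod>r\<in>?R. reflect_poly (pcompose [:-r, 1:] [:x, 1:]))"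
    by (subst mf) (simp only: pcompose_prod reflect_poly_prod)
  also have "\<dots> = (\<Prod>r\<in>?R. smult (- (r - x)) [:-(inverse (r - x)), 1:])"
  proof (intro prod.cong refl)
    fix r assume r: "r \<in> ?R"
    have "pcompose [:-r, 1:] [:x, 1:] = [:- (r - x), 1:]" by (simp add: pcompose_pCons)
    then show "reflect_poly (pcompose [:-r, 1:] [:x, 1:]) = smult (- (r - x)) [:-(inverse (r - x)), 1:]"
      using nz[OF r] by (simp add: reflect_poly_pCons field_simps)
  qed
  also have "\<dots> = smult c ?P" unfolding prod_smult c_def ..
  finally have m1: "?m1 = smult c ?P" .
  have inj: "inj_on (\<lambda>r. inverse (r - x)) ?R" by (auto simp: inj_on_def)
  let ?S = "(\<lambda>r. inverse (r - x)) ` ?R"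
  have PS: "?P = (\<Prod>r\<in>?S. [:-r, 1:])" by (subst prod.reindex[OF inj]) simp
  have m1H: "poly_over H ?m1"
    using poly_over_mono[OF is_minpolyD(1)[OF m(1)] H(3)] H(4) HD
    by (intro poly_over_reflect[OF HR] poly_over_pcompose[OF HR] poly_over_pCons[OF HR] poly_over_0[OF HR])
  have "c = coeff ?m1 (card ?S)"
    unfolding m1 PS using coeff_prod_linear(1)[of ?S] fin by simp
  then have cH: "c \<in> H" using poly_overD[OF m1H] by simp
  have "?P = smult (inverse c) ?m1" unfolding m1 using c0 by simp
  then have PH: "poly_over H ?P" using m1H cH HD(6) by (metis poly_over_smult[OF HR])
  have "inverse (a - x) \<in> H"
  proof (rule unique_least_root_mem[OF H(1,2), of ?S])
    show "finite ?S" using fin by simp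
    show "poly_over H (\<Prod>r\<in>?S. [:-r, 1:])" using PH PS by simp
    show "inverse (a - x) \<in> ?S" using is_minpolyD(3)[OF m(1)] by blast
    show "inverse (a - x) \<noteq> 0" using False by simp
    fix r assume r: "r \<in> ?S" "r \<noteq> inverse (a - x)"
    then obtain a' where a': "poly m a' = 0" "r = inverse (a' - x)" "a' \<noteq> a" by blast
    have lt: "a - a' \<prec> a - x" using close[OF a'(1,3)] minus_le_commute by blast
    have "a' - x = - (a - a') + (a - x)" by simp
    moreover have "- (a - a') + (a - x) \<preceq> - (a - a')"
      using lt by (intro dominant_add(2)) (simp only: le_uminus not_False_eq_True)
    ultimately have "a' - x \<preceq> a - a'" by (metis le_uminus)
    then have "a' - x \<prec> a - x" using lt le_lt_trans by blast
    then show "inverse (a - x) \<prec> r"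
      using le_inverse_iff[of "a - x" "a' - x"] nz[of a'] a' False by simp
  qed
  then have "inverse (inverse (a - x)) + x \<in> H" using HD(4)[OF HD(6) H(4)] by blast
  then show ?thesis by simp
qed (use H in simp)

lemma prod_le_power: "(\<And>t. t \<in> X \<Longrightarrow> t \<preceq> a) \<Longrightarrow> \<Prod>X \<preceq> a ^ card X"
  by (induction X rule: infinite_finite_induct) (auto intro: le_mult)

lemma power_lt_prod:
  assumes "finite X" "X \<noteq> {}" "\<And>t. t \<in> X \<Longrightarrow> a \<prec> t"
  shows "a ^ card X \<prec> \<Prod>X"
  using assms
proof (induction X rule: finite_ne_induct)
  case (insert t X)
  have "a \<noteq> 0" using insert.prems[of t] by auto
  then have "a * a ^ card X \<prec> t * \<Prod>X"
    using insert by (intro lt_mult lt_imp_le) auto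
  then show ?case using insert by simp
qed simp

text \<open>After the common factors are cancelled, equally many elements remain on both sides: of
  least value in \<open>S\<close>, of strictly larger value in \<open>T\<close>.\<close>

lemma least_product:
  assumes R: "finite R" "0 \<notin> R" and S: "S = {r \<in> R. \<forall>r'\<in>R. r \<preceq> r'}"
    and T: "T \<subseteq> R" "card T = card S" "T \<noteq> S"
  shows "\<Prod>S \<prec> \<Prod>T"
proof -
  have fin: "finite S" "finite T" using R S T finite_subset by auto
  have SR: "S \<subseteq> R" using S by blast
  have "\<not> T \<subseteq> S" using card_subset_eq[OF fin(1)] T by blast
  then have TS: "T - S \<noteq> {}" by blast
  have cards: "card (T - S) = card (S - T)"
  proof -
    have "card (T - S) + card (T \<inter> S) = card T" "card (S - T) + card (S \<inter> T) = card S"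
      using fin by (metis Int_Diff_disjoint Int_Diff_Un Un_Diff_Int Un_commute card_Un_disjoint finite_Diff finite_Int inf_commute)+
    then show ?thesis using T(2) by (simp add: Int_commute)
  qed
  then have "S \<noteq> {}" using TS fin by (metis Diff_empty card_0_eq empty_Diff finite_Diff)
  then obtain s where s: "s \<in> S" by blast
  have "\<Prod>(S - T) \<preceq> s ^ card (S - T)" using s S by (intro prod_le_power) auto
  moreover have "s ^ card (T - S) \<prec> \<Prod>(T - S)"
  proof (rule power_lt_prod)
    fix t assume t: "t \<in> T - S"
    then obtain r where "r \<in> R" "r \<prec> t" using S T(1) by blast
    moreover have "s \<preceq> r" using s S \<open>r \<in> R\<close> by blast
    ultimately show "s \<prec> t" using le_lt_trans by blast
  qed (use fin TS in auto)
  ultimately have lt: "\<Prod>(S - T) \<prec> \<Prod>(T - S)" unfolding cards using le_lt_trans by blast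
  have "\<Prod>S = \<Prod>(S \<inter> T) * \<Prod>(S - T)" "\<Prod>T = \<Prod>(S \<inter> T) * \<Prod>(T - S)"
    using prod.Int_Diff[OF fin(1), of "\<lambda>x. x" T] prod.Int_Diff[OF fin(2), of "\<lambda>x. x" S]
    by (simp_all add: Int_commute)
  moreover have "\<Prod>(S \<inter> T) \<noteq> 0" using fin SR R(2) by auto
  ultimately show ?thesis using lt by simp
qed

end

section \<open>Automorphisms and valuations\<close>

locale valued_ambient = ambient F + valued_closed V
  for F V :: "'a::alg_closed_field set"
begin

text \<open>
  Automorphisms over a henselian field preserve the valuation: the product of the conjugates of
  least value is, up to a \<open>p\<close>-th power, a root of strictly least value and hence lies in the field. So
  it is fixed, and by transitivity all conjugates have the same value. The field \<open>F\<close>, in which \<open>H\<close> is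
  relatively algebraically closed, replaces \<open>H\<close> so that the ambient field is algebraic over it.
\<close>

lemma hensel_aut_le:
  assumes H: "is_subfield H" "hensel V H" "H \<subseteq> F" "F \<inter> alg_closure H \<subseteq> H"
    and t: "aut_over F \<tau>" and y: "y \<in> alg_closure H" "y \<noteq> 0"
  shows "y \<preceq> \<tau> y"
proof -
  define R where "R = {\<sigma> y | \<sigma>. aut_over F \<sigma>}"
  obtain p where p: "p \<noteq> 0" "poly_over F p" "poly p y = 0"
    using alg[of y] unfolding algebraic_over_def by blast
  have "R \<subseteq> {r. poly p r = 0}" unfolding R_def using aut_over_root[OF _ p(2,3)] by blast
  then have finR: "finite R" using poly_roots_finite[OF p(1)] finite_subset by blast
  have R0: "0 \<notin> R" unfolding R_def using y(2) aut_overD(13) by fastforce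
  have yR: "y \<in> R" unfolding R_def using aut_over_id by (metis (mono_tags, lifting) id_apply mem_Collect_eq)
  have stab: "\<sigma> ` R \<subseteq> R" if "aut_over F \<sigma>" for \<sigma>
    unfolding R_def using aut_over_comp[OF that] by (auto simp: o_def)
  define S where "S = {r \<in> R. \<forall>r'\<in>R. r \<preceq> r'}"
  have "S \<noteq> {}"
  proof -
    have "\<exists>r\<in>X. \<forall>r'\<in>X. r \<preceq> r'" if "finite X" "X \<noteq> {}" for X :: "'a set"
      using that
    proof (induction X rule: finite_ne_induct)
      case (insert x X)
      then obtain i where "i \<in> X" "\<forall>j\<in>X. i \<preceq> j" by blast
      then show ?case using le_total[of i x] le_trans le_refl by (metis insert_iff)
    qed auto
    then show ?thesis unfolding S_def using finR yR by blast
  qed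
  define b where "b = \<Prod>S"
  have SR: "S \<subseteq> R" unfolding S_def by blast
  have finS: "finite S" using SR finR finite_subset by blast
  have img: "\<sigma> b = \<Prod>(\<sigma> ` S)" if "aut_over F \<sigma>" for \<sigma>
    unfolding b_def aut_over_prod[OF that]
    using aut_overD(2)[OF that] by (subst prod.reindex) (auto intro: inj_on_subset)
  have move: "b \<prec> \<sigma> b" if s: "aut_over F \<sigma>" "\<sigma> ` S \<noteq> S" for \<sigma>
    unfolding img[OF s(1)] unfolding b_def
  proof (rule least_product[OF finR R0 S_def _ _ s(2)])
    show "\<sigma> ` S \<subseteq> R" using stab[OF s(1)] SR by blast
    show "card (\<sigma> ` S) = card S"
      using aut_overD(2)[OF s(1)] by (intro card_image) (auto intro: inj_on_subset)
  qed
  have dich: "\<sigma> b = b \<or> b \<prec> \<sigma> b" if "aut_over F \<sigma>" for \<sigma>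
    using move[OF that] img[OF that] unfolding b_def by metis
  have Halg: "is_subfield (alg_closure H)" using alg_closure_subfield[OF H(1)] .
  have conj: "\<sigma> a \<in> alg_closure H" if "aut_over F \<sigma>" "a \<in> alg_closure H" for \<sigma> a
    using that aut_over_root[OF aut_over_mono[OF that(1) H(3)]]
    unfolding alg_closure_def algebraic_over_def by blast
  have "R \<subseteq> alg_closure H" unfolding R_def using conj y(1) by blast
  then have bH: "b \<in> alg_closure H"
    unfolding b_def using SR by (intro subring_prod[OF subfield_imp_subring[OF Halg]]) auto
  have b0: "b \<noteq> 0" unfolding b_def using finS SR R0 by auto
  obtain k m where m: "is_minpoly F (b ^ CHAR('a) ^ k) m" "rsquarefree m" and k: "CHAR('a) > 0 \<or> k = 0"
    using separable_power[OF F alg, of b] by blast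
  define q where "q = CHAR('a) ^ k"
  have q: "q > 0" unfolding q_def using k by auto
  have roots: "\<exists>\<sigma>. aut_over F \<sigma> \<and> r = \<sigma> b ^ q" if "poly m r = 0" for r
    using minpoly_conjugate[OF m(1) that] aut_overD(10) unfolding q_def by metis
  have "b ^ q \<in> H"
  proof (rule unique_least_root_mem[OF H(1,2), of "{r. poly m r = 0}"])
    have mf: "m = (\<Prod>r | poly m r = 0. [:-r, 1:])"
      using rsquarefree_factorization(1)[OF m(2)] is_minpolyD(2)[OF m(1)] by simp
    show "finite {r. poly m r = 0}" using poly_roots_finite is_minpolyD(4)[OF m(1)] by blast
    \<comment> \<open>Minimality refers to \<open>F\<close>, but the roots are powers of conjugates
      of \<open>b\<close>, so the coefficients are algebraic over \<open>H\<close>, and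
      \<open>F\<close> has no such elements outside \<open>H\<close>.\<close>
    have "poly_over (alg_closure H) (\<Prod>r | poly m r = 0. [:-r, 1:])"
    proof (rule poly_over_prod[OF subfield_imp_subring[OF Halg]])
      fix r assume "r \<in> {r. poly m r = 0}"
      then have "r \<in> alg_closure H"
        using roots conj bH is_subfieldD(9)[OF Halg] by blast
      then show "poly_over (alg_closure H) [:-r, 1:]"
        using is_subfieldD[OF Halg] subfield_imp_subring[OF Halg]
        by (intro poly_over_pCons poly_over_0)
    qed
    then have "poly_over (alg_closure H) m" using mf by simp
    then have "poly_over H m"
      using H(4) poly_overD[OF is_minpolyD(1)[OF m(1)]] unfolding poly_over_def by blast
    then show "poly_over H (\<Prod>r | poly m r = 0. [:-r, 1:])" using mf by simp
    show "b ^ q \<in> {r. poly m r = 0}" using is_minpolyD(3)[OF m(1)] by (simp add: q_def)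
    show "b ^ q \<noteq> 0" using b0 by simp
    fix r assume r: "r \<in> {r. poly m r = 0}" "r \<noteq> b ^ q"
    then obtain \<sigma> where s: "aut_over F \<sigma>" "r = \<sigma> b ^ q" using roots by blast
    then have "b \<prec> \<sigma> b" using dich r(2) by metis
    then show "b ^ q \<prec> r" unfolding s(2) using q by (rule lt_power)
  qed
  then have bF: "b ^ q \<in> F" using H(3) by blast
  have fixed: "\<sigma> ` S = S" if s: "aut_over F \<sigma>" for \<sigma>
  proof (rule ccontr)
    assume "\<sigma> ` S \<noteq> S"
    then have "b ^ q \<prec> \<sigma> b ^ q" using move[OF s] q lt_power by blast
    moreover have "\<sigma> b ^ q = b ^ q" using aut_overD(5,10)[OF s] bF by metis
    ultimately show False by simp
  qed
  obtain \<sigma> where s: "aut_over F \<sigma>" "\<sigma> y \<in> S" using \<open>S \<noteq> {}\<close> SR unfolding R_def by blast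
  then have "\<sigma> y \<in> \<sigma> ` S" using fixed by blast
  then have "y \<in> S" using aut_overD(14)[OF s(1)] by auto
  moreover have "\<tau> y \<in> R" unfolding R_def using t by blast
  ultimately show ?thesis unfolding S_def by blast
qed

lemma hensel_aut_preserves:
  assumes H: "is_subfield H" "hensel V H" "H \<subseteq> F" "F \<inter> alg_closure H \<subseteq> H"
    and t: "aut_over F \<tau>" and y: "y \<in> alg_closure H"
  shows "y \<in> V \<longleftrightarrow> \<tau> y \<in> V"
proof (cases "y = 0")
  case False
  have "\<tau> y \<in> alg_closure H"
    using y aut_over_root[OF aut_over_mono[OF t H(3)]]
    unfolding alg_closure_def algebraic_over_def by blast
  moreover have "\<tau> y \<noteq> 0" using False aut_overD(13)[OF t] by simp
  ultimately have "\<tau> y \<preceq> y"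
    using hensel_aut_le[OF H aut_over_inv[OF t], of "\<tau> y"] aut_overD(2)[OF t] by simp
  moreover have "y \<preceq> \<tau> y" using hensel_aut_le[OF H t y False] .
  ultimately show ?thesis unfolding mem_iff using le_trans by blast
qed (simp add: aut_overD(6)[OF t])

subsection \<open>Extending value-preserving embeddings\<close>

text \<open>
  Avoidance of finitely many valuation rings: if \<open>z\<close> has images outside the valuation ring for all
  old embeddings and \<open>y\<close> for the new one, then \<open>z\<close> or some \<open>z\<^sup>k + y\<close> does for all of them.
\<close>

lemma common_nonintegral:
  assumes "finite R" "R \<noteq> {}" and E: "\<And>r. r \<in> R \<Longrightarrow> emb F (E r) \<and> Domain (E r) = D"
    and bad: "\<And>r. r \<in> R \<Longrightarrow> \<exists>y y'. (y, y') \<in> E r \<and> y \<in> V \<and> y' \<notin> V"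
  shows "\<exists>e\<in>V \<inter> D. \<forall>r\<in>R. \<forall>e'. (e, e') \<in> E r \<longrightarrow> e' \<notin> V"
  using assms
proof (induction R rule: finite_ne_induct)
  case (singleton r)
  obtain y y' where y: "(y, y') \<in> E r" "y \<in> V" "y' \<notin> V" using singleton.prems(2) by blast
  have "emb F (E r)" "Domain (E r) = D" using singleton.prems(1) by blast+
  then show ?case using y emb_unique[of "E r" y] by blast
next
  case (insert s R)
  obtain z where z: "z \<in> V" "z \<in> D" "\<forall>r\<in>R. \<forall>e'. (z, e') \<in> E r \<longrightarrow> e' \<notin> V"
  proof -
    have "\<exists>e\<in>V \<inter> D. \<forall>r\<in>R. \<forall>e'. (e, e') \<in> E r \<longrightarrow> e' \<notin> V"
      by (rule insert.IH; rule insert.prems; simp)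
    then show ?thesis using that by blast
  qed
  obtain y y' where y: "(y, y') \<in> E s" "y \<in> V" "y' \<notin> V" using insert.prems(2) by blast
  have es: "emb F (E s)" "Domain (E s) = D" using insert.prems(1) by blast+
  obtain z' where z': "(z, z') \<in> E s" using z(2) es(2) by blast
  show ?case
  proof (cases "z' \<in> V")
    case False
    then have "\<forall>e'. (z, e') \<in> E s \<longrightarrow> e' \<notin> V" using z' emb_unique[OF es(1)] by blast
    then show ?thesis using z by blast
  next
    case True
    have yD: "y \<in> D" using y(1) es(2) by blast
    have DF: "is_subfield D" using emb_Domain[OF es(1)] es(2) by simp
    define bad where "bad r = {k. k > 0 \<and> (\<exists>e'. (z ^ k + y, e') \<in> E r \<and> e' \<in> V)}" for r
    have finbad: "finite (bad r)" if r: "r \<in> R" for r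
    proof -
      have er: "emb F (E r)" "Domain (E r) = D" using insert.prems(1) r by blast+
      obtain u where u: "(z, u) \<in> E r" using z(2) er(2) by blast
      obtain w where w: "(y, w) \<in> E r" using yD er(2) by blast
      have uV: "u \<notin> V" using z(3) r u by blast
      have val: "u ^ k + w \<in> V" if "k \<in> bad r" for k
        using that emb_add[OF er(1) emb_power[OF er(1) u, of k] w] emb_unique[OF er(1)]
        unfolding bad_def by blast
      \<comment> \<open>At most one exponent is bad for each old embedding: two would make
        \<open>u ^ l - u ^ k\<close> integral although \<open>u\<close> is not.\<close>
      have no: False if kl: "k \<in> bad r" "l \<in> bad r" "k < l" for k l
      proof -
        have "u ^ l - u ^ k \<in> V" using V_rules(3)[OF val[OF kl(2)] val[OF kl(1)]] by simp
        moreover have "u ^ l = u ^ k * u ^ (l - k)" using kl(3) by (simp add: power_add[symmetric])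
        ultimately have "1 \<preceq> u ^ k * (u ^ (l - k) - 1)" by (simp add: mem_iff right_diff_distrib)
        moreover have "u ^ k \<prec> 1" using uV mem_power kl(1) unfolding bad_def mem_iff by blast
        moreover have "u ^ (l - k) - 1 \<preceq> 1"
        proof -
          have "u ^ (l - k) \<prec> 1" using uV mem_power kl(3) unfolding mem_iff by (metis zero_less_diff)
          then have "u ^ (l - k) + (- 1) \<preceq> u ^ (l - k)" by (intro dominant_add(2)) simp
          then have "u ^ (l - k) - 1 \<preceq> u ^ (l - k)" by simp
          then show ?thesis using lt_imp_le[OF \<open>u ^ (l - k) \<prec> 1\<close>] by (rule le_trans)
        qed
        ultimately show False
          by (metis le_mult_left le_trans mult.right_neutral)
      qed
      have "bad r \<subseteq> {k}" if "k \<in> bad r" for k using no that by (metis linorder_neqE_nat singleton_iff subsetI)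
      then show ?thesis by (metis finite.emptyI finite.insertI finite_subset ex_in_conv)
    qed
    have "finite (\<Union>r\<in>R. bad r)" using finbad insert.hyps(1) by blast
    then have "infinite ({0<..} - (\<Union>r\<in>R. bad r))" by (intro Diff_infinite_finite infinite_Ioi)
    then have "{0<..} - (\<Union>r\<in>R. bad r) \<noteq> {}" by (metis finite.emptyI)
    then obtain k where "k \<in> {0<..} - (\<Union>r\<in>R. bad r)" by blast
    then have k: "k > 0" "\<forall>r\<in>R. k \<notin> bad r" by auto
    have "z ^ k + y \<in> V \<inter> D"
      using V_rules(4)[OF V_rules(7)[OF z(1)] y(2)] is_subfieldD(4)[OF DF is_subfieldD(9)[OF DF z(2)] yD] by blast
    moreover have "\<forall>r\<in>R. \<forall>e'. (z ^ k + y, e') \<in> E r \<longrightarrow> e' \<notin> V" using k unfolding bad_def by blast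
    moreover have "e' \<notin> V" if "(z ^ k + y, e') \<in> E s" for e'
    proof
      assume "e' \<in> V"
      moreover have "e' = z' ^ k + y'"
        using emb_unique[OF es(1) that emb_add[OF es(1) emb_power[OF es(1) z'] y(1)]] .
      moreover have "z' ^ k \<in> V" using True V_rules(7) by blast
      ultimately have "y' \<in> V" using V_rules(3)[of e' "z' ^ k"] by simp
      then show False using y(3) by blast
    qed
    ultimately show ?thesis by blast
  qed
qed

lemma emb_le_iff:
  assumes G: "emb F G" and pres: "\<And>a b. (a, b) \<in> G \<Longrightarrow> a \<in> V \<longleftrightarrow> b \<in> V"
    and ab: "(a, a') \<in> G" "(b, b') \<in> G"
  shows "a \<preceq> b \<longleftrightarrow> a' \<preceq> b'"
proof (cases "a = 0")
  case True
  then show ?thesis using emb_eq_0_iff[OF G ab(1)] emb_eq_0_iff[OF G ab(2)] by simp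
next
  case False
  then have "a' \<noteq> 0" using emb_eq_0_iff[OF G ab(1)] by simp
  moreover have "(b / a, b' / a') \<in> G"
    unfolding divide_inverse using emb_mult[OF G ab(2) emb_inverse[OF G ab(1)]] .
  ultimately show ?thesis using pres False le_iff by blast
qed

lemma aut_emb: "aut_over F \<tau> \<Longrightarrow> emb F {(a, \<tau> a) | a. True}"
  unfolding emb_def by (auto simp: aut_overD)

text \<open>A failure to preserve \<open>V\<close> can always be found in the direction from
  integral to nonintegral: with \<open>c\<close> of the same value as \<open>y ^ n\<close>, the
  quotient \<open>c / y ^ n\<close> is integral, and an integral image would force
  \<open>c'\<close>, \<open>c\<close> and finally \<open>y\<close> to be integral.\<close>

lemma adjoin_bad:
  assumes G: "emb F G" and pres: "\<And>a b. (a, b) \<in> G \<Longrightarrow> a \<in> V \<longleftrightarrow> b \<in> V"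
    and E: "emb F E" "G \<subseteq> E" and y: "(y, y') \<in> E" "y \<notin> V" "y' \<in> V"
  shows "\<exists>u u'. (u, u') \<in> E \<and> u \<in> V \<and> u' \<notin> V"
proof (rule ccontr)
  assume no: "\<not> ?thesis"
  have y0: "y \<noteq> 0" using y(2) V_rules(2) by blast
  obtain n c where c: "n > 0" "c \<in> Domain G" "c \<noteq> 0" "y ^ n \<preceq> c" "c \<preceq> y ^ n"
    using algebraic_value_torsion[OF emb_Domain[OF G] alg_over[OF emb_Domain_incl[OF G]] y0] by blast
  obtain c' where c': "(c, c') \<in> G" using c(2) by blast
  have yn: "(y ^ n, y' ^ n) \<in> E" "y ^ n \<noteq> 0" using emb_power[OF E(1) y(1)] y0 by auto
  have u: "(c / y ^ n, c' / y' ^ n) \<in> E"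
    unfolding divide_inverse using c' E(2) emb_mult[OF E(1) _ emb_inverse[OF E(1) yn(1)]] by blast
  have "c / y ^ n \<in> V" using c(4) yn(2) by (simp add: le_iff)
  then have u': "c' / y' ^ n \<in> V" using no u by blast
  have "y' ^ n \<noteq> 0" using emb_eq_0_iff[OF E(1) yn(1)] yn(2) by simp
  then have "c' = (c' / y' ^ n) * y' ^ n" by simp
  then have "c' \<in> V" using u' V_rules(5)[OF u' V_rules(7)[OF y(3)]] by metis
  then have "c \<in> V" using pres c' by blast
  then have "y ^ n \<in> V" using c(5) le_trans unfolding mem_iff by blast
  then show False using y(2) mem_power c(1) by blast
qed

text \<open>
  The Newton polygon decides: if an integral element \<open>e\<close> had only nonintegral images under the
  candidate extensions, then its minimal polynomial \<open>f\<close> would satisfy \<open>f / f(0) \<equiv> 1\<close> modulo the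
  maximal ideal.
\<close>

lemma preserving_extension_step:
  assumes G: "emb F G" and pres: "\<And>a b. (a, b) \<in> G \<Longrightarrow> a \<in> V \<longleftrightarrow> b \<in> V"
  shows "\<exists>G'. emb F G' \<and> G \<subseteq> G' \<and> z \<in> Domain G' \<and> (\<forall>a b. (a, b) \<in> G' \<longrightarrow> (a \<in> V \<longleftrightarrow> b \<in> V))"
proof (rule ccontr)
  assume no: "\<not> ?thesis"
  let ?M = "Domain G"
  have M: "is_subfield ?M" using emb_Domain[OF G] .
  note algM = alg_over[OF emb_Domain_incl[OF G]]
  obtain m where m: "is_minpoly ?M z m" using minpoly_exists[OF M algM] by blast
  obtain m' where m': "poly_rel G m m'" "degree m' = degree m" "m' \<noteq> 0" using minpoly_image[OF G m] by blast
  let ?R = "{r. poly m' r = 0}"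
  let ?E = "adjoin G z"
  have ae: "emb F (?E r)" "G \<subseteq> ?E r" "(z, r) \<in> ?E r" if "r \<in> ?R" for r
    using adjoin_emb[OF G m m'(1)] that by auto
  have dom: "Domain (?E r) = {poly g z | g. poly_over ?M g}" for r
    using poly_rel_exists[OF G] poly_rel_over[OF G] unfolding adjoin_def[OF G] by blast
  have bad: "\<exists>y y'. (y, y') \<in> ?E r \<and> y \<in> V \<and> y' \<notin> V" if r: "r \<in> ?R" for r
  proof -
    obtain y y' where "(y, y') \<in> ?E r" "\<not> (y \<in> V \<longleftrightarrow> y' \<in> V)"
      using no ae[OF r] by blast
    then show ?thesis using adjoin_bad[OF G pres ae(1,2)[OF r]] by blast
  qed
  have "finite ?R" using poly_roots_finite[OF m'(3)] .
  moreover have "?R \<noteq> {}" using alg_closed_imp_poly_has_root[of m'] m'(2) is_minpolyD(5)[OF m] by auto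
  ultimately obtain e where e: "e \<in> V" "e \<in> {poly g z | g. poly_over ?M g}"
    "\<forall>r\<in>?R. \<forall>e'. (e, e') \<in> ?E r \<longrightarrow> e' \<notin> V"
    using common_nonintegral[of ?R ?E "{poly g z | g. poly_over ?M g}"] ae(1) dom bad by blast
  obtain g where g: "poly_over ?M g" "e = poly g z" using e(2) by blast
  obtain g' where g': "poly_rel G g g'" using poly_rel_exists[OF G g(1)] by blast
  obtain f where f: "is_minpoly ?M e f" using minpoly_exists[OF M algM] by blast
  obtain f' where f': "poly_rel G f f'" "f' \<noteq> 0" using minpoly_image[OF G f] by blast
  \<comment> \<open>Every root \<open>s\<close> of \<open>f'\<close> is an image of \<open>e\<close>
    under a candidate extension: an automorphism extending \<open>G\<close> with \<open>e\<close>
    sent to \<open>s\<close> maps \<open>z\<close> to a root of \<open>m'\<close>.\<close>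
  have roots: "s \<prec> 1" if s: "poly f' s = 0" for s
  proof -
    note A = adjoin_emb[OF G f f'(1) s]
    obtain \<tau> where t: "aut_over F \<tau>" "\<forall>a b. (a, b) \<in> adjoin G e s \<longrightarrow> \<tau> a = b"
      using emb_extend_aut_simple[OF A(1)] by blast
    let ?T = "{(a, \<tau> a) | a. True}"
    note T = aut_emb[OF t(1)]
    have GT: "G \<subseteq> ?T" using t(2) A(2) by auto
    then have rel: "poly_rel ?T m m'" "poly_rel ?T g g'" using m'(1) g' unfolding poly_rel_def by blast+
    have zz: "(z, \<tau> z) \<in> ?T" by blast
    have "(0, poly m' (\<tau> z)) \<in> ?T" using emb_poly[OF T rel(1) zz] is_minpolyD(3)[OF m] by simp
    then have r: "\<tau> z \<in> ?R" using emb_0D[OF T] by blast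
    have "(e, poly g' (\<tau> z)) \<in> ?T" using emb_poly[OF T rel(2) zz] g(2) by simp
    moreover have "\<tau> e = s" using t(2) A(3) by blast
    ultimately have "s = poly g' (\<tau> z)" by auto
    then have "(e, s) \<in> ?E (\<tau> z)" unfolding adjoin_def[OF G] g(2) using g' by blast
    then show ?thesis using e(3) r unfolding mem_iff by blast
  qed
  have lt: "coeff f 0 \<prec> coeff f i" if "i > 0" for i
    using coeff_lt_of_roots[OF f'(2) roots that] emb_le_iff[OF G pres, of "coeff f i" "coeff f' i" "coeff f 0" "coeff f' 0"] f'(1)
    unfolding poly_rel_def by blast
  have "coeff f 0 \<noteq> 0" using lt[of 1] by auto
  have "coeff f 0 \<prec> (\<Sum>i\<in>{0<..degree f}. coeff f i * e ^ i)"
  proof (rule lt_sum[OF \<open>coeff f 0 \<noteq> 0\<close>])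
    fix i assume "i \<in> {0<..degree f}"
    then have "coeff f 0 \<prec> coeff f i" using lt by simp
    moreover have "coeff f i \<preceq> coeff f i * e ^ i"
      using mem_le[OF V_rules(7)[OF e(1)]] by (simp add: mult.commute)
    ultimately show "coeff f 0 \<prec> coeff f i * e ^ i" using lt_le_trans by blast
  qed
  then have "coeff f 0 + (\<Sum>i\<in>{0<..degree f}. coeff f i * e ^ i) \<noteq> 0"
    using dominant_add(2)[where a = "coeff f 0"] \<open>coeff f 0 \<noteq> 0\<close> by (metis zero_le_iff)
  moreover have "poly f e = coeff f 0 + (\<Sum>i\<in>{0<..degree f}. coeff f i * e ^ i)"
  proof -
    have "{..degree f} = insert 0 {0<..degree f}" by auto
    then show ?thesis unfolding poly_altdef by simp
  qed
  ultimately show False using is_minpolyD(3)[OF f] by simp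
qed

lemma preserving_extension:
  assumes G: "emb F G" and pres: "\<And>a b. (a, b) \<in> G \<Longrightarrow> a \<in> V \<longleftrightarrow> b \<in> V"
  shows "\<exists>\<tau>. aut_over F \<tau> \<and> (\<forall>a b. (a, b) \<in> G \<longrightarrow> \<tau> a = b) \<and> (\<forall>a. a \<in> V \<longleftrightarrow> \<tau> a \<in> V)"
  using emb_extend_aut[OF G, of "\<lambda>a b. a \<in> V \<longleftrightarrow> b \<in> V"] pres preserving_extension_step by blast

end

section \<open>Placing the transcendental element\<close>

lemma separable_imp_algebraic:
  assumes "separable_over K a" shows "algebraic_over K a"
proof -
  obtain m where "is_minpoly K a m" using assms unfolding separable_over_def by blast
  from is_minpolyD(1,3,4)[OF this] show ?thesis unfolding algebraic_over_def by blast
qed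

lemma wle_agree:
  assumes A: "is_subfield A" "V \<inter> A = W \<inter> A" and ab: "a \<in> A" "b \<in> A"
    and V: "valuation_subring V" and W: "valuation_subring W"
  shows "wle V a b \<longleftrightarrow> wle W a b"
proof (cases "a = 0")
  case True
  then show ?thesis
    using valuation_subring.zero_le_iff[OF V] valuation_subring.zero_le_iff[OF W] by simp
next
  case False
  then show ?thesis
    using valuation_subring.le_iff[OF V] valuation_subring.le_iff[OF W] A(2) is_subfieldD(8)[OF A(1) ab(2,1)]
    by blast
qed

text \<open>
  Every sequence in the algebraic closure of \<open>K\<close> prescribes the place of \<open>x\<close>: a polynomial is
  integral at \<open>x\<close> if it is eventually integral along the sequence. Evaluation along the sequence
  shows that the prescription is consistent.
\<close>

lemma valuation_along_sequence:
  fixes K :: "'a::alg_closed_field set"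
  assumes K: "is_subfield K" and x: "\<not> algebraic_over K x" and W: "valuation_subring W"
    and b: "\<And>k::nat. b k \<in> alg_closure K"
  shows "\<exists>V. valuation_subring V \<and> V \<inter> alg_closure K = W \<inter> alg_closure K \<and>
    (\<forall>c d. c \<in> alg_closure K \<longrightarrow> d \<in> alg_closure K \<longrightarrow> d \<noteq> 0 \<longrightarrow>
      (\<forall>\<^sub>F k in sequentially. wle W d (b k - c)) \<longrightarrow> wle V d (x - c)) \<and>
    (\<forall>c d. c \<in> alg_closure K \<longrightarrow> d \<in> alg_closure K \<longrightarrow> d \<noteq> 0 \<longrightarrow>
      (\<forall>\<^sub>F k in sequentially. \<not> wle W (b k - c) d) \<longrightarrow> \<not> wle V (x - c) d)"
proof -
  interpret W: valuation_subring W by (fact W)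
  let ?A = "alg_closure K"
  have AF: "is_subfield ?A" using alg_closure_subfield[OF K] .
  note AR = subfield_imp_subring[OF AF] and AD = is_subfieldD[OF AF]
  define B where "B = {poly p x | p. poly_over ?A p \<and> (\<forall>\<^sub>F k in sequentially. poly p (b k) \<in> W)}"
  \<comment> \<open>Keeping these elements nonunits yields the strict inequalities for
    \<open>x\<close> and prevents \<open>V\<close> from exceeding \<open>W\<close> on algebraic
    elements.\<close>
  define J where "J = {poly p x | p. poly_over ?A p \<and> (\<forall>\<^sub>F k in sequentially. \<not> wle W (poly p (b k)) 1)}"
  have B: "is_subring B"
    unfolding is_subring_def
  proof (intro conjI ballI)
    show "1 \<in> B" unfolding B_def using poly_over_1[OF AR] W.V_rules(1)
      by (intro CollectI exI[of _ 1]) simp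
    fix y z assume "y \<in> B" "z \<in> B"
    then obtain p q where pq: "poly_over ?A p" "\<forall>\<^sub>F k in sequentially. poly p (b k) \<in> W" "y = poly p x"
      "poly_over ?A q" "\<forall>\<^sub>F k in sequentially. poly q (b k) \<in> W" "z = poly q x"
      unfolding B_def by blast
    have "\<forall>\<^sub>F k in sequentially. poly (p - q) (b k) \<in> W"
      using pq(2,5) by eventually_elim (simp add: W.V_rules)
    then show "y - z \<in> B" unfolding B_def using pq poly_over_diff[OF AR]
      by (intro CollectI exI[of _ "p - q"]) simp
    have "\<forall>\<^sub>F k in sequentially. poly (p * q) (b k) \<in> W"
      using pq(2,5) by eventually_elim (simp add: W.V_rules)
    then show "y * z \<in> B" unfolding B_def using pq poly_over_mult[OF AR]
      by (intro CollectI exI[of _ "p * q"]) simp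
  qed
  have J: "is_ideal_of J B"
    unfolding is_ideal_of_def
  proof (intro conjI ballI)
    show "0 \<in> J" unfolding J_def using poly_over_0[OF AR]
      by (intro CollectI exI[of _ 0]) simp
    show "J \<subseteq> B"
    proof
      fix y assume "y \<in> J"
      then obtain p where p: "poly_over ?A p" "\<forall>\<^sub>F k in sequentially. \<not> wle W (poly p (b k)) 1" "y = poly p x"
        unfolding J_def by blast
      have "\<forall>\<^sub>F k in sequentially. poly p (b k) \<in> W"
        using p(2) by eventually_elim (simp add: W.mem_iff W.lt_imp_le)
      then show "y \<in> B" unfolding B_def using p by blast
    qed
    fix z assume "z \<in> J"
    then obtain q where q: "poly_over ?A q" "\<forall>\<^sub>F k in sequentially. \<not> wle W (poly q (b k)) 1" "z = poly q x"
      unfolding J_def by blast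
    show "y + z \<in> J" if "y \<in> J" for y
    proof -
      from that obtain p where p: "poly_over ?A p" "\<forall>\<^sub>F k in sequentially. \<not> wle W (poly p (b k)) 1" "y = poly p x"
        unfolding J_def by blast
      have "\<forall>\<^sub>F k in sequentially. \<not> wle W (poly (p + q) (b k)) 1"
        using p(2) q(2) by eventually_elim (simp add: W.lt_add)
      then show ?thesis unfolding J_def using p q poly_over_add[OF AR]
        by (intro CollectI exI[of _ "p + q"]) simp
    qed
    show "y * z \<in> J" if "y \<in> B" for y
    proof -
      from that obtain p where p: "poly_over ?A p" "\<forall>\<^sub>F k in sequentially. poly p (b k) \<in> W" "y = poly p x"
        unfolding B_def by blast
      have "\<forall>\<^sub>F k in sequentially. \<not> wle W (poly (p * q) (b k)) 1"
        using p(2) q(2)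
      proof eventually_elim
        case (elim k)
        then show ?case using W.lt_le_trans[OF elim(2) W.mem_le[OF elim(1)]] by simp
      qed
      then show ?thesis unfolding J_def using p q poly_over_mult[OF AR]
        by (intro CollectI exI[of _ "p * q"]) simp
    qed
  qed
  have "1 \<notin> J"
  proof
    assume "1 \<in> J"
    then obtain p where p: "poly_over ?A p" "\<forall>\<^sub>F k in sequentially. \<not> wle W (poly p (b k)) 1" "1 = poly p x"
      unfolding J_def by blast
    have "p = 1" using poly_transcendental_eq[OF K x p(1) poly_over_1[OF AR]] p(3) by simp
    then show False using p(2) by simp
  qed
  then obtain V where V: "valuation_subring V" "B \<subseteq> V" "\<forall>a\<in>J. \<not> wle V a 1"
    using valuation_subring_exists[OF B J] by blast
  interpret V: valuation_subring V by (fact V(1))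
  have const: "poly_over ?A [:c:]" if "c \<in> ?A" for c
    using that by (simp add: poly_over_pCons_iff[OF AR] poly_over_0[OF AR])
  have WV: "c \<in> V" if "c \<in> ?A" "c \<in> W" for c
  proof -
    have "c \<in> B" unfolding B_def using const that by (intro CollectI exI[of _ "[:c:]"]) simp
    then show ?thesis using V(2) by blast
  qed
  have lin: "poly_over ?A [:-(c / d), 1 / d:]" if "c \<in> ?A" "d \<in> ?A" for c d
    using that AD by (intro poly_over_pCons[OF AR] poly_over_0[OF AR]) auto
  have pl: "poly [:-(c / d), 1 / d:] y = (y - c) / d" for c d y :: 'a
    by (simp add: diff_divide_distrib)
  show ?thesis
  proof (intro exI[of _ V] conjI allI impI)
    show "V \<inter> ?A = W \<inter> ?A"
    proof (intro equalityI subsetI)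
      fix c assume c: "c \<in> V \<inter> ?A"
      show "c \<in> W \<inter> ?A"
      proof (rule ccontr)
        assume "c \<notin> W \<inter> ?A"
        then have "c \<notin> W" using c by blast
        then have "c \<noteq> 0" "\<not> wle W (inverse c) 1"
          using W.V_rules(2) by (auto simp: W.le_one_iff)
        moreover from this have "inverse c \<in> J"
          unfolding J_def using const[of "inverse c"] c AD(6) by (intro CollectI exI[of _ "[:inverse c:]"]) simp
        ultimately have "\<not> wle V (inverse c) 1" using V(3) by blast
        then show False using c \<open>c \<noteq> 0\<close> by (simp add: V.le_one_iff)
      qed
    qed (use WV in blast)
    fix c d assume c: "c \<in> ?A" and d: "d \<in> ?A" "d \<noteq> 0"
    show "wle V d (x - c)" if ev: "\<forall>\<^sub>F k in sequentially. wle W d (b k - c)"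
    proof -
      have "\<forall>\<^sub>F k in sequentially. poly [:-(c / d), 1 / d:] (b k) \<in> W"
        unfolding pl using ev d(2) by (simp add: W.le_iff)
      then have "(x - c) / d \<in> B" unfolding B_def
        using lin[OF c d(1)] pl by (intro CollectI exI[of _ "[:-(c / d), 1 / d:]"]) simp
      then show ?thesis using V(2) d(2) V.le_iff by blast
    qed
    show "\<not> wle V (x - c) d" if ev: "\<forall>\<^sub>F k in sequentially. \<not> wle W (b k - c) d"
    proof -
      have "\<forall>\<^sub>F k in sequentially. \<not> wle W (poly [:-(c / d), 1 / d:] (b k)) 1"
        unfolding pl using ev
      proof eventually_elim
        case (elim k)
        then show ?case using W.le_mult_left[of "(b k - c) / d" 1 d] d(2) by auto
      qed
      then have "(x - c) / d \<in> J" unfolding J_def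
        using lin[OF c d(1)] pl by (intro CollectI exI[of _ "[:-(c / d), 1 / d:]"]) simp
      then have "\<not> wle V ((x - c) / d) 1" using V(3) by blast
      then show ?thesis using V.le_mult_cancel[of d "(x - c) / d" 1] d(2) by simp
    qed
  qed (fact V(1))
qed

text \<open>
  Each increment \<open>d s\<close> exceeds in value the distances of \<open>a\<close> to its other conjugates, so that
  Krasner's lemma recovers \<open>a\<close> from every later approximation.
\<close>

lemma krasner_sequence:
  fixes K :: "'a::alg_closed_field set"
  assumes K: "is_subfield K" and K1: "is_subfield K1" "K \<subseteq> K1" and "\<forall>a\<in>K1. separable_over K a"
    and W: "valuation_subring W" and t: "t \<in> K" "t \<noteq> 0" "\<not> wle W t 1"
    and s: "\<And>n::nat. s n \<in> K1" "\<And>n. s n \<noteq> 0"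
  shows "\<exists>a. (\<forall>n. a n \<in> K1) \<and> (\<forall>n. \<exists>d\<in>K - {0}. a (Suc n) = a n + d * s n) \<and>
    (\<forall>n. \<not> wle W (a (Suc (Suc n)) - a (Suc n)) (a (Suc n) - a n)) \<and>
    (\<forall>n. \<exists>m. is_minpoly K (a n) m \<and> rsquarefree m \<and>
      (\<forall>b. poly m b = 0 \<longrightarrow> b \<noteq> a n \<longrightarrow> \<not> wle W (a (Suc n) - a n) (a n - b)))"
proof -
  interpret W: valuation_subring W by (fact W)
  have sep: "separable_over K a" if "a \<in> K1" for a using assms(4) that by blast
  \<comment> \<open>The state pairs an approximation with the increment that led to it, which the
    next increment must exceed. The start \<open>(0, 1)\<close> carries an arbitrary nonzero
    increment.\<close>
  define P where "P n z \<longleftrightarrow> fst z \<in> K1 \<and> snd z \<in> K1 \<and> snd z \<noteq> 0" for n :: nat and z :: "'a \<times> 'a"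
  define Q where "Q n z z' \<longleftrightarrow> fst z' = fst z + snd z' \<and> (\<exists>d\<in>K - {0}. snd z' = d * s n) \<and>
      \<not> wle W (snd z') (snd z) \<and> (\<exists>m. is_minpoly K (fst z) m \<and> rsquarefree m \<and>
        (\<forall>b. poly m b = 0 \<longrightarrow> b \<noteq> fst z \<longrightarrow> \<not> wle W (snd z') (fst z - b)))" for n and z z' :: "'a \<times> 'a"
  have algK1: "algebraic_over K a" if "a \<in> K1" for a
    using separable_imp_algebraic[OF sep[OF that]] .
  have AF: "is_subfield (alg_closure K)" using alg_closure_subfield[OF K] .
  have "\<exists>f. \<forall>n. P n (f n) \<and> Q n (f n) (f (Suc n))"
  proof (rule dependent_nat_choice)
    show "\<exists>z. P 0 z" unfolding P_def using is_subfieldD[OF K1(1)] by (intro exI[of _ "(0, 1)"]) auto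
    fix z n assume z: "P n z"
    obtain m where m: "is_minpoly K (fst z) m" "rsquarefree m"
      using sep z unfolding P_def separable_over_def by blast
    \<comment> \<open>Everything that the next increment must exceed in value; dividing by
      \<open>s n\<close> turns this into a condition on \<open>d \<in> K\<close>.\<close>
    let ?Y = "insert (snd z) ((\<lambda>b. fst z - b) ` {b. poly m b = 0 \<and> b \<noteq> fst z})"
    have "\<exists>d\<in>K - {0}. \<forall>y\<in>(\<lambda>y. y / s n) ` ?Y. \<not> wle W d y"
    proof (rule W.cofinal_finite[OF K t])
      show "finite ((\<lambda>y. y / s n) ` ?Y)"
        using poly_roots_finite[OF is_minpolyD(4)[OF m(1)]] by simp
      fix u assume "u \<in> (\<lambda>y. y / s n) ` ?Y"
      then obtain y where y: "y \<in> ?Y" "u = y / s n" by blast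
      have "y \<noteq> 0" using y(1) z unfolding P_def by auto
      moreover have "y \<in> alg_closure K"
      proof -
        have "fst z \<in> alg_closure K" "snd z \<in> alg_closure K"
          using z algK1 unfolding P_def alg_closure_def by blast+
        moreover have "b \<in> alg_closure K" if "poly m b = 0" for b
          using that is_minpolyD(1,4)[OF m(1)] unfolding alg_closure_def algebraic_over_def by blast
        ultimately show ?thesis using y(1) is_subfieldD(3)[OF AF] by blast
      qed
      moreover have "s n \<in> alg_closure K" using algK1 s(1) by (simp add: alg_closure_def)
      ultimately show "algebraic_over K u \<and> u \<noteq> 0"
        using is_subfieldD(8)[OF AF] s(2) y(2) by (simp add: alg_closure_def)
    qed
    then obtain d where d: "d \<in> K - {0}" "\<forall>y\<in>(\<lambda>y. y / s n) ` ?Y. \<not> wle W d y" by (rule bexE)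
    have big: "\<not> wle W (d * s n) y" if "y \<in> ?Y" for y
    proof -
      have "\<not> wle W d (y / s n)" using d(2) that by blast
      then show ?thesis using W.le_mult_cancel_right[of "s n" d "y / s n"] s(2) by simp
    qed
    have "d * s n \<in> K1" "d * s n \<noteq> 0" using d(1) K1 s is_subfieldD(5)[OF K1(1)] by auto
    then have "P (Suc n) (fst z + d * s n, d * s n)"
      unfolding P_def using z is_subfieldD(4)[OF K1(1)] unfolding P_def by simp
    moreover have "Q n z (fst z + d * s n, d * s n)"
      unfolding Q_def fst_conv snd_conv
    proof (intro conjI exI[of _ m] allI impI)
      show "\<exists>d'\<in>K - {0}. d * s n = d' * s n" using d(1) by blast
      show "\<not> wle W (d * s n) (snd z)" using big by blast
      show "\<not> wle W (d * s n) (fst z - b)" if "poly m b = 0" "b \<noteq> fst z" for b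
        using big that by blast
    qed (use m in simp_all)
    ultimately show "\<exists>z'. P (Suc n) z' \<and> Q n z z'" by blast
  qed
  then obtain f where f: "\<And>n. P n (f n)" "\<And>n. Q n (f n) (f (Suc n))" by blast
  define a where "a n = fst (f n)" for n
  have inc: "a (Suc n) - a n = snd (f (Suc n))" for n using f(2)[of n] unfolding Q_def a_def by simp
  show ?thesis
  proof (intro exI[of _ a] conjI allI)
    fix n
    show "a n \<in> K1" using f(1)[of n] unfolding P_def a_def by blast
    obtain d where "d \<in> K - {0}" "snd (f (Suc n)) = d * s n" using f(2)[of n] unfolding Q_def by blast
    then show "\<exists>d\<in>K - {0}. a (Suc n) = a n + d * s n" using inc[of n] by (metis add_diff_cancel_left' add.commute diff_add_cancel)
    show "\<not> wle W (a (Suc (Suc n)) - a (Suc n)) (a (Suc n) - a n)"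
      unfolding inc using f(2)[of "Suc n"] unfolding Q_def by blast
    show "\<exists>m. is_minpoly K (a n) m \<and> rsquarefree m \<and>
      (\<forall>b. poly m b = 0 \<longrightarrow> b \<noteq> a n \<longrightarrow> \<not> wle W (a (Suc n) - a n) (a n - b))"
      unfolding inc using f(2)[of n] unfolding Q_def a_def by blast
  qed
qed

lemma aut_over_adjoin:
  assumes t: "aut_over K \<tau>" and S: "\<And>a. a \<in> S \<Longrightarrow> \<tau> a = a"
  shows "aut_over (field_adjoin K S) \<tau>"
proof -
  have "is_subfield {a. \<tau> a = a}"
    using aut_overD[OF t] by (simp add: is_subfield_def)
  then have "field_adjoin K S \<subseteq> {a. \<tau> a = a}"
    using S aut_overD(5)[OF t] by (intro field_adjoin_least) auto
  then show ?thesis using t unfolding aut_over_def by blast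
qed

section \<open>Algebraic elements inside the algebraic closure of \<open>K(x)\<close>\<close>

locale transcendental_extension =
  fixes K :: "'a::alg_closed_field set" and x :: 'a
  assumes K: "is_subfield K" and x: "\<not> algebraic_over K x"
    and alg_Kx: "\<And>y. algebraic_over (field_adjoin K {x}) y"
begin

abbreviation "cl \<equiv> alg_closure K"

lemmas cl_field = alg_closure_subfield[OF K]
lemmas cl_root_closed = root_closed_alg_closure[OF K]

lemma K_cl: "K \<subseteq> cl" using alg_closure_incl[OF K] .

lemma ambient_adjoin:
  assumes "is_subfield H" "K \<subseteq> H" shows "ambient (field_adjoin H {x})"
proof
  show "is_subfield (field_adjoin H {x})" by (rule field_adjoin_subfield)
  have "field_adjoin K {x} \<subseteq> field_adjoin H {x}"
    using assms field_adjoin_incl(1)[of H "{x}"] field_adjoin_incl(2)[of "{x}" H]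
    by (intro field_adjoin_least) auto
  then show "algebraic_over (field_adjoin H {x}) y" for y using alg_Kx algebraic_over_mono by blast
qed

lemma adjoin_Int: "is_subfield H \<Longrightarrow> H \<subseteq> cl \<Longrightarrow> field_adjoin H {x} \<inter> cl = H"
  using field_adjoin_transcendental_Int[OF K x] .

lemma adjoin_cl: "a \<in> cl \<Longrightarrow> field_adjoin K {a} \<subseteq> cl"
  using cl_field K_cl by (intro field_adjoin_least) auto

text \<open>\<open>H\<close> is algebraically closed in \<open>H(x)\<close>, over which the whole
  type is algebraic, so the invariance of values over henselian fields applies to automorphisms over
  \<open>H(x)\<close>.\<close>

lemma aut_preserves:
  assumes V: "valuation_subring V" and H: "is_subfield H" "K \<subseteq> H" "H \<subseteq> cl" "hensel V H"
    and t: "aut_over (field_adjoin H {x}) \<tau>" and y: "y \<in> cl"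
  shows "y \<in> V \<longleftrightarrow> \<tau> y \<in> V"
proof -
  interpret ambient "field_adjoin H {x}" using ambient_adjoin H by blast
  interpret valuation_subring V by (fact V)
  interpret valued_ambient "field_adjoin H {x}" V ..
  have "alg_closure H = cl" using alg_closure_idem[OF K H(2,3)] .
  then show ?thesis
    using hensel_aut_preserves[OF H(1,4) field_adjoin_incl(1) _ t] adjoin_Int[OF H(1,3)] y by blast
qed

text \<open>Separability passes from \<open>K\<close> to \<open>H(x)\<close>, and \<open>b\<close>
  is not in \<open>H(x)\<close>, so some automorphism over \<open>H(x)\<close> moves it;
  henselianity of \<open>H\<close> controls its effect on values.\<close>

lemma separable_moved:
  assumes V: "valuation_subring V" and H: "is_subfield H" "K \<subseteq> H" "H \<subseteq> cl" "hensel V H"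
    and b: "separable_over K b" "b \<notin> H"
  shows "\<exists>\<tau>. aut_over H \<tau> \<and> (\<forall>y\<in>cl. y \<in> V \<longleftrightarrow> \<tau> y \<in> V) \<and> \<tau> b \<noteq> b"
proof -
  interpret ambient "field_adjoin H {x}" using ambient_adjoin H by blast
  have KF: "K \<subseteq> field_adjoin H {x}" using H field_adjoin_incl by blast
  obtain m where m: "is_minpoly K b m" "rsquarefree m" using b(1) unfolding separable_over_def by blast
  obtain n where n: "is_minpoly (field_adjoin H {x}) b n" using minpoly_exists[OF F alg] by blast
  obtain q where q: "m = q * n"
    using minpoly_divides[OF F n poly_over_mono[OF is_minpolyD(1)[OF m(1)] KF] is_minpolyD(3)[OF m(1)]] by blast
  have "rsquarefree n"
    using m(2) is_minpolyD(4)[OF n] unfolding rsquarefree_iff q by (auto simp: pderiv_mult)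
  moreover have "b \<notin> field_adjoin H {x}"
  proof -
    have "b \<in> cl" using is_minpolyD[OF m(1)] unfolding alg_closure_def algebraic_over_def by blast
    then show ?thesis using adjoin_Int[OF H(1,3)] b(2) by blast
  qed
  ultimately obtain \<tau> where "aut_over (field_adjoin H {x}) \<tau>" "\<tau> b \<noteq> b"
    using rsquarefree_fixed[OF n] by blast
  then show ?thesis
    using aut_preserves[OF V H] aut_over_mono[OF _ field_adjoin_incl(1)] by blast
qed

end

text \<open>\<open>W\<close> fixes the values of algebraic elements, while its behaviour at
  \<open>x\<close> is arbitrary; placing \<open>x\<close> produces a second ring that agrees with
  \<open>W\<close> on \<open>cl\<close>.\<close>

locale krasner_data = transcendental_extension K x + W: valuation_subring W
  for K :: "'a::alg_closed_field set" and x :: 'a and W :: "'a set" +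
  fixes K1 :: "'a set" and s a :: "nat \<Rightarrow> 'a"
  assumes K1: "is_subfield K1" "K \<subseteq> K1" and sep: "\<And>b. b \<in> K1 \<Longrightarrow> separable_over K b"
    and gen: "\<And>E. is_subfield E \<Longrightarrow> K \<subseteq> E \<Longrightarrow> range s \<subseteq> E \<Longrightarrow> K1 \<subseteq> E"
    and s: "\<And>n. s n \<in> K1"
    and a: "\<And>n. a n \<in> K1"
    and a_Suc: "\<And>n. \<exists>d\<in>K - {0}. a (Suc n) = a n + d * s n"
    and increasing: "\<And>n. \<not> wle W (a (Suc (Suc n)) - a (Suc n)) (a (Suc n) - a n)"
    and conj: "\<And>n. \<exists>m. is_minpoly K (a n) m \<and> rsquarefree m \<and>
      (\<forall>b. poly m b = 0 \<longrightarrow> b \<noteq> a n \<longrightarrow> \<not> wle W (a (Suc n) - a n) (a n - b))"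
begin

sublocale W: valued_closed W ..

definition e where "e n = a (Suc n) - a n"

lemma K1_cl: "K1 \<subseteq> cl"
  using sep separable_imp_algebraic by (auto simp: alg_closure_def)

lemma a_cl: "a n \<in> cl" using a K1_cl by blast

lemma e_cl: "e n \<in> cl" unfolding e_def using a_cl is_subfieldD(3)[OF cl_field] by blast

lemma e_mono: "i < j \<Longrightarrow> \<not> wle W (e j) (e i)"
proof (induction j)
  case (Suc j)
  have "\<not> wle W (e (Suc j)) (e j)" unfolding e_def by (rule increasing)
  then show ?case using Suc W.lt_trans by (cases "i = j") auto
qed simp

lemma e_nonzero: "e n \<noteq> 0"
  using e_mono[of n "Suc n"] by auto

text \<open>The increments increase strictly in value, so the first one decides the value of the
  telescoping sum.\<close>

lemma a_diff: "j < k \<Longrightarrow> wle W (a k - a j) (e j) \<and> wle W (e j) (a k - a j)"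
proof (induction k)
  case (Suc k)
  show ?case
  proof (cases "j = k")
    case False
    then have jk: "j < k" using Suc.prems by simp
    have "\<not> wle W (e k) (a k - a j)" using Suc.IH[OF jk] e_mono[OF jk] W.le_lt_trans by blast
    from W.dominant_add[OF this] have "wle W (a k - a j) (a k - a j + e k)" "wle W (a k - a j + e k) (a k - a j)" .
    moreover have "a k - a j + e k = a (Suc k) - a j" by (simp add: e_def)
    ultimately show ?thesis using Suc.IH[OF jk] W.le_trans by metis
  qed (simp add: e_def)
qed simp

text \<open>The distances between conjugates lie in \<open>cl\<close>, where \<open>V\<close> agrees
  with the \<open>W\<close> for which they were bounded, so Krasner's lemma applies with respect to
  \<open>V\<close>.\<close>

lemma recover:
  assumes V: "valuation_subring V" "V \<inter> cl = W \<inter> cl" and E: "is_subfield E" "hensel V E" "K \<subseteq> E" "y \<in> E"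
    and y: "wle V (e n) (y - a n)"
  shows "a n \<in> E"
proof -
  interpret V: valuation_subring V by (fact V(1))
  interpret V: valued_closed V ..
  obtain m where m: "is_minpoly K (a n) m" "rsquarefree m"
    "\<forall>b. poly m b = 0 \<longrightarrow> b \<noteq> a n \<longrightarrow> \<not> wle W (e n) (a n - b)"
    using conj[of n] unfolding e_def by blast
  show ?thesis
  proof (rule V.krasner[OF m(1,2) E])
    fix b assume b: "poly m b = 0" "b \<noteq> a n"
    have "b \<in> cl" using b(1) is_minpolyD(1,4)[OF m(1)] unfolding alg_closure_def algebraic_over_def by blast
    then have "a n - b \<in> cl" using a_cl is_subfieldD(3)[OF cl_field] by blast
    then have "\<not> wle V (e n) (a n - b)"
      using m(3) b wle_agree[OF cl_field V(2) e_cl _ V(1) W.valuation_subring_axioms] by blast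
    then show "\<not> wle V (y - a n) (a n - b)" using y V.le_trans by blast
  qed
qed

lemma s_mem: "is_subfield E \<Longrightarrow> K \<subseteq> E \<Longrightarrow> a n \<in> E \<Longrightarrow> a (Suc n) \<in> E \<Longrightarrow> s n \<in> E"
proof -
  assume E: "is_subfield E" "K \<subseteq> E" "a n \<in> E" "a (Suc n) \<in> E"
  obtain d where d: "d \<in> K - {0}" "a (Suc n) = a n + d * s n" using a_Suc by blast
  then have "s n = (a (Suc n) - a n) / d" by simp
  moreover have "a (Suc n) - a n \<in> E" using is_subfieldD(3)[OF E(1,4,3)] .
  moreover have "d \<in> E" using d(1) E(2) by blast
  ultimately show ?thesis using is_subfieldD(8)[OF E(1)] by simp
qed

abbreviation "Kh b \<equiv> hensel_hull W (field_adjoin K {b})"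

lemma Kh: "K \<subseteq> Kh b" "b \<in> Kh b" "is_subfield (Kh b)" "hensel W (Kh b)"
  using W.hensel_hull[of "field_adjoin K {b}"] field_adjoin_incl(1)[of K "{b}"] field_adjoin_incl(2)[of "{b}" K]
  by blast+

lemma hull_cl: "b \<in> cl \<Longrightarrow> Kh b \<subseteq> cl"
  using W.hensel_hull_root_closed[OF cl_root_closed adjoin_cl] .

lemma a_hull: "j \<le> k \<Longrightarrow> a j \<in> Kh (a k)"
  using recover[OF W.valuation_subring_axioms refl Kh(3,4,1,2)] a_diff[of j k] Kh(2)
  by (cases "j = k") auto

text \<open>The decomposition group over \<open>K(b)\<close>, acting on the whole type. Invariance
  is asked on \<open>cl\<close> only, as this is what henselianity supplies.\<close>

definition D where
  "D b = {\<tau>. aut_over (field_adjoin K {b}) \<tau> \<and> (\<forall>y\<in>cl. y \<in> W \<longleftrightarrow> \<tau> y \<in> W)}"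

lemma D_fixed:
  assumes "b \<in> cl" "\<tau> \<in> D b" "c \<in> Kh b" shows "\<tau> c = c"
  using W.hensel_hull_fixed[OF cl_root_closed _ adjoin_cl[OF assms(1)] _ assms(3)] assms(2)
  unfolding D_def by blast

lemma D_K: "\<tau> \<in> D b \<Longrightarrow> aut_over K \<tau>"
  unfolding D_def using aut_over_mono[OF _ field_adjoin_incl(1)] by blast

lemma aut_cl: "aut_over K \<tau> \<Longrightarrow> y \<in> cl \<Longrightarrow> \<tau> y \<in> cl"
  using aut_over_root unfolding alg_closure_def algebraic_over_def by blast

lemma D_antimono:
  assumes "j \<le> k" shows "D (a k) \<subseteq> D (a j)"
proof
  fix \<tau> assume t: "\<tau> \<in> D (a k)"
  have "\<tau> (a j) = a j" using D_fixed[OF a_cl t a_hull[OF assms]] .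
  then have "aut_over (field_adjoin K {a j}) \<tau>" using D_K[OF t] by (intro aut_over_adjoin) auto
  then show "\<tau> \<in> D (a j)" using t unfolding D_def by blast
qed

text \<open>
  An algebraic limit \<open>c\<close> would generate a henselization containing all \<open>a n\<close>. The orbits of \<open>c\<close>
  under the decomposition groups of the \<open>a n\<close> decrease and are finite, so they become stationary,
  and then so do the henselizations of the \<open>K(a n)\<close>.
\<close>

lemma no_algebraic_limit:
  assumes inf: "\<And>N. \<not> range s \<subseteq> Kh (a N)" and c: "c \<in> cl"
  shows "\<exists>j. \<not> wle W (e j) (c - a j)"
proof (rule ccontr)
  assume "\<not> ?thesis"
  then have lim: "wle W (e j) (c - a j)" for j by blast
  have ac: "a j \<in> Kh c" for j
    using recover[OF W.valuation_subring_axioms refl Kh(3,4,1,2) lim] .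
  define O' where "O' n = {\<tau> c | \<tau>. \<tau> \<in> D (a n)}" for n
  obtain p where p: "p \<noteq> 0" "poly_over K p" "poly p c = 0"
    using c unfolding alg_closure_def algebraic_over_def by blast
  have fin: "finite (O' n)" for n
  proof -
    have "O' n \<subseteq> {r. poly p r = 0}" unfolding O'_def using aut_over_root[OF D_K p(2,3)] by blast
    then show ?thesis using poly_roots_finite[OF p(1)] finite_subset by blast
  qed
  have dec: "O' k \<subseteq> O' j" if "j \<le> k" for j k unfolding O'_def using D_antimono[OF that] by blast
  obtain N where N: "\<And>k. card (O' N) \<le> card (O' k)"
    using ex_has_least_nat[of "\<lambda>_. True" _ "\<lambda>k. card (O' k)"] by blast
  have const: "O' k = O' N" if "N \<le> k" for k
    using card_seteq[OF fin dec[OF that] N] .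
  have "\<exists>k. a k \<notin> Kh (a N)"
  proof (rule ccontr)
    assume "\<not> ?thesis"
    then have "range s \<subseteq> Kh (a N)" using s_mem[OF Kh(3,1)] by blast
    then show False using inf by blast
  qed
  then obtain k where k: "a k \<notin> Kh (a N)" by blast
  then have Nk: "N \<le> k" using a_hull[of k N] by (meson nat_le_linear)
  obtain \<tau> where t: "aut_over (Kh (a N)) \<tau>" "\<forall>y\<in>cl. y \<in> W \<longleftrightarrow> \<tau> y \<in> W" "\<tau> (a k) \<noteq> a k"
    using separable_moved[OF W.valuation_subring_axioms Kh(3,1) hull_cl[OF a_cl] Kh(4) sep[OF a] k] by blast
  have "\<tau> \<in> D (a N)" unfolding D_def using t(1,2) aut_over_mono[OF t(1) W.hensel_hull(2)] by blast
  then have "\<tau> c \<in> O' N" unfolding O'_def by blast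
  then have "\<tau> c \<in> O' k" using const[OF Nk] by simp
  then obtain \<sigma> where sg: "\<sigma> \<in> D (a k)" "\<tau> c = \<sigma> c" unfolding O'_def by blast
  have tK: "aut_over K \<tau>" using aut_over_mono[OF t(1) Kh(1)] .
  have sK: "aut_over K \<sigma>" using D_K[OF sg(1)] .
  \<comment> \<open>Since \<open>\<sigma>\<close> and \<open>\<tau>\<close> agree at
    \<open>c\<close>, this composite lies in the decomposition group of \<open>c\<close> and fixes
    \<open>a k\<close>, an element of \<open>Kh c\<close>. As \<open>\<sigma>\<close> fixes
    \<open>a k\<close>, so does \<open>\<tau>\<close>.\<close>
  let ?r = "inv_into UNIV \<sigma> \<circ> \<tau>"
  have inv: "\<sigma> (inv_into UNIV \<sigma> y) = y" "inv_into UNIV \<sigma> (\<sigma> y) = y" for y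
    using aut_overD(1)[OF sK] by (auto simp: bij_is_surj surj_f_inv_f bij_is_inj)
  have rK: "aut_over K ?r" using aut_over_comp[OF aut_over_inv[OF sK] tK] .
  have "?r c = c" using sg(2) inv by simp
  then have "aut_over (field_adjoin K {c}) ?r" using rK by (intro aut_over_adjoin) auto
  moreover have "y \<in> W \<longleftrightarrow> ?r y \<in> W" if y: "y \<in> cl" for y
  proof -
    have "?r y \<in> cl" using aut_cl[OF rK y] .
    then have "?r y \<in> W \<longleftrightarrow> \<sigma> (?r y) \<in> W" using sg(1) unfolding D_def by blast
    then show ?thesis using t(2) y inv by simp
  qed
  ultimately have "?r \<in> D c" unfolding D_def by blast
  then have "?r (a k) = a k" using D_fixed[OF c _ ac] by blast
  then have "\<tau> (a k) = \<sigma> (a k)" using inv by (metis comp_apply)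
  moreover have "\<sigma> (a k) = a k" using D_fixed[OF a_cl sg(1) Kh(2)] .
  ultimately show False using t(3) by simp
qed

text \<open>
  Either some \<open>K(a N)\<close> already has the right henselization, and \<open>x\<close> is placed infinitely close to
  \<open>a N\<close>, or \<open>x\<close> becomes a limit of the sequence.
\<close>

lemma placement:
  shows "\<exists>V. valuation_subring V \<and> V \<inter> cl = W \<inter> cl \<and> K1 \<subseteq> hensel_hull V (field_adjoin K {x}) \<and>
    (\<forall>c\<in>cl. c \<in> K1 \<or> (\<exists>b\<in>K1. \<not> wle V (x - b) (b - c)))"
proof -
  obtain b where b: "\<And>k::nat. b k \<in> cl" and
    case1: "(\<exists>N. range s \<subseteq> Kh (a N) \<and> b = (\<lambda>_. a N)) \<or> (\<forall>N. \<not> range s \<subseteq> Kh (a N)) \<and> b = a"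
  proof (cases "\<exists>N. range s \<subseteq> Kh (a N)")
    case True
    then obtain N where "range s \<subseteq> Kh (a N)" by blast
    then show ?thesis using that[of "\<lambda>_. a N"] a_cl by blast
  next
    case False
    then show ?thesis using that[of a] a_cl by blast
  qed
  obtain V where V: "valuation_subring V" "V \<inter> cl = W \<inter> cl"
    and le': "\<forall>c d. c \<in> cl \<longrightarrow> d \<in> cl \<longrightarrow> d \<noteq> 0 \<longrightarrow>
      (\<forall>\<^sub>F k in sequentially. wle W d (b k - c)) \<longrightarrow> wle V d (x - c)"
    and lt': "\<forall>c d. c \<in> cl \<longrightarrow> d \<in> cl \<longrightarrow> d \<noteq> 0 \<longrightarrow>
      (\<forall>\<^sub>F k in sequentially. \<not> wle W (b k - c) d) \<longrightarrow> \<not> wle V (x - c) d"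
    using valuation_along_sequence[OF K x W.valuation_subring_axioms, of b, OF b]
    by (elim exE conjE) (rule that)
  have le: "wle V d (x - c)"
    if "c \<in> cl" "d \<in> cl" "d \<noteq> 0" "\<forall>\<^sub>F k in sequentially. wle W d (b k - c)" for c d
    using le'[rule_format, OF that] .
  have lt: "\<not> wle V (x - c) d"
    if "c \<in> cl" "d \<in> cl" "d \<noteq> 0" "\<forall>\<^sub>F k in sequentially. \<not> wle W (b k - c) d" for c d
    using lt'[rule_format, OF that] .
  interpret V: valuation_subring V by (fact V(1))
  interpret V: valued_closed V ..
  let ?E = "hensel_hull V (field_adjoin K {x})"
  have E: "is_subfield ?E" "hensel V ?E" "K \<subseteq> ?E" "x \<in> ?E"
    using V.hensel_hull[of "field_adjoin K {x}"] field_adjoin_incl(1)[of K "{x}"] field_adjoin_incl(2)[of "{x}" K]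
    by blast+
  from case1 have "range s \<subseteq> ?E \<and> (\<forall>c\<in>cl. c \<in> K1 \<or> (\<exists>b\<in>K1. \<not> wle V (x - b) (b - c)))"
  proof
    assume "\<exists>N. range s \<subseteq> Kh (a N) \<and> b = (\<lambda>_. a N)"
    then obtain N where N: "range s \<subseteq> Kh (a N)" "b = (\<lambda>_. a N)" by blast
    \<comment> \<open>Along the constant sequence the difference from \<open>a N\<close> is
      \<open>0\<close>, whose value exceeds that of every nonzero element.\<close>
    have close: "\<not> wle V (x - a N) (a N - c)" if "c \<in> cl" "c \<noteq> a N" for c
      using lt[OF a_cl, of "a N - c" N] that is_subfieldD(3)[OF cl_field a_cl] unfolding N(2) by simp
    have "wle V (e N) (x - a N)"
    proof -
      have "a N - (a N - e N) = e N" by simp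
      moreover have "a N - e N \<in> cl" using a_cl e_cl is_subfieldD(3)[OF cl_field] by blast
      ultimately show ?thesis using close[of "a N - e N"] e_nonzero[of N] V.lt_imp_le by fastforce
    qed
    then have aN: "a N \<in> ?E" using recover[OF V E] by blast
    \<comment> \<open>\<open>?E\<close> is henselian for \<open>V\<close>, but
      \<open>Kh (a N)\<close> is formed with \<open>W\<close>; cutting down to \<open>cl\<close>,
      where the two agree, bridges the difference.\<close>
    let ?E' = "\<Inter>{?E, cl}"
    have E': "is_subfield ?E'" using is_subfield_Int[OF E(1) cl_field] by simp
    have "hensel V ?E'"
      using E(2) V.hensel_root_closed[OF cl_root_closed] by (intro V.hensel_Inter) auto
    then have "hensel W ?E'"
      using hensel_cong[OF E' _ V(1) W.valuation_subring_axioms] V(2) by blast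
    moreover have "field_adjoin K {a N} \<subseteq> ?E'"
      using aN a_cl E(3) K_cl E' by (intro field_adjoin_least) auto
    ultimately have "Kh (a N) \<subseteq> ?E'" using W.hensel_hull_least E' by blast
    then have "range s \<subseteq> ?E" using N(1) by blast
    then show ?thesis using close a by blast
  next
    assume "(\<forall>N. \<not> range s \<subseteq> Kh (a N)) \<and> b = a"
    then have inf: "\<And>N. \<not> range s \<subseteq> Kh (a N)" and ba: "b = a" by blast+
    have near: "wle V (e j) (x - a j)" for j
    proof (rule le[OF a_cl e_cl e_nonzero])
      show "\<forall>\<^sub>F k in sequentially. wle W (e j) (b k - a j)"
        using eventually_gt_at_top[of j] unfolding ba by eventually_elim (use a_diff in blast)
    qed
    then have "a j \<in> ?E" for j using recover[OF V E] by blast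
    then have "range s \<subseteq> ?E" using s_mem[OF E(1,3)] by blast
    \<comment> \<open>As \<open>c\<close> is no limit, some \<open>a j - c\<close> has smaller value
      than \<open>e j\<close>, whereas \<open>x - a j\<close> has at least that value.\<close>
    moreover have "\<exists>b\<in>K1. \<not> wle V (x - b) (b - c)" if c: "c \<in> cl" for c
    proof -
      obtain j where j: "\<not> wle W (e j) (c - a j)" using no_algebraic_limit[OF inf c] by blast
      have "c - a j \<in> cl" using c a_cl is_subfieldD(3)[OF cl_field] by blast
      then have "\<not> wle V (e j) (c - a j)"
        using j wle_agree[OF cl_field V(2) e_cl _ V(1) W.valuation_subring_axioms] by blast
      then have "\<not> wle V (e j) (a j - c)" using V.le_minus_commute by blast
      then show ?thesis using near[of j] a[of j] V.le_trans by blast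
    qed
    ultimately show ?thesis by blast
  qed
  then show ?thesis using V gen[OF E(1,3)] by blast
qed

end

section \<open>The implicit constant field\<close>

context transcendental_extension
begin

text \<open>One inclusion is minimality of the hull, by \<open>incl\<close>. For the other,
  algebraic elements of \<open>K(x)^h\<close> are compared with \<open>H(x)\<close>, where
  \<open>H\<close> is the hull of \<open>K1\<close>: its only elements in \<open>cl\<close> are
  those of \<open>H\<close>.\<close>

lemma implicit_constants:
  assumes V: "valuation_subring V" and K1: "is_subfield K1" "K \<subseteq> K1" "K1 \<subseteq> cl"
    and incl: "K1 \<subseteq> hensel_hull V (field_adjoin K {x})"
    and near: "\<And>c. c \<in> cl \<Longrightarrow> c \<in> K1 \<or> (\<exists>b\<in>K1. \<not> wle V (x - b) (b - c))"
  shows "hensel_hull V K1 = relative_algebraic_closure K (hensel_hull V (field_adjoin K {x}))"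
proof -
  interpret valuation_subring V by (fact V)
  interpret V: valued_closed V ..
  let ?E = "hensel_hull V (field_adjoin K {x})"
  let ?H = "hensel_hull V K1"
  let ?F = "field_adjoin ?H {x}"
  have E: "is_subfield ?E" using V.hensel_hull by blast
  have H: "is_subfield ?H" "K \<subseteq> ?H" "?H \<subseteq> cl" "hensel V ?H"
    using V.hensel_hull[of K1] K1(2) V.hensel_hull_root_closed[OF cl_root_closed K1(3)] by blast+
  have rel: "relative_algebraic_closure K ?E = ?E \<inter> cl"
    unfolding relative_algebraic_closure_def alg_closure_def by blast
  have FI: "?F \<inter> cl = ?H" using adjoin_Int[OF H(1,3)] .
  interpret A: ambient ?F using ambient_adjoin[OF H(1,2)] .
  have KxF: "field_adjoin K {x} \<subseteq> ?F"
    using H(2) field_adjoin_incl(1)[of ?H "{x}"] field_adjoin_incl(2)[of "{x}" ?H]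
    by (intro field_adjoin_least) auto
  have fixed: "\<tau> c = c" if c: "c \<in> ?E" "c \<in> cl" and t: "aut_over ?F \<tau>" for c \<tau>
  proof -
    note tau = aut_overD[OF t]
    have xF: "x \<in> ?F" using field_adjoin_incl(2)[of "{x}" ?H] by blast
    have HF: "?H \<subseteq> ?F" using field_adjoin_incl(1) .
    interpret B: valued_ambient ?F V ..
    have tcl: "\<tau> y \<in> cl" if "y \<in> cl" for y
      using that aut_over_root[OF aut_over_mono[OF t]] HF H(2) unfolding alg_closure_def algebraic_over_def by blast
    have pres: "y \<in> V \<longleftrightarrow> \<tau> y \<in> V" if "y \<in> cl" for y using aut_preserves[OF V H t that] .
    have le_iff_cl: "y \<preceq> z \<longleftrightarrow> \<tau> y \<preceq> \<tau> z" if "y \<in> cl" "z \<in> cl" for y z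
      using pres[OF is_subfieldD(8)[OF cl_field that(2,1)]] le_iff[of y z] le_iff[of "\<tau> y" "\<tau> z"] tau(12,13)
      by (cases "y = 0") (simp_all add: tau(6,13))
    \<comment> \<open>Invariance of a value under \<open>\<tau>\<close>. Being multiplicative, it
      reduces for polynomials in \<open>x\<close> over \<open>cl\<close> to the linear
      factors.\<close>
    define sim where "sim y \<longleftrightarrow> y \<preceq> \<tau> y \<and> \<tau> y \<preceq> y" for y
    have sim_mult: "sim (y * z)" if "sim y" "sim z" for y z
      using that unfolding sim_def by (simp add: tau le_mult)
    have "alg_closure ?H = cl" using alg_closure_idem[OF K H(2,3)] .
    then have sim_cl: "sim y" if "y \<in> cl" for y
    proof (cases "y = 0")
      case False
      have "\<tau> y \<preceq> y"
        using B.hensel_aut_le[OF H(1,4) HF _ aut_over_inv[OF t], of "\<tau> y"] tcl[OF that] False tau(2,13)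
          FI \<open>alg_closure ?H = cl\<close> by simp
      moreover have "y \<preceq> \<tau> y"
        using B.hensel_aut_le[OF H(1,4) HF _ t, of y] that False FI \<open>alg_closure ?H = cl\<close> by simp
      ultimately show ?thesis unfolding sim_def by blast
    qed (simp add: sim_def tau)
    have sim_x: "sim (x - c)" if c: "c \<in> cl" for c
    proof (cases "c \<in> K1")
      case True
      then have "c \<in> ?F" using V.hensel_hull(2) HF by blast
      then show ?thesis unfolding sim_def using tau xF by simp
    next
      case False
      then obtain b where b: "b \<in> K1" "b - c \<prec> x - b" using near[OF c] by blast
      have bF: "\<tau> b = b" "\<tau> x = x" using b(1) V.hensel_hull(2) HF xF tau(5) by blast+
      have bcl: "b - c \<in> cl" using b(1) K1(3) c is_subfieldD(3)[OF cl_field] by blast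
      have s: "sim (b - c)" using sim_cl[OF bcl] .
      \<comment> \<open>The fixed element \<open>x - b\<close> is dominated both by
        \<open>b - c\<close> and by its image, so \<open>x - c\<close> and
        \<open>\<tau> (x - c)\<close> both have the value of \<open>b - c\<close>.\<close>
      have t1: "\<tau> (b - c) \<prec> x - b" using s b(2) le_lt_trans unfolding sim_def by blast
      have eq: "x - c = (b - c) + (x - b)" "\<tau> (x - c) = \<tau> (b - c) + (x - b)"
        using tau bF by simp_all
      have "x - c \<preceq> b - c" "b - c \<preceq> x - c" "\<tau> (x - c) \<preceq> \<tau> (b - c)" "\<tau> (b - c) \<preceq> \<tau> (x - c)"
        using dominant_add[OF b(2), folded eq(1)] dominant_add[OF t1, folded eq(2)] by blast+
      then show ?thesis using s le_trans unfolding sim_def by blast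
    qed
    have sim_poly: "sim (poly p x)" if "poly_over cl p" for p
      using that
    proof (induction "degree p" arbitrary: p)
      case 0
      then obtain c where "p = [:c:]" by (metis degree_eq_zeroE)
      then show ?case using sim_cl poly_overD[OF 0(2), of 0] by simp
    next
      case (Suc n)
      obtain r where r: "poly p r = 0" using alg_closed_imp_poly_has_root[of p] Suc.hyps(2) by auto
      have "p \<noteq> 0" using Suc.hyps(2) by auto
      then have rcl: "r \<in> cl" using alg_closure_root[OF K Suc.prems _ r] by blast
      let ?q = "synthetic_div p r"
      have "poly p x = (x - r) * poly ?q x"
        using arg_cong[OF synthetic_div_correct'[of r p], of "\<lambda>p. poly p x"] r by (simp add: algebra_simps)
      moreover have "sim (poly ?q x)"
        using Suc.hyps(1)[of ?q] Suc.hyps(2) poly_over_synthetic_div[OF subfield_imp_subring[OF cl_field] Suc.prems rcl]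
        by (simp add: degree_synthetic_div)
      ultimately show ?case using sim_mult[OF sim_x[OF rcl]] by simp
    qed
    let ?L = "field_adjoin cl {x}"
    have presL: "y \<in> V \<longleftrightarrow> \<tau> y \<in> V" if y: "y \<in> ?L" for y
    proof -
      obtain p q where pq: "poly_over cl p" "poly_over cl q" "y = poly p x / poly q x"
        using y unfolding field_adjoin_single[OF cl_field] by blast
      show ?thesis
      proof (cases "poly q x = 0")
        case True
        then show ?thesis using pq(3) tau(6) by simp
      next
        case False
        have "y \<in> V \<longleftrightarrow> poly q x \<preceq> poly p x" unfolding pq(3) using le_iff[OF False] by simp
        also have "\<dots> \<longleftrightarrow> \<tau> (poly q x) \<preceq> \<tau> (poly p x)"
          using sim_poly[OF pq(1)] sim_poly[OF pq(2)] le_trans unfolding sim_def by blast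
        also have "\<dots> \<longleftrightarrow> \<tau> y \<in> V"
          unfolding pq(3) using le_iff[of "\<tau> (poly q x)"] False tau by simp
        finally show ?thesis .
      qed
    qed
    interpret C: ambient "field_adjoin K {x}" using ambient_adjoin[OF K] by blast
    interpret C: valued_ambient "field_adjoin K {x}" V ..
    \<comment> \<open>Outside \<open>cl(x)\<close> nothing is known about the values of
      \<open>\<tau>\<close>, so only this restriction is kept and extended anew over
      \<open>K(x)\<close>.\<close>
    let ?G = "{(y, \<tau> y) | y. y \<in> ?L}"
    have KL: "field_adjoin K {x} \<subseteq> ?L"
      using K_cl field_adjoin_incl(1)[of cl "{x}"] field_adjoin_incl(2)[of "{x}" cl]
      by (intro field_adjoin_least) auto
    have "emb (field_adjoin K {x}) ?G"
      unfolding emb_def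
    proof (intro conjI ballI allI impI)
      show "(y, y) \<in> ?G" if "y \<in> field_adjoin K {x}" for y
        using that KL KxF tau(5)[of y] by force
      fix y z y' z' assume "(y, y') \<in> ?G" "(z, z') \<in> ?G"
      then show "(y - z, y' - z') \<in> ?G" "(y * z, y' * z') \<in> ?G"
        using tau is_subfieldD(3,5)[OF field_adjoin_subfield, of _ cl "{x}"] by auto
    qed (auto simp: tau)
    then obtain \<sigma> where sg: "aut_over (field_adjoin K {x}) \<sigma>" "\<forall>y z. (y, z) \<in> ?G \<longrightarrow> \<sigma> y = z"
      "\<forall>y. y \<in> V \<longleftrightarrow> \<sigma> y \<in> V"
      using C.preserving_extension[of ?G] presL by blast
    have "\<sigma> c = c"
      using V.hensel_hull_fixed[OF root_closed_UNIV sg(1) _ _ c(1)] sg(3) by blast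
    moreover have "(c, \<tau> c) \<in> ?G" using c(2) field_adjoin_incl(1)[of cl "{x}"] by blast
    then have "\<sigma> c = \<tau> c" using sg(2)[rule_format] by simp
    ultimately show ?thesis by simp
  qed
  have "?E \<inter> cl \<subseteq> ?H"
  proof
    fix c assume c: "c \<in> ?E \<inter> cl"
    let ?p = "CHAR('a)"
    obtain k where k: "?p > 0 \<or> k = 0" "c ^ ?p ^ k \<in> ?F"
      using A.fixed_imp_power_mem[of c] fixed c by blast
    have "c ^ ?p ^ k \<in> ?H" using k(2) c FI is_subfieldD(9)[OF cl_field] by blast
    with k(1) show "c \<in> ?H"
    proof (induction k)
      case (Suc k)
      then have p: "?p > 0" by simp
      let ?d = "c ^ ?p ^ k"
      \<comment> \<open>One \<open>p\<close>-th root is taken at a time. A field closed under simple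
        roots that contains \<open>H(x)\<close> but not \<open>?d\<close> is henselian, hence
        contains \<open>?E\<close> and with it \<open>?d\<close>.\<close>
      have "?d \<in> ?H"
      proof (rule ccontr)
        assume "?d \<notin> ?H"
        moreover have d: "?d \<in> ?E" "?d \<in> cl"
          using c is_subfieldD(9)[OF E] is_subfieldD(9)[OF cl_field] by blast+
        ultimately have "?d \<notin> ?F" using FI by blast
        moreover have "?d ^ ?p \<in> ?F"
          using Suc.prems(2) field_adjoin_incl(1)[of ?H "{x}"] by (simp add: power_mult[symmetric] mult.commute subset_iff)
        ultimately obtain M where M: "is_subfield M" "?F \<subseteq> M" "?d \<notin> M" "simple_root_closed M"
          using inseparable_avoids_simple_roots[OF A.F _ _ p] by blast
        have "?E \<subseteq> M"
          using M(1,2) KxF V.hensel_simple_root_closed[OF M(4)] by (intro V.hensel_hull_least) auto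
        then show False using d(1) M(3) by blast
      qed
      then show ?case using Suc.IH p by blast
    qed simp
  qed
  moreover have "?H \<subseteq> ?E \<inter> cl" using V.hensel_hull_mono[OF incl] H(3) by blast
  ultimately show ?thesis unfolding rel by blast
qed

end

section \<open>Valuations and valuation rings\<close>

definition value_class :: "'a::field set \<Rightarrow> 'a \<Rightarrow> 'a set" where
  "value_class V a = {b. wle V a b \<and> wle V b a}"

text \<open>A value is the class of all elements having it, so the group lives on
  \<open>'a set\<close> whatever the type of the given value group. The class of \<open>0\<close>
  stays outside the carrier.\<close>

definition class_group :: "'a::field set \<Rightarrow> 'a set value_group" where
  "class_group V = \<lparr>carrier = value_class V ` (UNIV - {0}),
     monoid.mult = (\<lambda>A B. {c. \<exists>a\<in>A. \<exists>b\<in>B. wle V (a * b) c \<and> wle V c (a * b)}),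
     one = value_class V 1, vle = (\<lambda>A B. \<exists>a\<in>A. \<exists>b\<in>B. wle V a b)\<rparr>"

context valuation_subring
begin

lemma value_class_eq_iff: "value_class V a = value_class V b \<longleftrightarrow> a \<preceq> b \<and> b \<preceq> a"
proof
  assume "value_class V a = value_class V b"
  moreover have "a \<in> value_class V a" by (simp add: value_class_def)
  ultimately show "a \<preceq> b \<and> b \<preceq> a" by (simp add: value_class_def)
next
  assume "a \<preceq> b \<and> b \<preceq> a"
  then show "value_class V a = value_class V b"
    unfolding value_class_def using le_trans by blast
qed

lemma class_group_simps:
  "carrier (class_group V) = value_class V ` (UNIV - {0})"
  "\<one>\<^bsub>class_group V\<^esub> = value_class V 1"
  "value_class V a \<otimes>\<^bsub>class_group V\<^esub> value_class V b = value_class V (a * b)"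
  "vle (class_group V) (value_class V a) (value_class V b) \<longleftrightarrow> a \<preceq> b"
proof -
  have self: "c \<in> value_class V c" for c by (simp add: value_class_def)
  show "value_class V a \<otimes>\<^bsub>class_group V\<^esub> value_class V b = value_class V (a * b)"
  proof (intro equalityI subsetI)
    fix c assume "c \<in> value_class V a \<otimes>\<^bsub>class_group V\<^esub> value_class V b"
    then obtain a' b' where ab: "a' \<in> value_class V a" "b' \<in> value_class V b" "a' * b' \<preceq> c" "c \<preceq> a' * b'"
      unfolding class_group_def by auto
    then have "a * b \<preceq> a' * b'" "a' * b' \<preceq> a * b" unfolding value_class_def by (simp_all add: le_mult)
    then show "c \<in> value_class V (a * b)" unfolding value_class_def using ab(3,4) le_trans by blast
  next
    fix c assume "c \<in> value_class V (a * b)"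
    then show "c \<in> value_class V a \<otimes>\<^bsub>class_group V\<^esub> value_class V b"
      using self[of a] self[of b] unfolding class_group_def value_class_def[of V "a * b"] by auto
  qed
  show "vle (class_group V) (value_class V a) (value_class V b) \<longleftrightarrow> a \<preceq> b"
  proof
    assume "vle (class_group V) (value_class V a) (value_class V b)"
    then obtain a' b' where "a' \<in> value_class V a" "b' \<in> value_class V b" "a' \<preceq> b'"
      unfolding class_group_def by auto
    then show "a \<preceq> b" unfolding value_class_def using le_trans by blast
  next
    assume "a \<preceq> b"
    then show "vle (class_group V) (value_class V a) (value_class V b)"
      using self unfolding class_group_def by auto
  qed
qed (simp_all add: class_group_def)

lemma ordered_class_group: "ordered_value_group (class_group V)"
proof -
  have "comm_group (class_group V)"
  proof (rule comm_groupI)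
    fix A assume "A \<in> carrier (class_group V)"
    then obtain a where a: "a \<noteq> 0" "A = value_class V a" by (auto simp: class_group_simps)
    show "\<exists>B\<in>carrier (class_group V). B \<otimes>\<^bsub>class_group V\<^esub> A = \<one>\<^bsub>class_group V\<^esub>"
      using a by (intro bexI[of _ "value_class V (inverse a)"]) (auto simp: class_group_simps)
  qed (auto simp: class_group_simps ac_simps)
  then interpret comm_group "class_group V" .
  show ?thesis
  proof
    fix A B C assume "A \<in> carrier (class_group V)" "B \<in> carrier (class_group V)"
    then obtain a b where ab: "a \<noteq> 0" "A = value_class V a" "b \<noteq> 0" "B = value_class V b"
      by (auto simp: class_group_simps)
    show "vle (class_group V) A B \<Longrightarrow> vle (class_group V) B A \<Longrightarrow> A = B"
      using ab by (simp add: class_group_simps value_class_eq_iff)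
    show "vle (class_group V) A B \<or> vle (class_group V) B A"
      using ab le_total by (simp add: class_group_simps)
    assume "C \<in> carrier (class_group V)"
    then obtain c where c: "c \<noteq> 0" "C = value_class V c" by (auto simp: class_group_simps)
    show "vle (class_group V) A B \<Longrightarrow> vle (class_group V) B C \<Longrightarrow> vle (class_group V) A C"
      using ab c le_trans by (auto simp: class_group_simps)
    show "vle (class_group V) A B \<Longrightarrow>
        vle (class_group V) (A \<otimes>\<^bsub>class_group V\<^esub> C) (B \<otimes>\<^bsub>class_group V\<^esub> C)"
      using ab c by (simp add: class_group_simps)
  qed
qed

lemma valuation_on_value_class: "valuation_on UNIV (class_group V) (value_class V)"
proof -
  have "a \<preceq> a + b \<or> b \<preceq> a + b" for a b
    using le_total[of a b] le_add[of a a b] le_add[of b a b] by auto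
  then show ?thesis
    unfolding valuation_on_def using ordered_class_group by (simp add: class_group_simps)
qed

lemma henselian_iff_hensel:
  assumes F: "is_subfield F"
  shows "henselian F (class_group V) (value_class V) \<longleftrightarrow> hensel V F"
proof -
  let ?\<Gamma> = "class_group V" and ?v = "value_class V"
  have ring: "valuation_ring F ?\<Gamma> ?v = F \<inter> V"
    unfolding valuation_ring_def by (auto simp: class_group_simps mem_iff)
  have ideal: "valuation_ideal F ?\<Gamma> ?v = {a \<in> F. 1 \<prec> a}"
    unfolding valuation_ideal_def using le_total by (auto simp: class_group_simps value_class_eq_iff)
  have key: "poly f a \<in> F \<and> (poly (pderiv f) a \<noteq> 0 \<and> ?v (poly (pderiv f) a) = \<one>\<^bsub>?\<Gamma>\<^esub> \<longleftrightarrow> poly (pderiv f) a \<preceq> 1)"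
    if f: "\<forall>i. coeff f i \<in> F \<inter> V" and a: "a \<in> F \<inter> V" for f a
  proof
    have "poly_over F f" "poly_over V f" using f by (auto simp: poly_over_def)
    then show "poly f a \<in> F" using a poly_in_subring[OF subfield_imp_subring[OF F]] by blast
    have "1 \<preceq> poly (pderiv f) a"
      using a poly_in_subring[OF subring poly_over_pderiv[OF subring \<open>poly_over V f\<close>], of a]
      unfolding mem_iff[symmetric] by blast
    then show "poly (pderiv f) a \<noteq> 0 \<and> ?v (poly (pderiv f) a) = \<one>\<^bsub>?\<Gamma>\<^esub> \<longleftrightarrow> poly (pderiv f) a \<preceq> 1"
      by (auto simp: class_group_simps value_class_eq_iff)
  qed
  have diff: "b - a \<in> F" if "a \<in> F \<inter> V" "b \<in> F \<inter> V" for a b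
    using that is_subfieldD(3)[OF F] by blast
  show ?thesis
    unfolding henselian_def hensel_def ring ideal poly_over_def
  proof (intro iff_allI, goal_cases)
    case (1 f a)
    show ?case
    proof (cases "(\<forall>i. coeff f i \<in> F \<inter> V) \<and> a \<in> F \<inter> V")
      case True
      then have "poly f a \<in> F" and
        "poly (pderiv f) a \<noteq> 0 \<and> ?v (poly (pderiv f) a) = \<one>\<^bsub>?\<Gamma>\<^esub> \<longleftrightarrow> poly (pderiv f) a \<preceq> 1"
        and "\<And>b. b \<in> F \<inter> V \<Longrightarrow> b - a \<in> F"
        using key diff by blast+
      then show ?thesis using True by auto
    qed blast
  qed
qed

end

lemma henselization_eq_hull:
  fixes L :: "'a::alg_closed_field set"
  assumes "valuation_subring U"
  shows "henselization (class_group U) (value_class U) L = hensel_hull U L"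
  unfolding henselization_def hensel_hull_def
  using valuation_subring.henselian_iff_hensel[OF assms] by (metis (lifting))

section \<open>From a Krull valuation on a subfield to valuation rings and back\<close>

locale valued_field =
  fixes F :: "'a::field set" and \<Gamma> :: "'g value_group" and v :: "'a \<Rightarrow> 'g"
  assumes val: "valuation_on F \<Gamma> v"
begin

lemma F: "is_subfield F" and ovg: "ordered_value_group \<Gamma>"
  using val unfolding valuation_on_def by blast+

sublocale G: ordered_value_group \<Gamma> by (rule ovg)

lemma image: "v ` (F - {0}) = carrier \<Gamma>"
  using val unfolding valuation_on_def by blast

lemma v_closed: "a \<in> F \<Longrightarrow> a \<noteq> 0 \<Longrightarrow> v a \<in> carrier \<Gamma>"
  using image by blast

lemma v_mult: "a \<in> F \<Longrightarrow> a \<noteq> 0 \<Longrightarrow> b \<in> F \<Longrightarrow> b \<noteq> 0 \<Longrightarrow> v (a * b) = v a \<otimes>\<^bsub>\<Gamma>\<^esub> v b"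
  and v_add: "a \<in> F \<Longrightarrow> a \<noteq> 0 \<Longrightarrow> b \<in> F \<Longrightarrow> b \<noteq> 0 \<Longrightarrow> a + b \<noteq> 0 \<Longrightarrow>
    vle \<Gamma> (v a) (v (a + b)) \<or> vle \<Gamma> (v b) (v (a + b))"
  using val unfolding valuation_on_def by blast+

lemma v_1: "v 1 = \<one>\<^bsub>\<Gamma>\<^esub>"
  using v_mult[of 1 1] v_closed[of 1] is_subfieldD(1)[OF F] G.l_cancel_one'[of "v 1" "v 1"] by simp

lemma vle_iff:
  assumes "a \<in> F" "a \<noteq> 0" "b \<in> F" "b \<noteq> 0"
  shows "vle \<Gamma> (v a) (v b) \<longleftrightarrow> vle \<Gamma> \<one>\<^bsub>\<Gamma>\<^esub> (v (b / a))"
proof -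
  have ia: "inverse a \<in> F" "inverse a \<noteq> 0" "b / a \<in> F" "b / a \<noteq> 0"
    using assms is_subfieldD[OF F] by auto
  have "v a \<otimes>\<^bsub>\<Gamma>\<^esub> v (inverse a) = \<one>\<^bsub>\<Gamma>\<^esub>" "v b \<otimes>\<^bsub>\<Gamma>\<^esub> v (inverse a) = v (b / a)"
    using v_mult[OF assms(1,2) ia(1,2)] v_mult[OF assms(3,4) ia(1,2)] assms v_1 by (simp_all add: divide_inverse)
  moreover have "v (b / a) \<otimes>\<^bsub>\<Gamma>\<^esub> v a = v b" using v_mult[OF ia(3,4) assms(1,2)] assms by simp
  ultimately show ?thesis
    using G.vle_mult[of "v a" "v b" "v (inverse a)"] G.vle_mult[of "\<one>\<^bsub>\<Gamma>\<^esub>" "v (b / a)" "v a"]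
      v_closed assms ia by force
qed

abbreviation "R \<equiv> valuation_ring F \<Gamma> v"
abbreviation "M \<equiv> valuation_ideal F \<Gamma> v"

lemma v_minus_1: "v (- 1) = \<one>\<^bsub>\<Gamma>\<^esub>"
proof -
  have m: "- 1 \<in> F" "v (- 1) \<in> carrier \<Gamma>" using is_subfieldD[OF F] v_closed[of "- 1"] by auto
  have sq: "v (- 1) \<otimes>\<^bsub>\<Gamma>\<^esub> v (- 1) = \<one>\<^bsub>\<Gamma>\<^esub>" using v_mult[of "- 1" "- 1"] m v_1 by simp
  have "vle \<Gamma> \<one>\<^bsub>\<Gamma>\<^esub> (v (- 1)) \<or> vle \<Gamma> (v (- 1)) \<one>\<^bsub>\<Gamma>\<^esub>" using G.vle_total m by blast
  then show ?thesis
    using G.vle_mult[of "\<one>\<^bsub>\<Gamma>\<^esub>" "v (- 1)" "v (- 1)"] G.vle_mult[of "v (- 1)" "\<one>\<^bsub>\<Gamma>\<^esub>" "v (- 1)"]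
      G.vle_antisym m sq by force
qed

lemma v_uminus: "a \<in> F \<Longrightarrow> v (- a) = v a"
  using v_mult[of "- 1" a] v_minus_1 v_closed[of a] is_subfieldD[OF F] by (cases "a = 0") auto

lemma ring_add: "a \<in> R \<Longrightarrow> b \<in> R \<Longrightarrow> a + b \<in> R"
proof -
  assume ab: "a \<in> R" "b \<in> R"
  then have F': "a \<in> F" "b \<in> F" "a + b \<in> F" using is_subfieldD(4)[OF F] unfolding valuation_ring_def by auto
  show ?thesis
  proof (cases "a = 0 \<or> b = 0 \<or> a + b = 0")
    case False
    then have "vle \<Gamma> \<one>\<^bsub>\<Gamma>\<^esub> (v a)" "vle \<Gamma> \<one>\<^bsub>\<Gamma>\<^esub> (v b)" using ab unfolding valuation_ring_def by auto
    then have "vle \<Gamma> \<one>\<^bsub>\<Gamma>\<^esub> (v (a + b))"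
      using v_add[of a b] G.vle_trans[of "\<one>\<^bsub>\<Gamma>\<^esub>" _ "v (a + b)"] v_closed F' False by blast
    then show ?thesis using F' unfolding valuation_ring_def by blast
  qed (use ab F' in \<open>auto simp: valuation_ring_def\<close>)
qed

lemma ring_mult_ge: "a \<in> R \<Longrightarrow> a \<noteq> 0 \<Longrightarrow> b \<in> F \<Longrightarrow> b \<noteq> 0 \<Longrightarrow> vle \<Gamma> (v b) (v (a * b))"
  using G.vle_mult[of "\<one>\<^bsub>\<Gamma>\<^esub>" "v a" "v b"] v_mult[of a b] v_closed unfolding valuation_ring_def by auto

lemma ring_mult: "a \<in> R \<Longrightarrow> b \<in> R \<Longrightarrow> a * b \<in> R"
proof -
  assume ab: "a \<in> R" "b \<in> R"
  then have F': "a \<in> F" "b \<in> F" "a * b \<in> F" using is_subfieldD(5)[OF F] unfolding valuation_ring_def by auto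
  show ?thesis
  proof (cases "a = 0 \<or> b = 0")
    case False
    then have "vle \<Gamma> (v b) (v (a * b))" using ring_mult_ge ab(1) F' by blast
    moreover have "vle \<Gamma> \<one>\<^bsub>\<Gamma>\<^esub> (v b)" using ab False unfolding valuation_ring_def by auto
    ultimately have "vle \<Gamma> \<one>\<^bsub>\<Gamma>\<^esub> (v (a * b))"
      using G.vle_trans[of "\<one>\<^bsub>\<Gamma>\<^esub>" "v b" "v (a * b)"] v_closed[of b] v_closed[of "a * b"] F' False by simp
    then show ?thesis using F' unfolding valuation_ring_def by blast
  qed (use ab F' in \<open>auto simp: valuation_ring_def\<close>)
qed

lemma ring_uminus: "a \<in> R \<Longrightarrow> - a \<in> R"
  using v_uminus is_subfieldD(7)[OF F] unfolding valuation_ring_def by auto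

lemma ring_subring: "is_subring R"
  unfolding is_subring_def
proof (intro conjI ballI)
  have "vle \<Gamma> \<one>\<^bsub>\<Gamma>\<^esub> \<one>\<^bsub>\<Gamma>\<^esub>" using G.vle_total by blast
  then show "1 \<in> R" unfolding valuation_ring_def using v_1 is_subfieldD(1)[OF F] by simp
  show "a - b \<in> R" if "a \<in> R" "b \<in> R" for a b
    using ring_add[OF that(1) ring_uminus[OF that(2)]] by simp
qed (rule ring_mult)

lemma ideal_subset: "M \<subseteq> R"
  unfolding valuation_ideal_def valuation_ring_def by blast

lemma ideal_iff: "a \<in> M \<longleftrightarrow> a \<in> F \<and> (a = 0 \<or> \<not> vle \<Gamma> (v a) \<one>\<^bsub>\<Gamma>\<^esub>)"
proof (cases "a \<in> F \<and> a \<noteq> 0")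
  case True
  then have "v a \<in> carrier \<Gamma>" using v_closed by blast
  then have "vle \<Gamma> \<one>\<^bsub>\<Gamma>\<^esub> (v a) \<and> v a \<noteq> \<one>\<^bsub>\<Gamma>\<^esub> \<longleftrightarrow> \<not> vle \<Gamma> (v a) \<one>\<^bsub>\<Gamma>\<^esub>"
    using G.vle_total[of "v a" "\<one>\<^bsub>\<Gamma>\<^esub>"] G.vle_antisym[of "v a" "\<one>\<^bsub>\<Gamma>\<^esub>"] by auto
  then show ?thesis using True unfolding valuation_ideal_def by blast
qed (auto simp: valuation_ideal_def)

lemma ideal: "is_ideal_of M R"
  unfolding is_ideal_of_def
proof (intro conjI ballI)
  show "0 \<in> M" unfolding valuation_ideal_def using is_subfieldD(2)[OF F] by simp
  show "M \<subseteq> R" by (rule ideal_subset)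
  fix b assume b: "b \<in> M"
  then have bF: "b \<in> F" by (simp add: ideal_iff)
  show "a + b \<in> M" if a: "a \<in> M" for a
  proof (cases "a = 0 \<or> b = 0 \<or> a + b = 0")
    case True
    then show ?thesis using a b is_subfieldD(2)[OF F] by (auto simp: ideal_iff)
  next
    case False
    have F': "a \<in> F" "a + b \<in> F" using a bF is_subfieldD(4)[OF F] by (auto simp: ideal_iff)
    have "\<not> vle \<Gamma> (v (a + b)) \<one>\<^bsub>\<Gamma>\<^esub>"
    proof
      assume *: "vle \<Gamma> (v (a + b)) \<one>\<^bsub>\<Gamma>\<^esub>"
      have "vle \<Gamma> (v a) \<one>\<^bsub>\<Gamma>\<^esub> \<or> vle \<Gamma> (v b) \<one>\<^bsub>\<Gamma>\<^esub>"
        using v_add[of a b] G.vle_trans[OF _ _ _ _ *] v_closed F' bF False by blast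
      then show False using a b False by (simp add: ideal_iff)
    qed
    then show ?thesis using F' by (simp add: ideal_iff)
  qed
  show "a * b \<in> M" if a: "a \<in> R" for a
  proof (cases "a = 0 \<or> b = 0")
    case True
    then show ?thesis using is_subfieldD(2)[OF F] by (auto simp: ideal_iff)
  next
    case False
    have F': "a \<in> F" "a * b \<in> F" using a bF is_subfieldD(5)[OF F] by (auto simp: valuation_ring_def)
    have "\<not> vle \<Gamma> (v (a * b)) \<one>\<^bsub>\<Gamma>\<^esub>"
    proof
      assume *: "vle \<Gamma> (v (a * b)) \<one>\<^bsub>\<Gamma>\<^esub>"
      have "vle \<Gamma> (v b) (v (a * b))" using ring_mult_ge[OF a _ bF] False by blast
      then have "vle \<Gamma> (v b) \<one>\<^bsub>\<Gamma>\<^esub>"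
        using G.vle_trans[of "v b" "v (a * b)" "\<one>\<^bsub>\<Gamma>\<^esub>"] * v_closed[of b] v_closed[of "a * b"] F' bF False by simp
      then show False using b False by (simp add: ideal_iff)
    qed
    then show ?thesis using F' by (simp add: ideal_iff)
  qed
qed

lemma one_notin_ideal: "1 \<notin> M"
  unfolding valuation_ideal_def using v_1 by simp

lemma inverse_ideal: "a \<in> F \<Longrightarrow> a \<notin> R \<Longrightarrow> inverse a \<in> M"
proof -
  assume a: "a \<in> F" "a \<notin> R"
  then have a0: "a \<noteq> 0" "\<not> vle \<Gamma> \<one>\<^bsub>\<Gamma>\<^esub> (v a)" unfolding valuation_ring_def by auto
  have "inverse a \<in> F" using a(1) is_subfieldD(6)[OF F] by blast
  moreover have "vle \<Gamma> (v (inverse a)) \<one>\<^bsub>\<Gamma>\<^esub> \<longleftrightarrow> vle \<Gamma> \<one>\<^bsub>\<Gamma>\<^esub> (v a)"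
  proof -
    have "1 / inverse a = a" by (simp add: divide_inverse)
    then show ?thesis using vle_iff[of "inverse a" 1] a0(1) calculation is_subfieldD(1)[OF F] v_1 by simp
  qed
  ultimately show ?thesis using a0 by (simp add: ideal_iff)
qed

text \<open>\<open>W\<close> cannot contain more of \<open>F\<close> than \<open>R\<close>: an
  element of \<open>F\<close> outside \<open>R\<close> has its inverse in \<open>M\<close>, which
  consists of nonunits of \<open>W\<close>.\<close>

lemma valuation_ring_extension:
  "\<exists>W. valuation_subring W \<and> W \<inter> F = R \<and> (\<forall>a\<in>M. \<not> wle W a 1)"
proof -
  obtain W where W: "valuation_subring W" "R \<subseteq> W" "\<forall>a\<in>M. \<not> wle W a 1"
    using valuation_subring_exists[OF ring_subring ideal one_notin_ideal] by blast
  interpret W: valuation_subring W by (fact W(1))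
  have "a \<in> R" if "a \<in> W" "a \<in> F" for a
  proof (rule ccontr)
    assume "a \<notin> R"
    then have "\<not> wle W (inverse a) 1" using inverse_ideal[OF that(2)] W(3) by blast
    moreover have "a \<noteq> 0" using \<open>a \<notin> R\<close> is_subringD(2)[OF ring_subring] by blast
    ultimately show False using that(1) by (simp add: W.le_one_iff)
  qed
  moreover have "R \<subseteq> F" unfolding valuation_ring_def by blast
  ultimately show ?thesis using W by blast
qed

lemma extends_class_group:
  assumes V: "valuation_subring V" "V \<inter> F = R"
  shows "extends_valuation F \<Gamma> v (class_group V) (value_class V)"
proof -
  interpret V: valuation_subring V by (fact V(1))
  have le: "vle \<Gamma> (v a) (v b) \<longleftrightarrow> wle V a b" if "a \<in> F - {0}" "b \<in> F - {0}" for a b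
  proof -
    have "b / a \<in> F" "b / a \<noteq> 0" using that is_subfieldD(8)[OF F] by auto
    then have "vle \<Gamma> (v a) (v b) \<longleftrightarrow> b / a \<in> R"
      using vle_iff[of a b] that unfolding valuation_ring_def by simp
    also have "\<dots> \<longleftrightarrow> wle V a b" using V(2) \<open>b / a \<in> F\<close> that V.le_iff[of a b] by blast
    finally show ?thesis .
  qed
  \<comment> \<open>Any element with the given value may be chosen, since elements of
    \<open>F\<close> of equal value divide each other in \<open>V\<close>.\<close>
  define \<iota> where "\<iota> g = value_class V (SOME a. a \<in> F - {0} \<and> v a = g)" for g
  have iota: "\<iota> (v a) = value_class V a" if a: "a \<in> F - {0}" for a
  proof -
    let ?b = "SOME b. b \<in> F - {0} \<and> v b = v a"
    have b: "?b \<in> F - {0} \<and> v ?b = v a" using a by (intro someI[of "\<lambda>b. b \<in> F - {0} \<and> v b = v a" a]) blast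
    have "wle V ?b a" "wle V a ?b"
      using b le[of ?b a] le[of a ?b] a le[of a a] by auto
    then show ?thesis unfolding \<iota>_def V.value_class_eq_iff by blast
  qed
  have rep: "\<exists>a. a \<in> F - {0} \<and> g = v a" if "g \<in> carrier \<Gamma>" for g using that image by blast
  show ?thesis
    unfolding extends_valuation_def
  proof (intro bexI[of _ \<iota>] conjI ballI)
    show "value_class V a = \<iota> (v a)" if "a \<in> F - {0}" for a using iota[OF that] by simp
    show "vle \<Gamma> g h \<longleftrightarrow> vle (class_group V) (\<iota> g) (\<iota> h)" if g: "g \<in> carrier \<Gamma>" and h: "h \<in> carrier \<Gamma>" for g h
    proof -
      obtain a where "a \<in> F - {0}" "g = v a" using rep[OF g] by blast
      moreover obtain b where "b \<in> F - {0}" "h = v b" using rep[OF h] by blast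
      ultimately show ?thesis using iota le by (simp add: V.class_group_simps)
    qed
    show "\<iota> \<in> hom \<Gamma> (class_group V)"
    proof (rule homI)
      fix g h assume gh: "g \<in> carrier \<Gamma>" "h \<in> carrier \<Gamma>"
      obtain a b where ab: "a \<in> F - {0}" "g = v a" "b \<in> F - {0}" "h = v b"
        using rep[OF gh(1)] rep[OF gh(2)] by blast
      show "\<iota> g \<in> carrier (class_group V)" using ab iota by (auto simp: V.class_group_simps)
      have "a * b \<in> F - {0}" using ab is_subfieldD(5)[OF F] by auto
      moreover have "g \<otimes>\<^bsub>\<Gamma>\<^esub> h = v (a * b)" using v_mult[of a b] ab by simp
      ultimately show "\<iota> (g \<otimes>\<^bsub>\<Gamma>\<^esub> h) = \<iota> g \<otimes>\<^bsub>class_group V\<^esub> \<iota> h"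
        using iota ab by (simp add: V.class_group_simps)
    qed
  qed
qed

end

lemma countable_generators:
  assumes K: "is_subfield K" and gen: "countably_generated_extension K K1"
  shows "\<exists>s :: nat \<Rightarrow> 'a::field. (\<forall>n. s n \<in> K1) \<and> (\<forall>n. s n \<noteq> 0) \<and>
    (\<forall>E. is_subfield E \<longrightarrow> K \<subseteq> E \<longrightarrow> range s \<subseteq> E \<longrightarrow> K1 \<subseteq> E)"
proof -
  obtain S where S: "countable S" "K1 = field_adjoin K S" using gen unfolding countably_generated_extension_def by blast
  \<comment> \<open>The element \<open>1\<close> makes the set nonempty, so that even a finite one
    is listed with repetitions; removing \<open>0\<close> permits division by the
    \<open>s n\<close>. The generated field stays the same.\<close>
  let ?S = "insert 1 (S - {0})"
  have "countable ?S" using S(1) by simp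
  then have r: "range (from_nat_into ?S) = ?S" by (intro range_from_nat_into) auto
  have K1F: "is_subfield K1" unfolding S(2) by (rule field_adjoin_subfield)
  have "S \<subseteq> K1" unfolding S(2) by (rule field_adjoin_incl(2))
  then have SK: "?S \<subseteq> K1" using is_subfieldD(1)[OF K1F] by blast
  show ?thesis
  proof (intro exI[of _ "from_nat_into ?S"] conjI allI impI)
    have m: "from_nat_into ?S n \<in> ?S" for n by (rule from_nat_into) simp
    show "from_nat_into ?S n \<in> K1" for n using m[of n] SK by blast
    show "from_nat_into ?S n \<noteq> 0" for n using m[of n] by auto
    fix E assume E: "is_subfield E" "K \<subseteq> E" "range (from_nat_into ?S) \<subseteq> E"
    then have "S \<subseteq> E" unfolding r using is_subfieldD(2)[OF E(1)] by blast
    then show "K1 \<subseteq> E" unfolding S(2) using E by (intro field_adjoin_least) auto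
  qed
qed

theorem theorem1p3:
  fixes K K1 :: "'a::alg_closed_field set"
    and x :: 'a
    and \<Gamma> :: "'g value_group"
    and v :: "'a \<Rightarrow> 'g"
  assumes "separable_algebraic_extension K K1"
    and "countably_generated_extension K K1"
    and "valuation_on K1 \<Gamma> v"
    and "nontrivial_on K \<Gamma> v"
    and "\<not> algebraic_over K x"
    and "\<forall>y::'a. algebraic_over (field_adjoin K {x}) y"
  shows "\<exists>(\<Delta> :: 'a set value_group) (w :: 'a \<Rightarrow> 'a set).
           valuation_on UNIV \<Delta> w \<and> extends_valuation K1 \<Gamma> v \<Delta> w \<and>
           henselization \<Delta> w K1 = implicit_constant_field \<Delta> w K x"
proof -
  have K: "is_subfield K" and K1: "is_subfield K1" "K \<subseteq> K1" and sep: "\<And>b. b \<in> K1 \<Longrightarrow> separable_over K b"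
    using assms(1) unfolding separable_algebraic_extension_def by blast+
  have sep': "\<forall>b\<in>K1. separable_over K b" using sep by blast
  interpret transcendental_extension K x using K assms(5,6) by unfold_locales auto
  interpret v: valued_field K1 \<Gamma> v using assms(3) by unfold_locales
  obtain W where W: "valuation_subring W" "W \<inter> K1 = v.R" "\<forall>a\<in>v.M. \<not> wle W a 1"
    using v.valuation_ring_extension by blast
  obtain t where t: "t \<in> K" "t \<noteq> 0" "\<not> wle W t 1"
  proof -
    \<comment> \<open>Either \<open>u\<close> or its inverse has positive value, and both lie in
      \<open>K\<close>, as cofinality requires.\<close>
    obtain u where u: "u \<in> K" "u \<noteq> 0" "v u \<noteq> \<one>\<^bsub>\<Gamma>\<^esub>" using assms(4) unfolding nontrivial_on_def by blast
    show ?thesis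
    proof (cases "u \<in> v.R")
      case True
      then have "u \<in> v.M" using u(2,3) unfolding valuation_ring_def valuation_ideal_def by blast
      then show ?thesis using that[of u] u W(3) by blast
    next
      case False
      then have "inverse u \<in> v.M" using v.inverse_ideal u(1) K1(2) by blast
      then show ?thesis using that[of "inverse u"] u W(3) is_subfieldD(6)[OF K] by simp
    qed
  qed
  obtain s where s: "\<And>n::nat. s n \<in> K1" "\<And>n. s n \<noteq> 0"
    and gen: "\<And>E. is_subfield E \<Longrightarrow> K \<subseteq> E \<Longrightarrow> range s \<subseteq> E \<Longrightarrow> K1 \<subseteq> E"
    using countable_generators[OF K assms(2)] by blast
  obtain a where a: "\<forall>n. a n \<in> K1" "\<forall>n. \<exists>d\<in>K - {0}. a (Suc n) = a n + d * s n"
    "\<forall>n. \<not> wle W (a (Suc (Suc n)) - a (Suc n)) (a (Suc n) - a n)"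
    "\<forall>n. \<exists>m. is_minpoly K (a n) m \<and> rsquarefree m \<and>
      (\<forall>b. poly m b = 0 \<longrightarrow> b \<noteq> a n \<longrightarrow> \<not> wle W (a (Suc n) - a n) (a n - b))"
    using krasner_sequence[OF K K1 sep' W(1) t, of s, OF s] by (elim exE conjE) (rule that)
  interpret W: valuation_subring W by (fact W(1))
  interpret D: krasner_data K x W K1 s a
    using K1 sep gen s(1) a by unfold_locales auto
  obtain V where V: "valuation_subring V" "V \<inter> cl = W \<inter> cl" "K1 \<subseteq> hensel_hull V (field_adjoin K {x})"
    "\<forall>c\<in>cl. c \<in> K1 \<or> (\<exists>b\<in>K1. \<not> wle V (x - b) (b - c))"
    using D.placement by (elim exE conjE) (rule that)
  have "V \<inter> K1 = v.R" using V(2) W(2) D.K1_cl by blast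
  moreover have "hensel_hull V K1 = relative_algebraic_closure K (hensel_hull V (field_adjoin K {x}))"
    using implicit_constants[OF V(1) K1 D.K1_cl V(3)] V(4) by blast
  ultimately show ?thesis
    using valuation_subring.valuation_on_value_class[OF V(1)] v.extends_class_group[OF V(1)]
    unfolding implicit_constant_field_def henselization_eq_hull[OF V(1)]
    by (intro exI[of _ "class_group V"] exI[of _ "value_class V"])
      (simp add: implicit_constant_field_def henselization_eq_hull[OF V(1)])
qed

end
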